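(* The min-cost popular instance problem is NP-hard, even when each preference list has length at most 2. Further, the hardness holds even when the preference lists are derived from a master list.
   Context: Popular matchings: a preference instance is a bipartite graph $G=(\mathcal{A}\cup\mathcal{B},E)$ with $\mathcal{A}$ a set of people and $\mathcal{B}$ a set of items; each person ranks the items adjacent to her in order of preference (ties allowed); each item $b$ has a number $\mathsf{copies}(b)$ of copies. A matching $M$ assigns each person at most one acceptable item such that each item $b$ is assigned to at most $\mathsf{copies}(b)$ people; $M(a)$ is the item assigned to $a$. A person $a$ prefers $M$ to $M'$ if $a$ is matched in $M$ and unmatched in $M'$, or matched in both and prefers $M(a)$ to $M'(a)$. $M$ is more popular than $M'$ if more people prefer $M$ to $M'$ than prefer $M'$ to $M$; $M$ is popular if no matching is more popular than $M$. Min-cost popular instance problem: the input is a set $\mathcal{A}$ of people, each with a preference list over a universe $U$ of items, and a price $\mathsf{cost}(b)\ge 0$ for each $b\in U$. One must choose integers $\mathsf{copies}(b)\ge 0$ for $b\in U$ (the items with $\mathsf{copies}(b)>0$ form $\mathcal{B}$, and each person's list is restricted to them, ranks being determined by the relative order among present items) such that the resulting instance admits a popular matching that matches every person of $\mathcal{A}$, minimizing the cost $\sum_{b\in U}\mathsf{copies}(b)\,\mathsf{cost}(b)$. Preference lists are derived from a master list if there is a total order on the items such that each person's list is strict and, whenever $b$ precedes $b'$ in the master list and both are on a person's list, $b$ precedes $b'$ on that list. *)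

theory Defs
  imports Complex_Main "HOL-Computational_Algebra.Polynomial"
begin

section \<open>Multi-tape Turing machines\<close>

text \<open>
  Symbols and states are natural numbers.  Symbol 0 is the blank; a bit string is written on a
  tape from cell 0 onwards, with 1 for \<open>False\<close> and 2 for \<open>True\<close>.  A machine with
  \<open>n = nstates M\<close> has the working states \<open>0, ..., n - 1\<close> (state 0 is initial), the accepting
  halting state \<open>n\<close> and the rejecting halting state \<open>n + 1\<close>.
\<close>

datatype dir = Go_Left | Stay | Go_Right

record tm =
  ntapes :: nat
  nstates :: nat
  nsymbols :: nat
  delta :: "nat \<Rightarrow> nat list \<Rightarrow> nat \<times> (nat \<times> dir) list"

definition wf_tm :: "tm \<Rightarrow> bool" where
  "wf_tm M \<longleftrightarrow> ntapes M \<ge> 2 \<and> nsymbols M \<ge> 3 \<and>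
     (\<forall>q < nstates M. \<forall>ss. length ss = ntapes M \<and> set ss \<subseteq> {..<nsymbols M} \<longrightarrow>
        (case delta M q ss of (q', as) \<Rightarrow>
           q' \<le> nstates M + 1 \<and> length as = ntapes M \<and> fst ` set as \<subseteq> {..<nsymbols M}))"

text \<open>A tape is two-way infinite and consists of its contents and its head position.\<close>

type_synonym tape = "(int \<Rightarrow> nat) \<times> int"
type_synonym config = "nat \<times> tape list"

fun move :: "dir \<Rightarrow> int \<Rightarrow> int" where
  "move Go_Left h = h - 1"
| "move Stay h = h"
| "move Go_Right h = h + 1"

fun read :: "tape \<Rightarrow> nat" where
  "read (c, h) = c h"

fun act :: "nat \<times> dir \<Rightarrow> tape \<Rightarrow> tape" where
  "act (s, d) (c, h) = (c(h := s), move d h)"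

fun step :: "tm \<Rightarrow> config \<Rightarrow> config" where
  "step M (q, ts) =
     (if q < nstates M
      then (case delta M q (map read ts) of (q', as) \<Rightarrow> (q', map2 act as ts))
      else (q, ts))"

definition contents_of :: "bool list \<Rightarrow> int \<Rightarrow> nat" where
  "contents_of xs i =
     (if 0 \<le> i \<and> i < int (length xs) then (if xs ! nat i then 2 else 1) else 0)"

text \<open>The first tapes hold the inputs; all further tapes are blank.\<close>

definition init :: "tm \<Rightarrow> bool list list \<Rightarrow> config" where
  "init M inputs =
     (0, map (\<lambda>i. (contents_of (if i < length inputs then inputs ! i else []), 0)) [0..<ntapes M])"

definition run :: "tm \<Rightarrow> bool list list \<Rightarrow> nat \<Rightarrow> config" where
  "run M inputs t = (step M ^^ t) (init M inputs)"

definition halted :: "tm \<Rightarrow> config \<Rightarrow> bool" where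
  "halted M c \<longleftrightarrow> fst c \<ge> nstates M"

definition accepting :: "tm \<Rightarrow> config \<Rightarrow> bool" where
  "accepting M c \<longleftrightarrow> fst c = nstates M"


section \<open>Polynomial time, NP and NP-hardness\<close>

text \<open>The input is on the first tape, the output is left on the second one.\<close>

definition polytime_computable :: "(bool list \<Rightarrow> bool list) \<Rightarrow> bool" where
  "polytime_computable f \<longleftrightarrow>
     (\<exists>M (p :: nat poly). wf_tm M \<and>
        (\<forall>x. let c = run M [x] (poly p (length x)) in
             halted M c \<and> fst (snd c ! 1) = contents_of (f x)))"

text \<open>A polynomial-time verifier gets the input on the first tape and a certificate of
  polynomially bounded length on the second one.\<close>

definition NP :: "bool list set set" where
  "NP = {L. \<exists>M (p :: nat poly) (r :: nat poly). wf_tm M \<and>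
     (\<forall>x. (\<forall>u. length u \<le> poly r (length x) \<longrightarrow> halted M (run M [x, u] (poly p (length x)))) \<and>
          (x \<in> L \<longleftrightarrow> (\<exists>u. length u \<le> poly r (length x) \<and>
                            accepting M (run M [x, u] (poly p (length x))))))}"

text \<open>
  A decision problem consists of a set \<open>D\<close> of instances, the yes-instances \<open>Y\<close> among them and a
  string encoding.  Reductions are polynomial-time many-one reductions whose values always
  encode instances in \<open>D\<close>, so that hardness for \<open>D\<close> entails hardness for every larger set of instances.
\<close>

definition NP_hard :: "('i \<Rightarrow> bool list) \<Rightarrow> 'i set \<Rightarrow> ('i \<Rightarrow> bool) \<Rightarrow> bool" where
  "NP_hard enc D Y \<longleftrightarrow>
     (\<forall>L \<in> NP. \<exists>f. polytime_computable f \<and>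
        (\<forall>x. f x \<in> enc ` D \<and> (x \<in> L \<longleftrightarrow> f x \<in> enc ` {I \<in> D. Y I})))"


section \<open>Popular matchings\<close>

text \<open>
  A preference list is the sequence of its tie classes, the most preferred one first.  People
  are the indices of a list of preference lists.
\<close>

type_synonym pref = "nat list list"

definition items_on :: "pref \<Rightarrow> nat set" where
  "items_on P = set (concat P)"

definition prefers_item :: "pref \<Rightarrow> nat \<Rightarrow> nat \<Rightarrow> bool" where
  "prefers_item P b b' \<longleftrightarrow> (\<exists>i j. i < j \<and> j < length P \<and> b \<in> set (P ! i) \<and> b' \<in> set (P ! j))"

definition matching :: "pref list \<Rightarrow> (nat \<Rightarrow> nat) \<Rightarrow> (nat \<Rightarrow> nat option) \<Rightarrow> bool" where
  "matching Ps copies M \<longleftrightarrow>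
     (\<forall>a b. M a = Some b \<longrightarrow> a < length Ps \<and> b \<in> items_on (Ps ! a)) \<and>
     (\<forall>b. card {a. M a = Some b} \<le> copies b)"

fun prefers_outcome :: "pref \<Rightarrow> nat option \<Rightarrow> nat option \<Rightarrow> bool" where
  "prefers_outcome P (Some b) None = True"
| "prefers_outcome P (Some b) (Some b') = prefers_item P b b'"
| "prefers_outcome P None _ = False"

definition voters :: "pref list \<Rightarrow> (nat \<Rightarrow> nat option) \<Rightarrow> (nat \<Rightarrow> nat option) \<Rightarrow> nat set" where
  "voters Ps M M' = {a. a < length Ps \<and> prefers_outcome (Ps ! a) (M a) (M' a)}"

definition more_popular :: "pref list \<Rightarrow> (nat \<Rightarrow> nat option) \<Rightarrow> (nat \<Rightarrow> nat option) \<Rightarrow> bool" where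
  "more_popular Ps M M' \<longleftrightarrow> card (voters Ps M M') > card (voters Ps M' M)"

definition popular :: "pref list \<Rightarrow> (nat \<Rightarrow> nat) \<Rightarrow> (nat \<Rightarrow> nat option) \<Rightarrow> bool" where
  "popular Ps copies M \<longleftrightarrow>
     matching Ps copies M \<and> \<not> (\<exists>M'. matching Ps copies M' \<and> more_popular Ps M' M)"


section \<open>The min-cost popular instance problem\<close>

text \<open>
  The universe of items is the set of indices of \<open>costs\<close>.  Prices are non-negative rationals, so
  that instances are finite objects, and \<open>budget\<close> is the threshold of the decision version.
\<close>

record mcpi =
  prefs :: "pref list"
  costs :: "rat list"
  budget :: rat

definition universe :: "mcpi \<Rightarrow> nat set" where
  "universe I = {..<length (costs I)}"

definition mcpi_instances :: "mcpi set" where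
  "mcpi_instances = {I.
     (\<forall>P \<in> set (prefs I). distinct (concat P) \<and> [] \<notin> set P \<and> items_on P \<subseteq> universe I) \<and>
     (\<forall>q \<in> set (costs I). q \<ge> 0) \<and> budget I \<ge> 0}"

text \<open>Restriction of a list to the items in \<open>B\<close>; tie classes that become empty disappear.\<close>

definition restrict_pref :: "nat set \<Rightarrow> pref \<Rightarrow> pref" where
  "restrict_pref B P = filter (\<lambda>c. c \<noteq> []) (map (filter (\<lambda>b. b \<in> B)) P)"

definition feasible :: "mcpi \<Rightarrow> (nat \<Rightarrow> nat) \<Rightarrow> bool" where
  "feasible I copies \<longleftrightarrow>
     (let Ps = map (restrict_pref {b \<in> universe I. copies b > 0}) (prefs I) in
      \<exists>M. popular Ps copies M \<and> (\<forall>a < length (prefs I). M a \<noteq> None))"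

definition total_cost :: "mcpi \<Rightarrow> (nat \<Rightarrow> nat) \<Rightarrow> rat" where
  "total_cost I copies = (\<Sum>b \<in> universe I. of_nat (copies b) * costs I ! b)"

definition mcpi_yes :: "mcpi \<Rightarrow> bool" where
  "mcpi_yes I \<longleftrightarrow> (\<exists>copies. feasible I copies \<and> total_cost I copies \<le> budget I)"

definition lists_at_most :: "nat \<Rightarrow> mcpi \<Rightarrow> bool" where
  "lists_at_most k I \<longleftrightarrow> (\<forall>P \<in> set (prefs I). length (concat P) \<le> k)"

definition precedes :: "'a list \<Rightarrow> 'a \<Rightarrow> 'a \<Rightarrow> bool" where
  "precedes xs b b' \<longleftrightarrow> (\<exists>i j. i < j \<and> j < length xs \<and> xs ! i = b \<and> xs ! j = b')"

text \<open>A total order on the finite universe is given as an enumeration \<open>ms\<close> of it.\<close>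

definition from_master_list :: "mcpi \<Rightarrow> bool" where
  "from_master_list I \<longleftrightarrow>
     (\<exists>ms. distinct ms \<and> set ms = universe I \<and>
        (\<forall>P \<in> set (prefs I). (\<forall>c \<in> set P. length c = 1) \<and>
           (\<forall>b \<in> items_on P. \<forall>b' \<in> items_on P. precedes ms b b' \<longrightarrow> prefers_item P b b')))"


section \<open>String encoding of instances\<close>

text \<open>Lists are self-delimiting: every entry is preceded by \<open>True\<close>, the end is marked by
  \<open>False\<close>.  Numbers are written in binary, least significant bit first.\<close>

definition enc_list :: "('a \<Rightarrow> bool list) \<Rightarrow> 'a list \<Rightarrow> bool list" where
  "enc_list f xs = concat (map (\<lambda>x. True # f x) xs) @ [False]"

fun bits :: "nat \<Rightarrow> bool list" where
  "bits n = (if n = 0 then [] else odd n # bits (n div 2))"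

declare bits.simps [simp del]

definition enc_nat :: "nat \<Rightarrow> bool list" where
  "enc_nat n = enc_list (\<lambda>b. [b]) (bits n)"

definition enc_rat :: "rat \<Rightarrow> bool list" where
  "enc_rat q = enc_nat (nat (fst (quotient_of q))) @ enc_nat (nat (snd (quotient_of q)))"

definition enc_mcpi :: "mcpi \<Rightarrow> bool list" where
  "enc_mcpi I =
     enc_list (enc_list (enc_list enc_nat)) (prefs I) @ enc_list enc_rat (costs I) @ enc_rat (budget I)"

definition self_delimiting :: "'a set \<Rightarrow> ('a \<Rightarrow> bool list) \<Rightarrow> bool" where
  "self_delimiting A f \<longleftrightarrow> (\<forall>x \<in> A. \<forall>y \<in> A. \<forall>s t. f x @ s = f y @ t \<longrightarrow> x = y \<and> s = t)"

lemma self_delimitingD: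
  "self_delimiting A f \<Longrightarrow> f x @ s = f y @ t \<Longrightarrow> x \<in> A \<Longrightarrow> y \<in> A \<Longrightarrow> x = y \<and> s = t"
  unfolding self_delimiting_def by blast

lemma enc_list_simps [simp]:
  "enc_list f [] = [False]"
  "enc_list f (x # xs) = True # f x @ enc_list f xs"
  by (simp_all add: enc_list_def)

lemma self_delimiting_list:
  assumes "self_delimiting A f"
  shows "self_delimiting (lists A) (enc_list f)"
proof -
  have "xs = ys \<and> s = t"
    if "enc_list f xs @ s = enc_list f ys @ t" "set xs \<subseteq> A" "set ys \<subseteq> A" for xs ys s t
    using that
  proof (induction xs arbitrary: ys)
    case Nil
    then show ?case by (cases ys) auto
  next
    case (Cons x xs)
    then obtain y zs where ys: "ys = y # zs" by (cases ys) auto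
    with Cons.prems have "f x @ enc_list f xs @ s = f y @ enc_list f zs @ t" "x \<in> A" "y \<in> A"
      by auto
    from self_delimitingD[OF assms this]
    have "x = y" "enc_list f xs @ s = enc_list f zs @ t" by auto
    with Cons.IH[of zs] Cons.prems ys show ?case by auto
  qed
  then show ?thesis
    unfolding self_delimiting_def lists_eq_set by simp
qed

lemma bits_inj: "bits m = bits n \<Longrightarrow> m = n"
proof (induction m arbitrary: n rule: less_induct)
  case (less m)
  show ?case
  proof (cases "m = 0 \<or> n = 0")
    case True
    with less.prems show ?thesis
      by (cases "m = 0"; cases "n = 0") (simp_all add: bits.simps[of m] bits.simps[of n] bits.simps[of 0])
  next
    case False
    with less.prems have eq: "odd m = odd n" "bits (m div 2) = bits (n div 2)"
      by (auto simp: bits.simps[of m] bits.simps[of n])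
    from False less.IH[of "m div 2" "n div 2"] eq have "m div 2 = n div 2" by simp
    with eq(1) show ?thesis by presburger
  qed
qed

lemma self_delimiting_nat: "self_delimiting UNIV enc_nat"
proof -
  have "self_delimiting (lists UNIV) (enc_list (\<lambda>b :: bool. [b]))"
    by (rule self_delimiting_list) (simp add: self_delimiting_def)
  note sd = self_delimitingD[OF this]
  have "x = y \<and> s = t" if "enc_nat x @ s = enc_nat y @ t" for x y s t
  proof -
    have "bits x = bits y \<and> s = t"
      by (rule sd[OF that[unfolded enc_nat_def]]) simp_all
    then show ?thesis by (intro conjI bits_inj) (elim conjE, assumption)+
  qed
  then show ?thesis
    unfolding self_delimiting_def by blast
qed

lemma self_delimiting_rat: "self_delimiting {0..} enc_rat"
  unfolding self_delimiting_def
proof (intro ballI allI impI)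
  fix x y :: rat and s t
  assume nonneg: "x \<in> {0..}" "y \<in> {0..}" and "enc_rat x @ s = enc_rat y @ t"
  then have enc: "enc_nat (nat (fst (quotient_of x))) @ enc_nat (nat (snd (quotient_of x))) @ s =
      enc_nat (nat (fst (quotient_of y))) @ enc_nat (nat (snd (quotient_of y))) @ t"
    by (simp add: enc_rat_def)
  note sd = self_delimitingD[OF self_delimiting_nat _ UNIV_I UNIV_I]
  from sd[OF enc] have eq1: "nat (fst (quotient_of x)) = nat (fst (quotient_of y))"
    and enc': "enc_nat (nat (snd (quotient_of x))) @ s = enc_nat (nat (snd (quotient_of y))) @ t"
    by simp_all
  from sd[OF enc'] have eq2: "nat (snd (quotient_of x)) = nat (snd (quotient_of y))" "s = t"
    by simp_all
  have pos: "snd (quotient_of x) > 0" "snd (quotient_of y) > 0"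
    by (simp_all add: quotient_of_denom_pos')
  have "fst (quotient_of z) \<ge> 0" if "z \<ge> 0" for z :: rat
  proof -
    have "z = of_int (fst (quotient_of z)) / of_int (snd (quotient_of z))"
      by (rule quotient_of_div) simp
    moreover have "(of_int (snd (quotient_of z)) :: rat) > 0"
      by (simp add: quotient_of_denom_pos')
    ultimately have "\<not> (of_int (fst (quotient_of z)) :: rat) < 0"
      using that divide_neg_pos[of "of_int (fst (quotient_of z)) :: rat"] by fastforce
    then show ?thesis by simp
  qed
  with nonneg have "fst (quotient_of x) \<ge> 0" "fst (quotient_of y) \<ge> 0" by auto
  with eq1 eq2 pos have "quotient_of x = quotient_of y" by (auto intro: prod_eqI)
  then show "x = y \<and> s = t" using eq2 by (simp add: quotient_of_inject)
qed

text \<open>Instances can be recovered from their encodings.\<close>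

lemma inj_on_enc_mcpi: "inj_on enc_mcpi mcpi_instances"
proof (rule inj_onI)
  fix I J
  assume D: "I \<in> mcpi_instances" "J \<in> mcpi_instances" and eq: "enc_mcpi I = enc_mcpi J"
  have mem: "costs I \<in> lists {0..}" "costs J \<in> lists {0..}" "budget I \<in> {0..}" "budget J \<in> {0..}"
    using D by (auto simp: mcpi_instances_def)
  have sd: "self_delimiting (lists (lists (lists UNIV))) (enc_list (enc_list (enc_list enc_nat)))"
    by (intro self_delimiting_list self_delimiting_nat)
  have "prefs I = prefs J \<and>
      enc_list enc_rat (costs I) @ enc_rat (budget I) = enc_list enc_rat (costs J) @ enc_rat (budget J)"
    by (rule self_delimitingD[OF sd eq[unfolded enc_mcpi_def]]) simp_all
  moreover from this have "costs I = costs J \<and> enc_rat (budget I) = enc_rat (budget J)"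
    by (intro self_delimitingD[OF self_delimiting_list[OF self_delimiting_rat] _ mem(1,2)]) simp
  moreover from this have "budget I = budget J"
    using self_delimitingD[OF self_delimiting_rat, of "budget I" "[]" "budget J" "[]"] mem by simp
  ultimately show "I = J" by simp
qed

end

theory Submission
  imports Defs
begin

text \<open>
  Let every list have length at most two, and let every item that occurs be the whole list of some
  person. Call an item high if somebody gets it as a second choice. In a popular matching that
  matches everybody, a high item is given to all people who rank it first: otherwise such a person
  and one who has the item as a second choice could both be promoted at the expense of a single third
  person. Conversely every set of high items yields a popular matching with this property. So the minimal cost is
  the minimum over sets \<open>H\<close> of high items of the sum of the prices paid, and each person pays the
  cheaper price iff \<open>u \<notin> H\<close> and \<open>v \<in> H\<close>. A person \<open>[u, v]\<close> together with a person \<open>[v, w]\<close>, where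
  \<open>w\<close> has the price \<open>2 * price v - price u\<close>, pays a constant plus \<open>price u - price v\<close> if both
  \<open>u\<close> and \<open>v\<close> are high. Conflicts of this kind express that the high items select one tile for each
  cell of a tableau of the verifier, with compatible tiles in neighbouring cells; prices
  decrease along every list, hence the lists come from a master list.

  All blocks of people have the same optimal price, so that the budget is that price times the number
  of blocks, a fixed number followed by zeros in binary. The instance can therefore be written
  by nested loops over counters in binary, which a small while language with a translation to
  Turing machines makes precise.
\<close>


section \<open>Popularity with lists of length at most two\<close>

text \<open>An edge gadget needs \<open>price v < price u \<le> 2 * price v\<close>, and prices
  depend on the code of an item only, so one item per tile could not express a conflict between
  equal tiles of two cells. Hence every cell has two items per tile, \<open>X\<close> with prices
  from \<open>6 * K\<close> and \<open>Y\<close> with prices from \<open>4 * K\<close>. Conflicts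
  lead from an \<open>X\<close> of the first cell to a \<open>Y\<close> of the second, and the pair
  of a cell with itself forces both selections to agree. Prices step by 2, so that a second high
  item loses more than the one unit that a high item gains. Conditions on the initial row are people
  with a second choice of price 0, which leave the budget untouched.

  The other obstacle is that an actual machine has to write the instance. The people of a block
  depend only on the class of a pair of cells, which a finite automaton computes from the digits of
  the counter, so finitely many fixed texts suffice. The side of the tableau is a power of two: then
  a counter with a fixed number of digits runs through all pairs of cells, and the low bits of the
  number of an item are copied from that counter.\<close>

definition strict_pref :: "nat list \<Rightarrow> pref" where
  "strict_pref us = map (\<lambda>b. [b]) us"

definition pair_lists :: "nat list list \<Rightarrow> bool" where
  "pair_lists as \<longleftrightarrow> (\<forall>us \<in> set as. (\<exists>u. us = [u]) \<or>
     (\<exists>u v. us = [u, v] \<and> u \<noteq> v \<and> [u] \<in> set as \<and> [v] \<in> set as))"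

definition choice :: "nat set \<Rightarrow> nat list \<Rightarrow> nat" where
  "choice H us = (if length us = 2 \<and> us ! 0 \<notin> H \<and> us ! 1 \<in> H then us ! 1 else us ! 0)"

lemma items_on_strict_pref [simp]: "items_on (strict_pref us) = set us"
  by (simp add: items_on_def strict_pref_def)

lemma prefers_item_strict_pref [simp]:
  "\<not> prefers_item (strict_pref [u]) b b'"
  "prefers_item (strict_pref [u, v]) b b' \<longleftrightarrow> b = u \<and> b' = v"
proof -
  show "\<not> prefers_item (strict_pref [u]) b b'"
    by (simp add: prefers_item_def strict_pref_def)
  show "prefers_item (strict_pref [u, v]) b b' \<longleftrightarrow> b = u \<and> b' = v"
  proof
    assume "b = u \<and> b' = v"
    then show "prefers_item (strict_pref [u, v]) b b'"
      unfolding prefers_item_def strict_pref_def by (intro exI[of _ 0] exI[of _ 1]) simp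
  qed (auto simp: prefers_item_def strict_pref_def less_Suc_eq)
qed

lemma restrict_strict_pref: "set us \<subseteq> B \<Longrightarrow> restrict_pref B (strict_pref us) = strict_pref us"
  by (induction us) (auto simp: restrict_pref_def strict_pref_def)

lemma pair_listsE:
  assumes "pair_lists as" "a < length as"
  obtains u where "as ! a = [u]" | u v where "as ! a = [u, v]" "u \<noteq> v"
  using assms unfolding pair_lists_def by (metis nth_mem)

lemma pair_lists_singleton:
  assumes "pair_lists as" "a < length as" "u \<in> set (as ! a)"
  shows "\<exists>a'<length as. as ! a' = [u]"
proof -
  have "[u] \<in> set as"
    using assms nth_mem[OF assms(2)] unfolding pair_lists_def by fastforce
  then show ?thesis by (auto simp: in_set_conv_nth)
qed

text \<open>Whoever prefers another matching receives a low item \<open>u\<close> there. All copies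
  of \<open>u\<close> are in use, so at least as many people lose \<open>u\<close> as gain it; a low
  item is only ever held as a first choice, hence each of the losers votes against. Summing over
  \<open>u\<close> balances the votes.\<close>

lemma feasible_choice:
  fixes H :: "nat set" and as :: "nat list list"
  assumes pl: "pair_lists as" and prefs: "prefs I = map strict_pref as"
    and uni: "\<forall>us \<in> set as. set us \<subseteq> universe I"
  defines "copies \<equiv> \<lambda>b. card {a. a < length as \<and> choice H (as ! a) = b}"
  shows "feasible I copies"
proof -
  define n where "n = length as"
  define M where "M = (\<lambda>a. if a < n then Some (choice H (as ! a)) else None)"
  have choice_in: "choice H (as ! a) \<in> set (as ! a)" if "a < n" for a
    using pl that[unfolded n_def] by (cases rule: pair_listsE) (auto simp: choice_def)
  have fin: "finite {a. a < n \<and> P a}" for P by (rule finite_subset[of _ "{..<n}"]) auto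
  have Minv: "{a. M a = Some b} = {a. a < n \<and> choice H (as ! a) = b}" for b
    by (auto simp: M_def)
  \<comment> \<open>The owner of the list \<open>[b]\<close> takes a copy of \<open>b\<close>, so
    restricting the lists to the present items changes nothing.\<close>
  have present: "0 < copies b" if "a < n" "b \<in> set (as ! a)" for a b
  proof -
    from pair_lists_singleton[OF pl] that obtain a' where "a' < n" "as ! a' = [b]"
      unfolding n_def by blast
    then have "a' \<in> {a. a < n \<and> choice H (as ! a) = b}" by (simp add: choice_def)
    then have "card {a. a < n \<and> choice H (as ! a) = b} \<noteq> 0"
      unfolding card_0_eq[OF fin] by (rule ex_in_conv[THEN iffD1, OF exI])
    then show ?thesis unfolding copies_def n_def by (simp only: neq0_conv)
  qed
  have Ps: "map (restrict_pref {b \<in> universe I. copies b > 0}) (prefs I) = map strict_pref as"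
    unfolding prefs map_map o_def
  proof (rule map_cong[OF refl])
    fix us assume us: "us \<in> set as"
    then obtain a where "a < n" "us = as ! a" by (auto simp: in_set_conv_nth n_def)
    have "set us \<subseteq> {b \<in> universe I. 0 < copies b}"
      using present[OF \<open>a < n\<close>] bspec[OF uni us] unfolding \<open>us = as ! a\<close> by blast
    then show "restrict_pref {b \<in> universe I. 0 < copies b} (strict_pref us) = strict_pref us"
      by (rule restrict_strict_pref)
  qed
  have mM: "matching (map strict_pref as) copies M"
    unfolding matching_def Minv
  proof (intro conjI allI impI)
    fix a b assume "M a = Some b"
    then have a: "a < n" "b = choice H (as ! a)" by (auto simp: M_def split: if_splits)
    then show "a < length (map strict_pref as)" by (simp add: n_def)
    show "b \<in> items_on (map strict_pref as ! a)" using a choice_in[of a] by (simp add: n_def)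
  qed (simp add: copies_def n_def)
  have "\<not> more_popular (map strict_pref as) M' M" if m': "matching (map strict_pref as) copies M'" for M'
  proof -
    define G where "G = voters (map strict_pref as) M' M"
    define D where "D = voters (map strict_pref as) M M'"
    define Gu where "Gu = (\<lambda>u. {a \<in> G. M' a = Some u})"
    define Du where "Du = (\<lambda>u. {a. M a = Some u \<and> M' a \<noteq> Some u})"
    have M'in: "a < n \<and> b \<in> set (as ! a)" if "M' a = Some b" for a b
    proof -
      have "a < length (map strict_pref as) \<and> b \<in> items_on (map strict_pref as ! a)"
        using m' that unfolding matching_def by blast
      then show ?thesis by (auto simp: n_def)
    qed
    have G: "\<exists>u v. as ! a = [u, v] \<and> M a = Some v \<and> M' a = Some u \<and> u \<notin> H \<and> v \<in> H \<and> a < n \<and> u \<noteq> v"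
      if "a \<in> G" for a
    proof -
      have a: "a < length as" and p: "prefers_outcome (strict_pref (as ! a)) (M' a) (M a)"
        using that by (auto simp: G_def voters_def)
      have "M a = Some (choice H (as ! a))" using a by (simp add: M_def n_def)
      with p obtain b where b: "M' a = Some b" "prefers_item (strict_pref (as ! a)) b (choice H (as ! a))"
        by (cases "M' a") auto
      from pl a show ?thesis
      proof (cases rule: pair_listsE)
        case (1 u)
        with b show ?thesis by simp
      next
        case (2 u v)
        with b a show ?thesis by (auto simp: M_def n_def choice_def split: if_splits)
      qed
    qed
    have finG: "finite G" and finD: "finite D" by (auto simp: G_def D_def voters_def)
    define U where "U = {u. u \<notin> H \<and> Gu u \<noteq> {}}"
    have "U \<subseteq> (\<lambda>a. the (M' a)) ` G" by (force simp: U_def Gu_def)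
    then have finU: "finite U" using finG finite_surj by blast
    have GU: "G = (\<Union>u\<in>U. Gu u)" using G by (fastforce simp: U_def Gu_def)
    have le: "card (Gu u) \<le> card (Du u)" and sub: "Du u \<subseteq> D" if u: "u \<in> U" for u
    proof -
      have fM: "finite {a. M a = Some u}" "finite {a. M' a = Some u}"
        using M'in by (auto simp: M_def intro: finite_subset[of _ "{..<n}"])
      have "Gu u \<subseteq> {a. M' a = Some u} - {a. M a = Some u}" using G by (fastforce simp: Gu_def)
      then have "card (Gu u) \<le> card ({a. M' a = Some u} - {a. M a = Some u})"
        using fM by (intro card_mono) auto
      also have "\<dots> \<le> card ({a. M a = Some u} - {a. M' a = Some u})"
      proof (rule card_le_sym_Diff[OF fM(2,1)])
        show "card {a. M' a = Some u} \<le> card {a. M a = Some u}"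
          using m' by (simp add: matching_def Minv copies_def n_def)
      qed
      also have "{a. M a = Some u} - {a. M' a = Some u} = Du u" by (auto simp: Du_def)
      finally show "card (Gu u) \<le> card (Du u)" .
      show "Du u \<subseteq> D"
      proof
        fix a assume "a \<in> Du u"
        then have a: "a < length as" "choice H (as ! a) = u" "M a = Some u" "M' a \<noteq> Some u"
          by (auto simp: Du_def M_def n_def split: if_splits)
        have "prefers_outcome (strict_pref (as ! a)) (Some u) (M' a)"
        proof (cases "M' a")
          case None
          then show ?thesis by simp
        next
          case (Some w)
          with M'in a have "w \<in> set (as ! a)" "w \<noteq> u" by auto
          from pl a(1) show ?thesis
            using \<open>w \<in> set (as ! a)\<close> \<open>w \<noteq> u\<close> a(2) u Some
            by (cases rule: pair_listsE) (auto simp: choice_def U_def split: if_splits)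
        qed
        with a show "a \<in> D" by (simp add: D_def voters_def)
      qed
    qed
    have "card G \<le> (\<Sum>u\<in>U. card (Gu u))" unfolding GU by (rule card_UN_le[OF finU])
    also have "\<dots> \<le> (\<Sum>u\<in>U. card (Du u))" by (rule sum_mono) (rule le)
    also have "\<dots> = card (\<Union>u\<in>U. Du u)"
    proof (rule card_UN_disjoint[symmetric, OF finU])
      show "\<forall>u\<in>U. finite (Du u)" using finite_subset[OF sub finD] by blast
    qed (auto simp: Du_def)
    also have "\<dots> \<le> card D" using sub finD by (intro card_mono) auto
    finally show ?thesis by (simp add: more_popular_def G_def D_def)
  qed
  with mM have "popular (map strict_pref as) copies M" by (auto simp: popular_def)
  moreover have "\<forall>a < length (prefs I). M a \<noteq> None" by (simp add: M_def n_def prefs)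
  ultimately show ?thesis unfolding feasible_def Let_def Ps by blast
qed

lemma total_cost_choice:
  fixes H :: "nat set" and as :: "nat list list"
  assumes pl: "pair_lists as" and uni: "\<forall>us \<in> set as. set us \<subseteq> universe I"
  defines "copies \<equiv> \<lambda>b. card {a. a < length as \<and> choice H (as ! a) = b}"
  shows "total_cost I copies = (\<Sum>us\<leftarrow>as. costs I ! choice H us)"
proof -
  have fU: "finite (universe I)" by (simp add: universe_def)
  have sub: "(\<lambda>a. choice H (as ! a)) ` {..<length as} \<subseteq> universe I"
  proof (clarsimp)
    fix a assume a: "a < length as"
    from pl this have "choice H (as ! a) \<in> set (as ! a)"
      by (cases rule: pair_listsE) (auto simp: choice_def)
    with uni a show "choice H (as ! a) \<in> universe I" by (meson nth_mem subsetD)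
  qed
  have "(\<Sum>us\<leftarrow>as. costs I ! choice H us) = (\<Sum>a<length as. costs I ! choice H (as ! a))"
    by (simp add: sum_list_sum_nth atLeast0LessThan)
  also have "\<dots> = (\<Sum>b\<in>universe I. \<Sum>a\<in>{a \<in> {..<length as}. choice H (as ! a) = b}. costs I ! choice H (as ! a))"
    by (rule sum.group[symmetric]) (use fU sub in auto)
  also have "\<dots> = (\<Sum>b\<in>universe I. \<Sum>a\<in>{a \<in> {..<length as}. choice H (as ! a) = b}. costs I ! b)"
    by (intro sum.cong) auto
  also have "\<dots> = total_cost I copies"
    by (simp add: total_cost_def copies_def)
  finally show ?thesis ..
qed

text \<open>\<open>H\<close> consists of the items that somebody holds as a second choice. Whoever
  holds a second choice \<open>v\<close> makes \<open>v\<close> high, and popularity makes the first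
  choice \<open>u\<close> low, so \<open>choice\<close> picks \<open>v\<close> as well. Where the
  first choice is held, falling prices make \<open>choice\<close> at most as expensive.\<close>

lemma feasible_lower_bound:
  fixes as :: "nat list list"
  assumes pl: "pair_lists as" and prefs: "prefs I = map strict_pref as"
    and uni: "\<forall>us \<in> set as. set us \<subseteq> universe I"
    and dec: "\<And>u v. [u, v] \<in> set as \<Longrightarrow> costs I ! v \<le> costs I ! u"
    and nonneg: "\<forall>q \<in> set (costs I). q \<ge> 0"
    and feas: "feasible I copies"
  shows "\<exists>H. (\<Sum>us\<leftarrow>as. costs I ! choice H us) \<le> total_cost I copies"
proof -
  define n where "n = length as"
  define B where "B = {b \<in> universe I. copies b > 0}"
  define Ps where "Ps = map (restrict_pref B) (prefs I)"
  from feas obtain M where pop: "popular Ps copies M" and all: "\<And>a. a < n \<Longrightarrow> M a \<noteq> None"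
    unfolding feasible_def Let_def Ps_def B_def prefs n_def by auto
  have mM: "matching Ps copies M" using pop by (simp add: popular_def)
  have Min: "a < n \<and> b \<in> set (as ! a) \<and> b \<in> B" if "M a = Some b" for a b
  proof -
    have "a < length Ps \<and> b \<in> items_on (Ps ! a)"
      using mM that unfolding matching_def by blast
    then have a: "a < n" "b \<in> items_on (Ps ! a)" by (auto simp: Ps_def prefs n_def)
    then have "b \<in> items_on (restrict_pref B (strict_pref (as ! a)))" by (simp add: Ps_def prefs n_def)
    then have "b \<in> set (as ! a) \<and> b \<in> B" by (auto simp: items_on_def restrict_pref_def strict_pref_def)
    with a show ?thesis by simp
  qed
  have single: "M a = Some u" if "a < n" "as ! a = [u]" for a u
    using all[OF that(1)] Min[of a] that(2) by (cases "M a") auto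
  \<comment> \<open>Everybody is matched, so the owner of the list \<open>[b]\<close> holds a copy
    of \<open>b\<close>.\<close>
  have present: "b \<in> B" if "a < n" "b \<in> set (as ! a)" for a b
    using pair_lists_singleton[OF pl that[unfolded n_def]] single Min unfolding n_def by blast
  have PsE: "Ps = map strict_pref as"
    unfolding Ps_def prefs map_map o_def
  proof (rule map_cong[OF refl])
    fix us assume us: "us \<in> set as"
    then obtain a where "a < n" "us = as ! a" by (auto simp: in_set_conv_nth n_def)
    have "set us \<subseteq> B" using present[OF \<open>a < n\<close>] unfolding \<open>us = as ! a\<close> by blast
    then show "restrict_pref B (strict_pref us) = strict_pref us"
      by (rule restrict_strict_pref)
  qed
  define H where "H = {v. \<exists>a<n. \<exists>u. as ! a = [u, v] \<and> M a = Some v}"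
  have finM: "finite {a. M a = Some b}" for b
    by (rule finite_subset[of _ "{..<n}"]) (use Min in auto)
  have key: "M a1 \<noteq> Some w" if a1: "a1 < n" "as ! a1 = [v, w]" "v \<in> H" for a1 v w
  proof
    assume M1: "M a1 = Some w"
    have vw: "v \<noteq> w" using pair_listsE[OF pl a1(1)[unfolded n_def]] a1(2) by fastforce
    from \<open>v \<in> H\<close> obtain a0 u where a0: "a0 < n" "as ! a0 = [u, v]" "M a0 = Some v"
      by (auto simp: H_def)
    have uv: "u \<noteq> v" using pair_listsE[OF pl a0(1)[unfolded n_def]] a0(2) by fastforce
    have "u \<in> set (as ! a0)" using a0 by simp
    from pair_lists_singleton[OF pl a0(1)[unfolded n_def] this] obtain a2
      where a2: "a2 < n" "as ! a2 = [u]" unfolding n_def by blast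
    have M2: "M a2 = Some u" using single a2 by blast
    have ne: "a0 \<noteq> a1" "a2 \<noteq> a0" "a2 \<noteq> a1" using a0 a1 a2 vw M1 by auto
    \<comment> \<open>The owner of \<open>[u]\<close> gives up a copy of \<open>u\<close> for
      \<open>a0\<close>, whose copy of \<open>v\<close> goes to \<open>a1\<close>: two votes against
      one.\<close>
    define M' where "M' = M(a0 := Some u, a1 := Some v, a2 := None)"
    have "matching Ps copies M'"
      unfolding matching_def
    proof (intro conjI allI impI)
      fix a b assume "M' a = Some b"
      then show "a < length Ps" "b \<in> items_on (Ps ! a)"
        using Min[of a b] a0 a1 ne by (auto simp: M'_def PsE n_def split: if_splits)
    next
      fix b
      have "card {a. M' a = Some b} \<le> card {a. M a = Some b}"
      proof (cases "b = u \<or> b = v")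
        case True
        \<comment> \<open>\<open>f\<close> sends each holder under \<open>M'\<close> to the previous
          holder of the same copy.\<close>
        define f where "f = (\<lambda>a. if a = a0 then a2 else if a = a1 then a0 else a)"
        have "inj_on f {a. M' a = Some b}"
          using True ne uv by (auto simp: inj_on_def f_def M'_def split: if_splits)
        moreover have "f ` {a. M' a = Some b} \<subseteq> {a. M a = Some b}"
          using True ne uv a0 M2 by (auto simp: f_def M'_def split: if_splits)
        ultimately show ?thesis using finM by (metis card_image card_mono)
      next
        case False
        then have "{a. M' a = Some b} \<subseteq> {a. M a = Some b}"
          by (auto simp: M'_def split: if_splits)
        then show ?thesis using finM by (intro card_mono)
      qed
      also have "\<dots> \<le> copies b" using mM by (simp add: matching_def)
      finally show "card {a. M' a = Some b} \<le> copies b" .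
    qed
    moreover have "more_popular Ps M' M"
    proof -
      have "{a0, a1} \<subseteq> voters Ps M' M"
        using a0 a1 ne M1 vw uv by (auto simp: voters_def PsE M'_def n_def)
      moreover have "finite (voters Ps M' M)" by (simp add: voters_def)
      ultimately have "card {a0, a1} \<le> card (voters Ps M' M)" by (rule card_mono[rotated])
      then have "2 \<le> card (voters Ps M' M)" using ne by simp
      moreover have "voters Ps M M' \<subseteq> {a2}"
      proof
        fix a assume "a \<in> voters Ps M M'"
        then have p: "prefers_outcome (strict_pref (as ! a)) (M a) (M' a)"
          by (auto simp: voters_def PsE)
        show "a \<in> {a2}"
        proof (rule ccontr)
          assume "a \<notin> {a2}"
          moreover have "\<not> prefers_outcome (strict_pref (as ! a)) (M a) (M a)" if "a < n"
            using pl that[unfolded n_def] by (cases rule: pair_listsE; cases "M a") auto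
          moreover have "a < n" using \<open>a \<in> voters Ps M M'\<close> by (simp add: voters_def PsE n_def)
          ultimately show False
            using p a0 a1 M1 vw uv ne by (auto simp: M'_def split: if_splits)
        qed
      qed
      then have "card (voters Ps M M') \<le> card {a2}" by (intro card_mono) auto
      ultimately show ?thesis by (simp add: more_popular_def)
    qed
    ultimately show False using pop unfolding popular_def by blast
  qed
  define m where "m = (\<lambda>a. the (M a))"
  have mM': "M a = Some (m a)" if "a < n" for a using all[OF that] by (auto simp: m_def)
  have fU: "finite (universe I)" by (simp add: universe_def)
  have sub: "m ` {..<n} \<subseteq> universe I" using mM' Min by (auto simp: B_def)
  have "(\<Sum>us\<leftarrow>as. costs I ! choice H us) = (\<Sum>a<n. costs I ! choice H (as ! a))"
    by (simp add: sum_list_sum_nth atLeast0LessThan n_def)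
  also have "\<dots> \<le> (\<Sum>a<n. costs I ! m a)"
  proof (rule sum_mono)
    fix a assume "a \<in> {..<n}"
    then have a: "a < n" by simp
    from pl a[unfolded n_def] show "costs I ! choice H (as ! a) \<le> costs I ! m a"
    proof (cases rule: pair_listsE)
      case (1 u)
      then show ?thesis using single[OF a] by (simp add: choice_def m_def)
    next
      case (2 u v)
      have "m a = u \<or> m a = v" using Min[OF mM'[OF a]] 2 by auto
      then show ?thesis
      proof
        assume "m a = v"
        then have "v \<in> H" "u \<notin> H" using a 2 mM'[OF a] key[OF a 2(1)] by (auto simp: H_def)
        then show ?thesis using 2 \<open>m a = v\<close> by (simp add: choice_def)
      next
        assume "m a = u"
        moreover have "[u, v] \<in> set as" using a 2 unfolding n_def by (metis nth_mem)
        ultimately show ?thesis using 2 dec[of u v] by (simp add: choice_def)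
      qed
    qed
  qed
  also have "\<dots> = (\<Sum>b\<in>universe I. \<Sum>a\<in>{a \<in> {..<n}. m a = b}. costs I ! m a)"
    by (rule sum.group[symmetric]) (use fU sub in auto)
  also have "\<dots> = (\<Sum>b\<in>universe I. of_nat (card {a \<in> {..<n}. m a = b}) * costs I ! b)"
    by (intro sum.cong) auto
  \<comment> \<open>Copies that nobody receives have a non-negative price.\<close>
  also have "\<dots> \<le> total_cost I copies"
    unfolding total_cost_def
  proof (intro sum_mono mult_right_mono)
    fix b assume b: "b \<in> universe I"
    have "card {a \<in> {..<n}. m a = b} \<le> card {a. M a = Some b}"
      using mM' finM by (intro card_mono) auto
    also have "\<dots> \<le> copies b" using mM by (simp add: matching_def)
    finally show "(of_nat (card {a \<in> {..<n}. m a = b}) :: rat) \<le> of_nat (copies b)" by simp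
    show "0 \<le> costs I ! b" using nonneg b by (simp add: universe_def)
  qed
  finally show ?thesis by blast
qed

theorem mcpi_yes_iff_choice:
  fixes as :: "nat list list"
  assumes "pair_lists as" "prefs I = map strict_pref as"
    and "\<forall>us \<in> set as. set us \<subseteq> universe I"
    and "\<And>u v. [u, v] \<in> set as \<Longrightarrow> costs I ! v \<le> costs I ! u"
    and "\<forall>q \<in> set (costs I). q \<ge> 0"
  shows "mcpi_yes I \<longleftrightarrow> (\<exists>H. (\<Sum>us\<leftarrow>as. costs I ! choice H us) \<le> budget I)"
proof
  assume "mcpi_yes I"
  then obtain copies where "feasible I copies" "total_cost I copies \<le> budget I"
    unfolding mcpi_yes_def by blast
  with feasible_lower_bound[OF assms, of copies]
  show "\<exists>H. (\<Sum>us\<leftarrow>as. costs I ! choice H us) \<le> budget I" using order_trans by blast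
next
  assume "\<exists>H. (\<Sum>us\<leftarrow>as. costs I ! choice H us) \<le> budget I"
  then obtain H where "(\<Sum>us\<leftarrow>as. costs I ! choice H us) \<le> budget I" ..
  with total_cost_choice[OF assms(1,3), of H] feasible_choice[OF assms(1-3), of H]
  show "mcpi_yes I" unfolding mcpi_yes_def by auto
qed


section \<open>Digits, items and gadgets\<close>

fun digits :: "nat \<Rightarrow> nat \<Rightarrow> nat \<Rightarrow> nat list" where
  "digits B 0 j = []"
| "digits B (Suc L) j = j mod B # digits B L (j div B)"

fun val :: "nat \<Rightarrow> nat list \<Rightarrow> nat" where
  "val B [] = 0"
| "val B (d # ds) = d + B * val B ds"

definition words :: "nat \<Rightarrow> nat \<Rightarrow> nat list set" where
  "words B L = {ds. length ds = L \<and> set ds \<subseteq> {..<B}}"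

lemma words_0 [simp]: "words B 0 = {[]}"
  by (auto simp: words_def)

lemma words_Suc: "ds \<in> words B (Suc L) \<longleftrightarrow> (\<exists>d ds'. ds = d # ds' \<and> d < B \<and> ds' \<in> words B L)"
  by (auto simp: words_def length_Suc_conv)

lemma digits_words: "0 < B \<Longrightarrow> digits B L j \<in> words B L"
  by (induction L arbitrary: j) (simp_all add: words_Suc)

lemma length_digits [simp]: "length (digits B L j) = L"
  by (induction L arbitrary: j) simp_all

lemma digits_val: "ds \<in> words B L \<Longrightarrow> digits B L (val B ds) = ds"
  by (induction L arbitrary: ds) (auto simp: words_Suc)

lemma val_less: "ds \<in> words B L \<Longrightarrow> val B ds < B ^ L"
proof (induction L arbitrary: ds)
  case (Suc L)
  then obtain d ds' where "ds = d # ds'" "d < B" "ds' \<in> words B L" by (auto simp: words_Suc)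
  moreover from this Suc.IH have "val B ds' + 1 \<le> B ^ L" by fastforce
  then have "B * (val B ds' + 1) \<le> B * B ^ L" by (rule mult_le_mono2)
  ultimately show ?case by simp
qed simp

lemma words_image: "0 < B \<Longrightarrow> words B L = digits B L ` {..<B ^ L}"
proof (intro equalityI subsetI)
  fix ds assume "ds \<in> words B L"
  then show "ds \<in> digits B L ` {..<B ^ L}"
    by (intro image_eqI[of _ _ "val B ds"]) (simp_all add: digits_val val_less)
qed (auto intro: digits_words)

text \<open>A cell of the tableau is a word over four digits, which holds one bit of the column and one bit
  of the row per digit. A digit of a word over 16 digits holds the bits of two cells, so that one
  counter enumerates all pairs of cells. The item with code \<open>c > 0\<close> at a cell has the digits of the
  cell below those of \<open>c\<close>; the binary representation of its number can be written digit by digit.\<close>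

definition cell :: "bool \<Rightarrow> nat list \<Rightarrow> nat list" where
  "cell sel ds = map (\<lambda>d. if sel then d div 4 else d mod 4) ds"

definition index :: "bool \<Rightarrow> nat list \<Rightarrow> nat \<Rightarrow> nat" where
  "index sel ds c = val 4 (cell sel ds) + 4 ^ length ds * c"

lemma cell_words: "ds \<in> words 16 L \<Longrightarrow> cell sel ds \<in> words 4 L"
  by (auto simp: words_def cell_def subset_iff)

lemma words_4_16: "ds \<in> words 4 L \<Longrightarrow> ds \<in> words 16 L"
  by (force simp: words_def)

lemma cell_False: "ds \<in> words 4 L \<Longrightarrow> cell False ds = ds"
  by (auto simp: words_def cell_def subset_iff intro!: map_idI)

lemma pair_word:
  assumes "w \<in> words 4 L" "w' \<in> words 4 L"
  shows "\<exists>ds \<in> words 16 L. cell False ds = w \<and> cell True ds = w'"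
  using assms
proof (induction L arbitrary: w w')
  case (Suc L)
  then obtain d v d' v' where *: "w = d # v" "d < 4" "v \<in> words 4 L" "w' = d' # v'" "d' < 4" "v' \<in> words 4 L"
    by (auto simp: words_Suc)
  from Suc.IH[OF *(3,6)] obtain ds where "ds \<in> words 16 L" "cell False ds = v" "cell True ds = v'" by blast
  with * show ?case by (intro bexI[of _ "(d + 4 * d') # ds"]) (auto simp: words_Suc cell_def)
qed (auto simp: cell_def)

lemma index_div_mod:
  assumes "ds \<in> words 16 L"
  shows "index sel ds c div 4 ^ L = c" "digits 4 L (index sel ds c mod 4 ^ L) = cell sel ds"
    and "c < n \<Longrightarrow> index sel ds c < n * 4 ^ L"
proof -
  have *: "length ds = L" "val 4 (cell sel ds) < 4 ^ L" "cell sel ds \<in> words 4 L"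
    using assms cell_words[OF assms] val_less[OF cell_words[OF assms]] by (auto simp: words_def)
  then show "index sel ds c div 4 ^ L = c" "digits 4 L (index sel ds c mod 4 ^ L) = cell sel ds"
    by (simp_all add: index_def digits_val)
  assume "c < n"
  then have "(c + 1) * 4 ^ L \<le> n * 4 ^ L" by (intro mult_le_mono1) simp
  then show "index sel ds c < n * 4 ^ L" using * by (simp add: index_def mult.commute)
qed

type_synonym person = "(bool \<times> nat) list"

definition inst :: "nat list \<Rightarrow> person list \<Rightarrow> nat list list" where
  "inst ds = map (map (\<lambda>(sel, c). index sel ds c))"

section \<open>Payments of people under a given set of high items\<close>

locale gadgets =
  fixes K :: nat
begin

definition X :: "nat \<Rightarrow> nat" where "X s = 1 + s"
definition Y :: "nat \<Rightarrow> nat" where "Y s = 1 + K + s"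
definition Top :: nat where "Top = 1 + 2 * K"
definition Bot :: "nat \<Rightarrow> nat" where "Bot j = 2 + 2 * K + j"
text \<open>Leaves room for bottom items of prices up to \<open>10 * K + 1\<close>, more than any
  gadget asks for.\<close>

definition NC :: nat where "NC = 12 * K + 4"

text \<open>The prices are chosen such that along each list of the gadgets the price decreases, and such
  that the price of the item \<open>Bot\<close> required by each gadget is a natural number.\<close>

definition price :: "nat \<Rightarrow> nat" where
  "price c = (if c = 0 then 0 else if c \<le> K then 6 * K + 2 * (c - 1)
     else if c \<le> 2 * K then 4 * K + 2 * (c - 1 - K) else if c = Top then 8 * K else c - (2 + 2 * K))"

lemma price_simps [simp]:
  "s < K \<Longrightarrow> price (X s) = 6 * K + 2 * s"
  "s < K \<Longrightarrow> price (Y s) = 4 * K + 2 * s"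
  "price Top = 8 * K"
  "price (Bot j) = j"
  by (simp_all add: price_def X_def Y_def Top_def Bot_def)

text \<open>The counterpart of \<open>choice\<close> for items given by a cell selector and a code,
  so that payments can be computed before the two cells are fixed.\<close>

definition chosen :: "(bool \<Rightarrow> nat \<Rightarrow> bool) \<Rightarrow> person \<Rightarrow> bool \<times> nat" where
  "chosen h us = (if length us = 2 \<and> \<not> case_prod h (us ! 0) \<and> case_prod h (us ! 1) then us ! 1 else us ! 0)"

definition pay :: "(bool \<Rightarrow> nat \<Rightarrow> bool) \<Rightarrow> person list \<Rightarrow> nat" where
  "pay h tm = (\<Sum>us\<leftarrow>tm. price (snd (chosen h us)))"

lemma pay_simps [simp]:
  "pay h [] = 0"
  "pay h (us # tm) = price (snd (chosen h us)) + pay h tm"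
  "pay h (tm @ tm') = pay h tm + pay h tm'"
  by (simp_all add: pay_def)

lemma pay_concat: "pay h (concat (map f xs)) = (\<Sum>x\<leftarrow>xs. pay h (f x))"
  by (induction xs) simp_all

lemma chosen_simps [simp]:
  "chosen h [us] = us"
  "chosen h [(a, u), (b, v)] = (if \<not> h a u \<and> h b v then (b, v) else (a, u))"
  by (simp_all add: chosen_def)

text \<open>An edge costs extra iff both \<open>u\<close> and \<open>v\<close> are high, a node costs one unit less if \<open>u\<close> is high.\<close>

definition edge :: "bool \<Rightarrow> nat \<Rightarrow> bool \<Rightarrow> nat \<Rightarrow> person list" where
  "edge a u b v = [[(a, u), (b, v)], [(b, v), (b, Bot (2 * price v - price u))]]"

definition node :: "nat \<Rightarrow> person list" where
  "node u = [[(False, Top), (False, u)], [(False, u), (False, Bot (2 * price u + 1 - 8 * K))]]"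

text \<open>The price of the bottom item makes up for that of \<open>u\<close>: if \<open>v\<close>
  is low, the two people pay \<open>price u\<close> and \<open>2 * price v - price u\<close>; if
  only \<open>v\<close> is high, both pay \<open>price v\<close>; if both are high, they pay
  \<open>price u + price v\<close>. A low bottom item can only raise the sum.\<close>

lemma pay_edge:
  assumes "price v < price u" "price u \<le> 2 * price v"
  shows "2 * price v + (if h a u \<and> h b v then price u - price v else 0) \<le> pay h (edge a u b v)"
    and "(\<And>j. h b (Bot j)) \<Longrightarrow>
      pay h (edge a u b v) = 2 * price v + (if h a u \<and> h b v then price u - price v else 0)"
  using assms by (auto simp: edge_def)

text \<open>A low \<open>u\<close> costs \<open>8 * K\<close> for \<open>Top\<close> and the rest up
  to \<open>2 * price u + 1\<close> for the bottom item; a high \<open>u\<close> costs its price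
  twice. Other choices for \<open>Top\<close> and the bottom item are no cheaper.\<close>

lemma pay_node:
  assumes "price u < 8 * K" "8 * K \<le> 2 * price u + 1"
  shows "2 * price u + 1 - (if h False u then 1 else 0) \<le> pay h (node u)"
    and "(\<And>j. h False (Bot j)) \<Longrightarrow> \<not> h False Top \<Longrightarrow>
      pay h (node u) = 2 * price u + 1 - (if h False u then 1 else 0)"
  using assms by (auto simp: node_def)

section \<open>Forcing exactly one high item among \<open>K\<close>\<close>

definition pairs :: "(nat \<times> nat) list" where
  "pairs = filter (\<lambda>(s, s'). s < s') (List.product [0..<K] [0..<K])"

lemma pairs: "set pairs = {(s, s'). s < s' \<and> s' < K}" "distinct pairs"
  by (auto simp: pairs_def distinct_product)

definition one_of :: "(nat \<Rightarrow> nat) \<Rightarrow> person list" where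
  "one_of f = concat (map (\<lambda>s. node (f s)) [0..<K]) @
     concat (map (\<lambda>(s, s'). edge False (f s') False (f s)) pairs)"

text \<open>The final \<open>- 1\<close> is the unit that the single high item saves.\<close>

definition one_of_price :: "(nat \<Rightarrow> nat) \<Rightarrow> nat" where
  "one_of_price f = (\<Sum>s\<leftarrow>[0..<K]. 2 * price (f s) + 1) + (\<Sum>(s, s')\<leftarrow>pairs. 2 * price (f s)) - 1"

text \<open>Count only the pairs that contain the minimum.\<close>

lemma card_pairs_ge:
  fixes S :: "nat set"
  assumes "finite S" "S \<noteq> {}"
  shows "card S - 1 \<le> card {(s, s'). s \<in> S \<and> s' \<in> S \<and> s < s'}"
proof -
  let ?m = "Min S"
  have "card (S - {?m}) = card S - 1" using assms by simp
  moreover have "card (S - {?m}) = card (Pair ?m ` (S - {?m}))"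
    by (rule card_image[symmetric]) (auto simp: inj_on_def)
  moreover have "Pair ?m ` (S - {?m}) \<subseteq> {(s, s'). s \<in> S \<and> s' \<in> S \<and> s < s'}"
  proof
    fix y assume "y \<in> Pair ?m ` (S - {?m})"
    then obtain s where s: "y = (?m, s)" "s \<in> S" "s \<noteq> ?m" by auto
    then have "?m < s" using Min_le[OF assms(1), of s] by simp
    with s Min_in[OF assms] show "y \<in> {(s, s'). s \<in> S \<and> s' \<in> S \<and> s < s'}" by simp
  qed
  moreover have "finite {(s, s'). s \<in> S \<and> s' \<in> S \<and> s < s'}"
    by (rule finite_subset[of _ "S \<times> S"]) (use assms in auto)
  ultimately show ?thesis using card_mono[of "{(s, s'). s \<in> S \<and> s' \<in> S \<and> s < s'}" "Pair ?m ` (S - {?m})"] by simp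
qed

text \<open>Each of the \<open>card S\<close> high items saves one unit, and each of the at least
  \<open>card S - 1\<close> pairs of them costs at least 2, the distance of consecutive prices. The
  balance is best for \<open>card S = 1\<close> and strictly worse for none or several.\<close>

lemma pay_one_of:
  assumes K: "0 < K"
    and f: "\<And>s. s < K \<Longrightarrow> price (f s) = a + 2 * s" and a: "4 * K \<le> a" "a \<le> 6 * K"
  shows "one_of_price f \<le> pay h (one_of f)"
    and "pay h (one_of f) \<le> one_of_price f \<Longrightarrow> \<exists>!s. s < K \<and> h False (f s)"
    and "(\<And>j. h False (Bot j)) \<Longrightarrow> \<not> h False Top \<Longrightarrow> \<exists>!s. s < K \<and> h False (f s) \<Longrightarrow>
      pay h (one_of f) = one_of_price f"
proof -
  define S where "S = {s. s < K \<and> h False (f s)}"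
  define P where "P = {(s, s'). s \<in> S \<and> s' \<in> S \<and> s < s'}"
  have finS: "finite S" and finP: "finite P"
    by (auto simp: S_def P_def intro: finite_subset[of _ "{..<K} \<times> {..<K}"])
  \<comment> \<open>The balance is computed in integers, where subtraction does not
    truncate.\<close>
  define A where "A = int (\<Sum>s<K. 2 * price (f s) + 1)"
  define B where "B = int (\<Sum>p\<in>set pairs. 2 * price (f (fst p)))"
  have A_sum: "A = (\<Sum>s<K. int (2 * price (f s) + 1))"
    and B_sum: "B = (\<Sum>p\<in>set pairs. int (2 * price (f (fst p))))"
    by (simp_all add: A_def B_def)
  have A: "(\<Sum>s\<leftarrow>[0..<K]. 2 * price (f s) + 1) = nat A"
    unfolding A_def nat_int by (simp add: sum_list_distinct_conv_sum_set atLeast0LessThan)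
  have B: "(\<Sum>(s, s')\<leftarrow>pairs. 2 * price (f s)) = nat B"
    unfolding B_def nat_int by (simp add: sum_list_distinct_conv_sum_set pairs(2) case_prod_beta)
  have A1: "1 \<le> A"
  proof -
    have "int (2 * price (f 0) + 1) \<le> A" unfolding A_sum by (rule member_le_sum) (use K in auto)
    then show ?thesis by simp
  qed
  have B0: "0 \<le> B" unfolding B_def by (rule of_nat_0_le_iff)
  have base: "int (one_of_price f) = A + B - 1"
    unfolding one_of_price_def A B using A1 B0 by (simp add: nat_add_distrib[symmetric] of_nat_diff)
  have ns: "price (f s) < 8 * K" "8 * K \<le> 2 * price (f s) + 1" if "s < K" for s using f[OF that] a that by auto
  have es: "price (f s) < price (f s')" "price (f s') \<le> 2 * price (f s)" if "(s, s') \<in> set pairs" for s s'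
    using that f a by (auto simp: pairs)
  have pay: "int (pay h (one_of f)) = (\<Sum>s<K. int (pay h (node (f s)))) +
      (\<Sum>p\<in>set pairs. int (pay h (edge False (f (snd p)) False (f (fst p)))))"
    by (simp add: one_of_def pay_concat sum_list_distinct_conv_sum_set atLeast0LessThan pairs(2) case_prod_beta)
  have cS: "(\<Sum>s<K. if h False (f s) then 1 else 0 :: int) = int (card S)"
    by (simp add: sum.If_cases S_def Int_def conj_commute lessThan_def)
  have sub: "P \<subseteq> set pairs" by (auto simp: P_def S_def pairs)
  have Pin: "p \<in> P \<longleftrightarrow> h False (f (snd p)) \<and> h False (f (fst p))" if "p \<in> set pairs" for p
    using that by (auto simp: P_def S_def pairs)
  have cP: "(\<Sum>p\<in>set pairs. if p \<in> P then w p else 0) = (\<Sum>p\<in>P. w p)" for w :: "nat \<times> nat \<Rightarrow> int"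
    using sub by (simp add: sum.If_cases Int_absorb1)
  have sn: "(\<Sum>s<K. int (2 * price (f s) + 1) - (if h False (f s) then 1 else 0)) = A - int (card S)"
    unfolding sum_subtractf A_sum cS by simp
  define W where "W = (\<lambda>p. int (price (f (snd p))) - int (price (f (fst p))))"
  have W2: "2 \<le> W p" if "p \<in> P" for p
    using that f[of "fst p"] f[of "snd p"] by (auto simp: W_def P_def S_def)
  have se: "(\<Sum>p\<in>set pairs. int (2 * price (f (fst p))) + (if p \<in> P then W p else 0)) = B + (\<Sum>p\<in>P. W p)"
    unfolding sum.distrib B_sum cP by simp
  have lower: "A - int (card S) + (B + (\<Sum>p\<in>P. W p)) \<le> int (pay h (one_of f))"
    unfolding pay sn[symmetric] se[symmetric]
  proof (intro add_mono sum_mono, goal_cases)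
    case (1 s)
    then show ?case using pay_node(1)[OF ns, of s h] by (auto split: if_splits)
  next
    case (2 p)
    then show ?case
      using pay_edge(1)[OF es, of "fst p" "snd p" h False False] Pin[OF 2] es[of "fst p" "snd p"]
      by (auto simp: W_def of_nat_diff split: if_splits)
  qed
  have Wge: "2 * int (card P) \<le> (\<Sum>p\<in>P. W p)"
    using sum_mono[of P "\<lambda>_. 2" W] W2 by simp
  have lower': "A - int (card S) + B + 2 * int (card P) \<le> int (pay h (one_of f))"
    using lower Wge by simp
  have cPS: "card S - 1 \<le> card P" if "S \<noteq> {}"
    unfolding P_def using card_pairs_ge[OF finS that] by (simp add: conj_assoc)
  have "int (one_of_price f) \<le> int (pay h (one_of f)) \<and>
      (card S \<noteq> 1 \<longrightarrow> int (one_of_price f) < int (pay h (one_of f)))"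
  proof (cases "S = {}")
    case True
    then show ?thesis using lower' base by simp
  next
    case False
    then have "1 \<le> card S" using finS by (simp add: Suc_le_eq card_gt_0_iff)
    then show ?thesis using cPS[OF False] lower' base by auto
  qed
  then have le: "one_of_price f \<le> pay h (one_of f)"
    and lt: "card S \<noteq> 1 \<Longrightarrow> one_of_price f < pay h (one_of f)" by auto
  show "one_of_price f \<le> pay h (one_of f)" by (rule le)
  show "\<exists>!s. s < K \<and> h False (f s)" if "pay h (one_of f) \<le> one_of_price f"
  proof -
    have "card S = 1" using lt that by (meson not_less)
    then obtain s where "S = {s}" by (auto simp: card_1_singleton_iff)
    then have "s' < K \<and> h False (f s') \<longleftrightarrow> s' = s" for s' unfolding S_def by blast
    then show ?thesis by simp
  qed
  assume bot: "\<And>j. h False (Bot j)" and top: "\<not> h False Top" and ex1: "\<exists>!s. s < K \<and> h False (f s)"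
  from ex1 obtain s where "s < K \<and> h False (f s)" "\<And>s'. s' < K \<and> h False (f s') \<Longrightarrow> s' = s" by blast
  then have s: "S = {s}" unfolding S_def by blast
  then have "P = {}" by (auto simp: P_def)
  have "int (pay h (one_of f)) = A - int (card S) + (B + (\<Sum>p\<in>P. W p))"
    unfolding pay sn[symmetric] se[symmetric]
  proof (intro arg_cong2[of _ _ _ _ "(+)"] sum.cong refl, goal_cases)
    case (1 s)
    then show ?case using pay_node(2)[OF ns, of s h] bot top by (auto split: if_splits)
  next
    case (2 p)
    then show ?case
      using pay_edge(2)[OF es, of "fst p" "snd p" h False False] Pin[OF 2] es[of "fst p" "snd p"] bot
      by (auto simp: W_def of_nat_diff split: if_splits)
  qed
  with base s \<open>P = {}\<close> show "pay h (one_of f) = one_of_price f" by simp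
qed

end


section \<open>From local constraints to instances\<close>

locale conflicts = gadgets K for K +
  fixes conf :: "'z \<Rightarrow> nat \<Rightarrow> nat \<Rightarrow> bool" and same :: "'z \<Rightarrow> bool"
  assumes K: "0 < K"
begin

definition conf_pairs :: "'z \<Rightarrow> (nat \<times> nat) list" where
  "conf_pairs z = filter (\<lambda>(s, s'). conf z s s') (List.product [0..<K] [0..<K])"

text \<open>The people with a single choice make every item of the cell a whole list, as
  \<open>pair_lists\<close> requires. Codes start at 1 because the binary number of an item must end
  with the bits of a positive code for the digits before it to be written out in full.\<close>

definition body :: "'z \<Rightarrow> person list" where
  "body z = concat (map (\<lambda>(s, s'). edge False (X s) True (Y s')) (conf_pairs z)) @
     (if same z then map (\<lambda>c. [(False, c)]) [1..<NC] @ one_of X @ one_of Y else [])"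

definition body_price :: "'z \<Rightarrow> nat" where
  "body_price z = (\<Sum>(s, s')\<leftarrow>conf_pairs z. 2 * price (Y s')) +
     (if same z then (\<Sum>c\<leftarrow>[1..<NC]. price c) + one_of_price X + one_of_price Y else 0)"

lemma set_conf_pairs: "set (conf_pairs z) = {(s, s'). s < K \<and> s' < K \<and> conf z s s'}"
  by (auto simp: conf_pairs_def)

lemma pay_X: 
  "one_of_price X \<le> pay h (one_of X)"
  "pay h (one_of X) \<le> one_of_price X \<Longrightarrow> \<exists>!s. s < K \<and> h False (X s)"
  "(\<And>j. h False (Bot j)) \<Longrightarrow> \<not> h False Top \<Longrightarrow> \<exists>!s. s < K \<and> h False (X s) \<Longrightarrow>
      pay h (one_of X) = one_of_price X"
  using pay_one_of[of X "6 * K" h] K by simp_all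

lemma pay_Y: 
  "one_of_price Y \<le> pay h (one_of Y)"
  "pay h (one_of Y) \<le> one_of_price Y \<Longrightarrow> \<exists>!s. s < K \<and> h False (Y s)"
  "(\<And>j. h False (Bot j)) \<Longrightarrow> \<not> h False Top \<Longrightarrow> \<exists>!s. s < K \<and> h False (Y s) \<Longrightarrow>
      pay h (one_of Y) = one_of_price Y"
  using pay_one_of[of Y "4 * K" h] K by simp_all

lemma pay_XY:
  assumes "s < K" "s' < K"
  shows "2 * price (Y s') \<le> pay h (edge False (X s) True (Y s'))"
    and "h False (X s) \<Longrightarrow> h True (Y s') \<Longrightarrow> 2 * price (Y s') < pay h (edge False (X s) True (Y s'))"
    and "(\<And>j. h True (Bot j)) \<Longrightarrow> \<not> (h False (X s) \<and> h True (Y s')) \<Longrightarrow>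
      pay h (edge False (X s) True (Y s')) = 2 * price (Y s')"
proof -
  have p: "price (Y s') < price (X s)" "price (X s) \<le> 2 * price (Y s')" using assms by simp_all
  note e = pay_edge[OF p, where h = h and a = False and b = True]
  show "2 * price (Y s') \<le> pay h (edge False (X s) True (Y s'))" using e(1) by (auto split: if_splits)
  show "h False (X s) \<Longrightarrow> h True (Y s') \<Longrightarrow> 2 * price (Y s') < pay h (edge False (X s) True (Y s'))"
    using e(1) p by (auto split: if_splits)
  show "(\<And>j. h True (Bot j)) \<Longrightarrow> \<not> (h False (X s) \<and> h True (Y s')) \<Longrightarrow>
      pay h (edge False (X s) True (Y s')) = 2 * price (Y s')"
    using e(2) by (auto split: if_splits)
qed

lemma pay_singles: "pay h (map (\<lambda>c. [(False, c)]) cs) = (\<Sum>c\<leftarrow>cs. price c)"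
  by (induction cs) simp_all

lemma pay_body_conf:
  "pay h (concat (map (\<lambda>(s, s'). edge False (X s) True (Y s')) (conf_pairs z))) =
     (\<Sum>p\<leftarrow>conf_pairs z. pay h (edge False (X (fst p)) True (Y (snd p))))"
  by (simp add: pay_concat case_prod_beta)

lemma sum_list_strict_mono_ex:
  fixes f g :: "'a \<Rightarrow> nat"
  assumes "\<And>x. x \<in> set xs \<Longrightarrow> f x \<le> g x" "y \<in> set xs" "f y < g y"
  shows "(\<Sum>x\<leftarrow>xs. f x) < (\<Sum>x\<leftarrow>xs. g x)"
  using assms
proof (induction xs)
  case (Cons a xs)
  have "(\<Sum>x\<leftarrow>xs. f x) \<le> (\<Sum>x\<leftarrow>xs. g x)" using Cons.prems(1) by (intro sum_list_mono) auto
  moreover have "f a \<le> g a" using Cons.prems(1) by simp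
  moreover have "f a < g a \<or> (\<Sum>x\<leftarrow>xs. f x) < (\<Sum>x\<leftarrow>xs. g x)"
  proof (cases "y = a")
    case False
    then show ?thesis using Cons.IH Cons.prems by simp
  qed (use Cons.prems in simp)
  ultimately show ?case by auto
qed simp

lemma body_price_le: "body_price z \<le> pay h (body z)"
proof -
  have "(\<Sum>(s, s')\<leftarrow>conf_pairs z. 2 * price (Y s')) \<le>
      (\<Sum>p\<leftarrow>conf_pairs z. pay h (edge False (X (fst p)) True (Y (snd p))))"
    unfolding case_prod_beta by (intro sum_list_mono) (auto simp: set_conf_pairs intro!: pay_XY simp del: price_simps)
  then show ?thesis
    using pay_X(1)[of h] pay_Y(1)[of h] unfolding body_def body_price_def pay_simps pay_body_conf
    by (simp add: pay_singles)
qed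

text \<open>Every gadget has its own lower bound, so a total that meets the sum of the bounds makes
  every gadget optimal.\<close>

lemma body_tight:
  assumes "pay h (body z) \<le> body_price z"
  shows "s < K \<Longrightarrow> s' < K \<Longrightarrow> conf z s s' \<Longrightarrow> \<not> (h False (X s) \<and> h True (Y s'))"
    and "same z \<Longrightarrow> (\<exists>!s. s < K \<and> h False (X s)) \<and> (\<exists>!s. s < K \<and> h False (Y s))"
proof -
  let ?f = "\<lambda>p. 2 * price (Y (snd p))"
  let ?g = "\<lambda>p. pay h (edge False (X (fst p)) True (Y (snd p)))"
  have le: "?f p \<le> ?g p" if "p \<in> set (conf_pairs z)" for p
    using that pay_XY(1)[of "fst p" "snd p" h] by (auto simp: set_conf_pairs simp del: price_simps)
  have c: "(\<Sum>p\<leftarrow>conf_pairs z. ?f p) \<le> (\<Sum>p\<leftarrow>conf_pairs z. ?g p)"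
    using le by (rule sum_list_mono)
  note X = pay_X(1)[of h] and Y = pay_Y(1)[of h]
  have tot: "(\<Sum>p\<leftarrow>conf_pairs z. ?g p) \<le> (\<Sum>p\<leftarrow>conf_pairs z. ?f p) \<and>
      (same z \<longrightarrow> pay h (one_of X) \<le> one_of_price X \<and> pay h (one_of Y) \<le> one_of_price Y)"
    using assms c X Y unfolding body_def body_price_def pay_simps pay_body_conf case_prod_beta
    by (auto simp: pay_singles split: if_splits)
  show "\<not> (h False (X s) \<and> h True (Y s'))" if "s < K" "s' < K" "conf z s s'"
  proof
    assume "h False (X s) \<and> h True (Y s')"
    then have "?f (s, s') < ?g (s, s')" using pay_XY(2)[OF that(1,2), of h] by (simp del: price_simps)
    moreover have "(s, s') \<in> set (conf_pairs z)" using that by (simp add: set_conf_pairs)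
    ultimately have "(\<Sum>p\<leftarrow>conf_pairs z. ?f p) < (\<Sum>p\<leftarrow>conf_pairs z. ?g p)"
      using sum_list_strict_mono_ex[of "conf_pairs z" ?f ?g "(s, s')"] le by blast
    with tot show False by simp
  qed
  show "(\<exists>!s. s < K \<and> h False (X s)) \<and> (\<exists>!s. s < K \<and> h False (Y s))" if "same z"
    using tot that pay_X(2)[of h] pay_Y(2)[of h] by blast
qed

lemma body_exact:
  assumes bot: "\<And>sel j. h sel (Bot j)" and top: "\<not> h False Top"
    and cf: "\<And>s s'. s < K \<Longrightarrow> s' < K \<Longrightarrow> conf z s s' \<Longrightarrow> \<not> (h False (X s) \<and> h True (Y s'))"
    and same: "same z \<Longrightarrow> (\<exists>!s. s < K \<and> h False (X s)) \<and> (\<exists>!s. s < K \<and> h False (Y s))"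
  shows "pay h (body z) = body_price z"
proof -
  have "(\<Sum>(s, s')\<leftarrow>conf_pairs z. 2 * price (Y s')) =
      (\<Sum>p\<leftarrow>conf_pairs z. pay h (edge False (X (fst p)) True (Y (snd p))))"
    unfolding case_prod_beta
  proof (intro arg_cong[of _ _ sum_list] map_cong refl)
    fix p assume "p \<in> set (conf_pairs z)"
    then have p: "fst p < K" "snd p < K" "conf z (fst p) (snd p)" by (auto simp: set_conf_pairs)
    show "2 * price (Y (snd p)) = pay h (edge False (X (fst p)) True (Y (snd p)))"
      by (rule pay_XY(3)[OF p(1,2) bot cf[OF p], symmetric])
  qed
  then show ?thesis
    using pay_X(3)[of h] pay_Y(3)[of h] bot top same unfolding body_def body_price_def pay_simps pay_body_conf
    by (simp add: pay_singles)
qed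

text \<open>The strictly falling prices keep the two items of a list distinct and later yield the
  master list.\<close>

definition person_ok :: "person \<Rightarrow> bool" where
  "person_ok us \<longleftrightarrow> (\<exists>a c. us = [(a, c)] \<and> 1 \<le> c \<and> c < NC) \<or>
     (\<exists>a u b v. us = [(a, u), (b, v)] \<and> 1 \<le> u \<and> u < NC \<and> 1 \<le> v \<and> v < NC \<and> price v < price u)"

lemma codes: 
  "s < K \<Longrightarrow> 1 \<le> X s \<and> X s < NC" "s < K \<Longrightarrow> 1 \<le> Y s \<and> Y s < NC" "1 \<le> Top \<and> Top < NC"
  "1 \<le> Bot j" "j < 10 * K + 2 \<Longrightarrow> Bot j < NC"
  by (auto simp: X_def Y_def Top_def Bot_def NC_def)

lemma edge_ok:
  assumes "1 \<le> u" "u < NC" "1 \<le> v" "v < NC" "0 < price v" "price v < price u" "2 * price v - price u < 10 * K + 2"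
  shows "us \<in> set (edge a u b v) \<Longrightarrow> person_ok us"
  using assms codes(4,5)[of "2 * price v - price u"] by (auto simp: edge_def person_ok_def)

lemma node_ok:
  assumes "1 \<le> u" "u < NC" "price u < 8 * K" "2 * price u + 1 - 8 * K < price u"
  shows "us \<in> set (node u) \<Longrightarrow> person_ok us"
  using assms codes(3) codes(4,5)[of "2 * price u + 1 - 8 * K"] by (auto simp: node_def person_ok_def)

lemma one_of_ok:
  assumes f: "\<And>s. s < K \<Longrightarrow> price (f s) = a + 2 * s \<and> 1 \<le> f s \<and> f s < NC" and a: "4 * K \<le> a" "a \<le> 6 * K"
  shows "us \<in> set (one_of f) \<Longrightarrow> person_ok us"
proof -
  assume "us \<in> set (one_of f)"
  then consider s where "s < K" "us \<in> set (node (f s))"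
    | s s' where "s < s'" "s' < K" "us \<in> set (edge False (f s') False (f s))"
    by (auto simp: one_of_def pairs)
  then show ?thesis
  proof cases
    case 1
    from node_ok[OF _ _ _ _ 1(2)] f[OF 1(1)] 1(1) a show ?thesis by simp
  next
    case 2
    from edge_ok[OF _ _ _ _ _ _ _ 2(3)] f[OF 2(2)] f[of s] 2(1,2) a show ?thesis by simp
  qed
qed

lemma body_ok: "us \<in> set (body z) \<Longrightarrow> person_ok us"
proof -
  assume "us \<in> set (body z)"
  then consider s s' where "s < K" "s' < K" "us \<in> set (edge False (X s) True (Y s'))"
    | c where "1 \<le> c" "c < NC" "us = [(False, c)]" | "us \<in> set (one_of X)" | "us \<in> set (one_of Y)"
    by (auto simp: body_def set_conf_pairs split: if_splits)
  then show ?thesis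
  proof cases
    case 1
    from edge_ok[OF _ _ _ _ _ _ _ 1(3)] codes(1)[OF 1(1)] codes(2)[OF 1(2)] 1(1,2) show ?thesis by simp
  next
    case 2
    then show ?thesis by (auto simp: person_ok_def)
  next
    case 3
    show ?thesis by (rule one_of_ok[OF _ _ _ 3, of "6 * K"]) (use codes(1) in auto)
  next
    case 4
    show ?thesis by (rule one_of_ok[OF _ _ _ 4, of "4 * K"]) (use codes(2) in auto)
  qed
qed

end

section \<open>Equivalence of the padded instance with a constraint satisfaction problem\<close>

locale reduction = conflicts K conf same
  for K and conf :: "'z \<Rightarrow> nat \<Rightarrow> nat \<Rightarrow> bool" and same :: "'z \<Rightarrow> bool" +
  fixes cls :: "nat list \<Rightarrow> 'z" and R :: nat
  assumes same_cls: "\<And>L ds. ds \<in> words 16 L \<Longrightarrow> same (cls ds) \<longleftrightarrow> cell False ds = cell True ds"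
    and conf_same: "\<And>z s s'. same z \<Longrightarrow> s \<noteq> s' \<Longrightarrow> conf z s s'"
    and R: "\<And>z. body_price z \<le> R" "0 < R"
begin

text \<open>Every block is padded to the common optimal price, so that the budget depends only on the
  number of blocks.\<close>

definition block :: "'z \<Rightarrow> person list" where
  "block z = body z @ replicate (R - body_price z) [(False, Bot 1)]"

text \<open>This person pays nothing iff \<open>X s\<close> is low and the bottom item is high, so a
  tile is forbidden without a contribution to the budget.\<close>

definition forbid :: "nat \<Rightarrow> person list" where
  "forbid s = [[(False, X s), (False, Bot 0)]]"

definition persons :: "nat \<Rightarrow> (nat list \<times> nat) list \<Rightarrow> nat list list" where
  "persons L forbs = concat (map (\<lambda>(ds, s). inst ds (forbid s)) forbs) @
     concat (map (\<lambda>j. inst (digits 16 L j) (block (cls (digits 16 L j)))) [0..<16 ^ L])"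

definition instance_of :: "nat \<Rightarrow> (nat list \<times> nat) list \<Rightarrow> mcpi" where
  "instance_of L forbs = \<lparr>prefs = map strict_pref (persons L forbs),
     costs = map (\<lambda>b. of_nat (price (b div 4 ^ L))) [0..<NC * 4 ^ L],
     budget = of_nat (R * 16 ^ L)\<rparr>"

definition csp :: "nat \<Rightarrow> (nat list \<times> nat) list \<Rightarrow> (nat list \<Rightarrow> nat) \<Rightarrow> bool" where
  "csp L forbs T \<longleftrightarrow> (\<forall>w \<in> words 4 L. T w < K) \<and>
     (\<forall>ds \<in> words 16 L. \<not> conf (cls ds) (T (cell False ds)) (T (cell True ds))) \<and>
     (\<forall>(ds, s) \<in> set forbs. T ds \<noteq> s)"

lemma pay_replicate: "pay h (replicate n [(False, Bot 1)]) = n"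
  by (induction n) simp_all

lemma pay_block: "pay h (block z) = pay h (body z) + (R - body_price z)"
  by (simp only: block_def pay_simps(3) pay_replicate)

lemma block_ok: "us \<in> set (block z) \<Longrightarrow> person_ok us"
  using body_ok codes(4)[of 1] codes(5)[of 1] by (auto simp: block_def person_ok_def)

lemma forbid_ok: "s < K \<Longrightarrow> us \<in> set (forbid s) \<Longrightarrow> person_ok us"
  using codes(1)[of s] codes(4)[of 0] codes(5)[of 0] K by (auto simp: forbid_def person_ok_def)

context
  fixes L :: nat and forbs :: "(nat list \<times> nat) list"
  assumes forbs: "\<And>ds s. (ds, s) \<in> set forbs \<Longrightarrow> ds \<in> words 4 L \<and> s < K"
begin

lemma personsD:
  assumes "us \<in> set (persons L forbs)"
  shows "\<exists>ds p. ds \<in> words 16 L \<and> person_ok p \<and> us = map (\<lambda>(sel, c). index sel ds c) p"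
proof -
  from assms consider ds s p where "(ds, s) \<in> set forbs" "p \<in> set (forbid s)" "us = map (\<lambda>(sel, c). index sel ds c) p"
    | j p where "j < 16 ^ L" "p \<in> set (block (cls (digits 16 L j)))" "us = map (\<lambda>(sel, c). index sel (digits 16 L j) c) p"
    unfolding persons_def inst_def by force
  then show ?thesis
  proof cases
    case 1
    then show ?thesis using forbs[OF 1(1)] forbid_ok words_4_16 by blast
  next
    case 2
    then show ?thesis using block_ok digits_words[of 16 L j] by (intro exI[of _ "digits 16 L j"] exI[of _ p]) simp
  qed
qed

text \<open>The person is found in the block of the word that holds the given cell twice.\<close>

lemma persons_single:
  assumes "ds \<in> words 16 L" "1 \<le> c" "c < NC"
  shows "[index sel ds c] \<in> set (persons L forbs)"
proof -
  obtain ds' where ds': "ds' \<in> words 16 L" "cell False ds' = cell sel ds" "cell True ds' = cell sel ds"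
    using pair_word[OF cell_words[OF assms(1)] cell_words[OF assms(1)]] by blast
  have len: "length ds' = length ds" using ds'(1) assms(1) by (simp add: words_def)
  have "same (cls ds')" using same_cls[OF ds'(1)] ds' by simp
  then have "[(False, c)] \<in> set (block (cls ds'))" using assms(2,3) by (auto simp: block_def body_def)
  then have "[index False ds' c] \<in> set (inst ds' (block (cls ds')))" by (force simp: inst_def)
  moreover have "index False ds' c = index sel ds c" by (simp add: index_def ds' len)
  moreover have "digits 16 L (val 16 ds') = ds'" "val 16 ds' < 16 ^ L" using digits_val[OF ds'(1)] val_less[OF ds'(1)] by auto
  ultimately show ?thesis unfolding persons_def by force
qed

lemma index_inj: "ds \<in> words 16 L \<Longrightarrow> c \<noteq> c' \<Longrightarrow> index sel ds c \<noteq> index sel' ds c'"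
  using index_div_mod(1) by metis

lemma pair_lists_persons: "pair_lists (persons L forbs)"
  unfolding pair_lists_def
proof
  fix us assume "us \<in> set (persons L forbs)"
  then obtain ds p where ds: "ds \<in> words 16 L" and p: "person_ok p" and us: "us = map (\<lambda>(sel, c). index sel ds c) p"
    using personsD by blast
  from p consider a c where "p = [(a, c)]"
    | a u b v where "p = [(a, u), (b, v)]" "1 \<le> u" "u < NC" "1 \<le> v" "v < NC" "price v < price u"
    unfolding person_ok_def by blast
  then show "(\<exists>u. us = [u]) \<or>
     (\<exists>u v. us = [u, v] \<and> u \<noteq> v \<and> [u] \<in> set (persons L forbs) \<and> [v] \<in> set (persons L forbs))"
  proof cases
    case 2
    then have "u \<noteq> v" by auto
    then show ?thesis using 2 us persons_single[OF ds] index_inj[OF ds] by simp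
  qed (simp add: us)
qed

lemma universe_instance: "universe (instance_of L forbs) = {..<NC * 4 ^ L}"
  by (simp add: universe_def instance_of_def)

lemma cost_index:
  assumes "ds \<in> words 16 L" "c < NC"
  shows "costs (instance_of L forbs) ! index sel ds c = of_nat (price c)"
  using index_div_mod(1,3)[OF assms(1)] assms(2) by (simp add: instance_of_def)

lemma persons_universe: "us \<in> set (persons L forbs) \<Longrightarrow> set us \<subseteq> universe (instance_of L forbs)"
  unfolding universe_instance using personsD[of us] index_div_mod(3)[of _ L] by (fastforce simp: person_ok_def)

lemma persons_dec:
  assumes "[b, b'] \<in> set (persons L forbs)"
  shows "costs (instance_of L forbs) ! b' < costs (instance_of L forbs) ! b"
proof -
  obtain ds p where ds: "ds \<in> words 16 L" and p: "person_ok p" and us: "[b, b'] = map (\<lambda>(sel, c). index sel ds c) p"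
    using personsD[OF assms] by (elim exE conjE) (rule that)
  from p us obtain a u c v where "p = [(a, u), (c, v)]" "u < NC" "v < NC" "price v < price u"
    unfolding person_ok_def by force
  with us cost_index[OF ds] show ?thesis by simp
qed

lemma choice_cost:
  assumes "ds \<in> words 16 L" "person_ok p"
  shows "costs (instance_of L forbs) ! choice H (map (\<lambda>(sel, c). index sel ds c) p) =
    of_nat (price (snd (chosen (\<lambda>sel c. index sel ds c \<in> H) p)))"
  using assms(2) cost_index[OF assms(1)] by (auto simp: person_ok_def choice_def)

lemma inst_cost:
  assumes "ds \<in> words 16 L" "\<And>p. p \<in> set tm \<Longrightarrow> person_ok p"
  shows "(\<Sum>us\<leftarrow>inst ds tm. costs (instance_of L forbs) ! choice H us) =
    of_nat (pay (\<lambda>sel c. index sel ds c \<in> H) tm)"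
  using assms(2) by (induction tm) (simp_all add: inst_def choice_cost[OF assms(1)])

lemma persons_cost:
  "(\<Sum>us\<leftarrow>persons L forbs. costs (instance_of L forbs) ! choice H us) =
    of_nat ((\<Sum>(ds, s)\<leftarrow>forbs. pay (\<lambda>sel c. index sel ds c \<in> H) (forbid s)) +
      (\<Sum>ds\<leftarrow>map (digits 16 L) [0..<16 ^ L]. pay (\<lambda>sel c. index sel ds c \<in> H) (block (cls ds))))"
proof -
  let ?c = "\<lambda>us. costs (instance_of L forbs) ! choice H us"
  have conc: "(\<Sum>us\<leftarrow>concat xss. ?c us) = (\<Sum>xs\<leftarrow>xss. \<Sum>us\<leftarrow>xs. ?c us)" for xss
    by (induction xss) simp_all
  have "(\<Sum>us\<leftarrow>concat (map (\<lambda>(ds, s). inst ds (forbid s)) fs). ?c us) =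
      of_nat (\<Sum>(ds, s)\<leftarrow>fs. pay (\<lambda>sel c. index sel ds c \<in> H) (forbid s))" if "set fs \<subseteq> set forbs" for fs
    using that
  proof (induction fs)
    case (Cons f fs)
    obtain ds s where f: "f = (ds, s)" by fastforce
    with Cons.prems forbs have "ds \<in> words 4 L" "s < K" by auto
    with inst_cost[OF words_4_16, of ds "forbid s"] forbid_ok Cons f show ?case by simp
  qed simp
  moreover have "(\<Sum>us\<leftarrow>concat (map (\<lambda>j. inst (digits 16 L j) (block (cls (digits 16 L j)))) js). ?c us) =
      of_nat (\<Sum>ds\<leftarrow>map (digits 16 L) js. pay (\<lambda>sel c. index sel ds c \<in> H) (block (cls ds)))" for js
    by (induction js) (simp_all add: inst_cost[OF digits_words] block_ok)
  ultimately show ?thesis by (simp add: persons_def)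
qed

lemma set_words_list: "set (map (digits 16 L) [0..<16 ^ L]) = words 16 L"
  by (simp add: words_image atLeast0LessThan)

text \<open>Each block costs at least \<open>R\<close> and there are \<open>16 ^ L\<close> of them,
  so the budget is met only if every block is optimal and the forbidding people pay nothing. The
  unique high \<open>X\<close> of a cell is then its tile. Conversely the items of the chosen tiles
  and all bottom items are made high.\<close>

theorem instance_yes_iff: "mcpi_yes (instance_of L forbs) \<longleftrightarrow> (\<exists>T. csp L forbs T)"
proof -
  define hi where "hi = (\<lambda>H ds sel c. index sel ds c \<in> H)"
  define F where "F = (\<lambda>H. \<Sum>(ds, s)\<leftarrow>forbs. pay (hi H ds) (forbid s))"
  define G where "G = (\<lambda>H. \<Sum>ds\<leftarrow>map (digits 16 L) [0..<16 ^ L]. pay (hi H ds) (block (cls ds)))"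
  have RG: "(\<Sum>ds\<leftarrow>map (digits 16 L) [0..<16 ^ L]. R) = R * 16 ^ L"
    by (simp add: o_def sum_list_triv mult.commute)
  have yes: "mcpi_yes (instance_of L forbs) \<longleftrightarrow> (\<exists>H. F H + G H \<le> R * 16 ^ L)"
  proof -
    have "mcpi_yes (instance_of L forbs) \<longleftrightarrow>
        (\<exists>H. (\<Sum>us\<leftarrow>persons L forbs. costs (instance_of L forbs) ! choice H us) \<le> budget (instance_of L forbs))"
    proof (rule mcpi_yes_iff_choice[OF pair_lists_persons])
      show "prefs (instance_of L forbs) = map strict_pref (persons L forbs)" by (simp add: instance_of_def)
      show "\<forall>us\<in>set (persons L forbs). set us \<subseteq> universe (instance_of L forbs)" using persons_universe by blast
      show "costs (instance_of L forbs) ! v \<le> costs (instance_of L forbs) ! u"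
        if "[u, v] \<in> set (persons L forbs)" for u v using persons_dec[OF that] by simp
      show "\<forall>q\<in>set (costs (instance_of L forbs)). 0 \<le> q" by (simp add: instance_of_def)
    qed
    also have "\<dots> \<longleftrightarrow> (\<exists>H. F H + G H \<le> R * 16 ^ L)"
      unfolding persons_cost F_def[symmetric] G_def[symmetric] hi_def[symmetric]
      by (simp add: instance_of_def F_def G_def hi_def flip: of_nat_add of_nat_mult of_nat_power) 
    finally show ?thesis .
  qed
  have ge: "R \<le> pay h (block z)" for h z using body_price_le[of z h] R(1)[of z] by (simp add: pay_block)
  have block_tight: "pay h (block z) \<le> R \<longleftrightarrow> pay h (body z) \<le> body_price z" for h z
    using R(1)[of z] by (simp add: pay_block) linarith
  show ?thesis unfolding yes
  proof
    assume "\<exists>H. F H + G H \<le> R * 16 ^ L"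
    then obtain H where H: "F H + G H \<le> R * 16 ^ L" ..
    have GR: "R * 16 ^ L \<le> G H" unfolding G_def RG[symmetric] by (rule sum_list_mono) (rule ge)
    have tight: "pay (hi H ds) (body (cls ds)) \<le> body_price (cls ds)" if ds: "ds \<in> words 16 L" for ds
    proof (rule ccontr)
      assume "\<not> pay (hi H ds) (body (cls ds)) \<le> body_price (cls ds)"
      then have "R < pay (hi H ds) (block (cls ds))" using block_tight by (meson not_less)
      then have "R * 16 ^ L < G H"
        unfolding G_def RG[symmetric]
        by (intro sum_list_strict_mono_ex[of _ _ _ ds]) (use ge ds set_words_list in auto)
      with H show False by simp
    qed
    have F0: "F H = 0" using H GR by simp
    have fb: "\<not> hi H ds False (X s)" if "(ds, s) \<in> set forbs" for ds s
    proof -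
      have "pay (hi H ds) (forbid s) = 0"
        using F0 that unfolding F_def by (force simp: sum_list_eq_0_iff)
      moreover have "0 < price (X s)" using forbs[OF that] K by simp
      ultimately show ?thesis by (auto simp: forbid_def split: if_splits)
    qed
    \<comment> \<open>Whether an item is high depends on its cell only, not on the pair of cells
      through which it is addressed.\<close>
    define g where "g = (\<lambda>w c. val 4 w + 4 ^ L * c \<in> H)"
    have g: "hi H ds sel c \<longleftrightarrow> g (cell sel ds) c" if "ds \<in> words 16 L" for ds sel c
      using that by (simp add: hi_def g_def index_def words_def)
    define T where "T = (\<lambda>w. THE s. s < K \<and> g w (X s))"
    have key: "T w < K \<and> g w (X (T w)) \<and> g w (Y (T w))" if w: "w \<in> words 4 L" for w
    proof -
      obtain ds where ds: "ds \<in> words 16 L" "cell False ds = w" "cell True ds = w"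
        using pair_word[OF w w] by blast
      then have "same (cls ds)" using same_cls by simp
      from body_tight(2)[OF tight[OF ds(1)] this]
      have ex: "\<exists>!s. s < K \<and> g w (X s)" "\<exists>!s. s < K \<and> g w (Y s)" using g[OF ds(1)] ds by simp_all
      from theI'[OF ex(1)] have TX: "T w < K \<and> g w (X (T w))" by (simp add: T_def)
      from ex(2) obtain s where s: "s < K" "g w (Y s)" by blast
      \<comment> \<open>In the block of a cell paired with itself all different indices conflict, so
        the selections among \<open>X\<close> and \<open>Y\<close> agree.\<close>
      have "s = T w"
      proof (rule ccontr)
        assume "s \<noteq> T w"
        then have "conf (cls ds) (T w) s" using conf_same[OF \<open>same (cls ds)\<close>, of "T w" s] by simp
        from body_tight(1)[OF tight[OF ds(1)] conjunct1[OF TX] s(1) this]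
        show False using g[OF ds(1)] ds TX s by simp
      qed
      with TX s show ?thesis by simp
    qed
    have "csp L forbs T"
      unfolding csp_def
    proof (intro conjI ballI)
      fix ds assume ds: "ds \<in> words 16 L"
      note k = key[OF cell_words[OF ds, of False]] key[OF cell_words[OF ds, of True]]
      show "\<not> conf (cls ds) (T (cell False ds)) (T (cell True ds))"
        using body_tight(1)[OF tight[OF ds], of "T (cell False ds)" "T (cell True ds)"] k g[OF ds] by blast
    next
      fix p assume p: "p \<in> set forbs"
      obtain ds s where ps: "p = (ds, s)" by fastforce
      then have "ds \<in> words 4 L" using forbs p by simp
      then show "case p of (ds, s) \<Rightarrow> T ds \<noteq> s"
        using fb[of ds s] p ps key[of ds] g[OF words_4_16, of ds False "X s"] cell_False[of ds L] by auto
    qed (use key in blast)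
    then show "\<exists>T. csp L forbs T" by (rule exI[of _ T])
  next
    assume "\<exists>T. csp L forbs T"
    then obtain T where T: "csp L forbs T" ..
    \<comment> \<open>The bound \<open>2 + 2 * K\<close> is the code of \<open>Bot 0\<close>: all
      bottom items are high, whereas \<open>Top\<close>, one code below, is low.\<close>
    define g where "g = (\<lambda>w c. c = X (T w) \<or> c = Y (T w) \<or> 2 + 2 * K \<le> c)"
    define H where "H = {b. g (digits 4 L (b mod 4 ^ L)) (b div 4 ^ L)}"
    have g: "hi H ds sel c \<longleftrightarrow> g (cell sel ds) c" if "ds \<in> words 16 L" for ds sel c
      using index_div_mod(1,2)[OF that] by (simp add: hi_def H_def)
    have TK: "T w < K" if "w \<in> words 4 L" for w using T that by (simp add: csp_def)
    have gX: "g w (X s) \<longleftrightarrow> s = T w" and gY: "g w (Y s) \<longleftrightarrow> s = T w"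
      and gB: "g w (Bot j)" and gT: "\<not> g w Top" if "w \<in> words 4 L" "s < K" for w s j
      using TK[OF that(1)] that(2) by (auto simp: g_def X_def Y_def Top_def Bot_def)
    have F: "pay (hi H ds) (forbid s) = 0" if "(ds, s) \<in> set forbs" for ds s
    proof -
      have *: "ds \<in> words 4 L" "s < K" "s \<noteq> T ds" using forbs[OF that] T that by (auto simp: csp_def)
      then show ?thesis
        using g[OF words_4_16[OF *(1)]] cell_False[OF *(1)] gX[OF *(1,2)] gB[OF *(1,2), of 0] by (simp add: forbid_def)
    qed
    have G: "pay (hi H ds) (block (cls ds)) = R" if ds: "ds \<in> words 16 L" for ds
    proof -
      have c: "cell sel ds \<in> words 4 L" for sel using cell_words[OF ds] .
      have "pay (hi H ds) (body (cls ds)) = body_price (cls ds)"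
      proof (rule body_exact)
        show "hi H ds sel (Bot j)" for sel j using g[OF ds] gB[OF c K] by simp
        show "\<not> hi H ds False Top" using g[OF ds] gT[OF c K] by simp
        show "\<not> (hi H ds False (X s) \<and> hi H ds True (Y s'))" if "s < K" "s' < K" "conf (cls ds) s s'" for s s'
        proof -
          have "\<not> conf (cls ds) (T (cell False ds)) (T (cell True ds))" using T ds by (simp add: csp_def)
          then show ?thesis using g[OF ds] gX[OF c that(1)] gY[OF c that(2)] that(3) by metis
        qed
        show "(\<exists>!s. s < K \<and> hi H ds False (X s)) \<and> (\<exists>!s. s < K \<and> hi H ds False (Y s))"
        proof (intro conjI ex1I[of _ "T (cell False ds)"])
        qed (use g[OF ds] gX[OF c] gY[OF c] TK[OF c] in auto)
      qed
      then show ?thesis using R(1)[of "cls ds"] by (simp add: pay_block)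
    qed
    have "F H = 0" using F by (auto simp: F_def sum_list_eq_0_iff)
    moreover have "G H = R * 16 ^ L"
      unfolding G_def RG[symmetric] by (intro arg_cong[of _ _ sum_list] map_cong refl G) (use set_words_list in auto)
    ultimately show "\<exists>H. F H + G H \<le> R * 16 ^ L" by (intro exI[of _ H]) simp
  qed
qed

lemma instance_ok:
  "instance_of L forbs \<in> mcpi_instances" "lists_at_most 2 (instance_of L forbs)" "from_master_list (instance_of L forbs)"
proof -
  let ?I = "instance_of L forbs"
  have len: "us \<noteq> [] \<and> length us \<le> 2 \<and> distinct us" if "us \<in> set (persons L forbs)" for us
    using pair_lists_persons that unfolding pair_lists_def by force
  have cc: "concat (strict_pref us) = us" "[] \<notin> set (strict_pref us)" for us
    by (induction us) (auto simp: strict_pref_def)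
  have pr: "prefs ?I = map strict_pref (persons L forbs)" by (simp add: instance_of_def)
  show "lists_at_most 2 ?I" using len by (simp add: lists_at_most_def pr cc)
  show "?I \<in> mcpi_instances"
    using len persons_universe by (auto simp: mcpi_instances_def pr cc) (auto simp: instance_of_def)
  \<comment> \<open>Sorting by falling price respects every list, as items of equal price never
    share one.\<close>
  define ms where "ms = sort_key (\<lambda>b. - (costs ?I ! b)) [0..<NC * 4 ^ L]"
  have sorted: "costs ?I ! b' \<le> costs ?I ! b" if "precedes ms b b'" for b b'
  proof -
    have "sorted (map (\<lambda>b. - (costs ?I ! b)) ms)" by (simp add: ms_def)
    with that show ?thesis unfolding precedes_def sorted_iff_nth_mono_less by force
  qed
  have dist: "distinct ms" "set ms = universe ?I" by (simp_all add: ms_def universe_instance atLeast0LessThan)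
  show "from_master_list ?I"
    unfolding from_master_list_def
  proof (intro exI[of _ ms] conjI dist ballI)
    fix P assume "P \<in> set (prefs ?I)"
    then obtain us where us: "P = strict_pref us" "us \<in> set (persons L forbs)" by (auto simp: pr)
    show "length c = 1" if "c \<in> set P" for c using that us by (auto simp: strict_pref_def)
    show "precedes ms b b' \<longrightarrow> prefers_item P b b'" if b: "b \<in> items_on P" "b' \<in> items_on P" for b b'
    proof
      assume pre: "precedes ms b b'"
      then have ne: "b \<noteq> b'" using dist(1) unfolding precedes_def by (auto simp: nth_eq_iff_index_eq)
      then obtain u v where uv: "us = [u, v]"
        using b us pair_lists_persons unfolding pair_lists_def by fastforce
      then have "costs ?I ! v < costs ?I ! u" using persons_dec us by blast
      with sorted[OF pre] b us uv ne show "prefers_item P b b'" by auto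
    qed
  qed
qed

end

end


section \<open>Tableaux of multi-tape machines\<close>

text \<open>The symbols under all heads are repeated in every cell as \<open>trd\<close>, so that a
  transition is a local condition although the heads may be far apart.\<close>

record tile =
  tflag :: bool
  tst :: nat
  trd :: "nat list"
  tsy :: "nat list"
  thd :: "bool list"

definition tiles :: "tm \<Rightarrow> tile set" where
  "tiles M = {s. tst s \<le> nstates M + 1 \<and>
     length (trd s) = ntapes M \<and> set (trd s) \<subseteq> {..<nsymbols M} \<and>
     length (tsy s) = ntapes M \<and> set (tsy s) \<subseteq> {..<nsymbols M} \<and>
     length (thd s) = ntapes M \<and> (\<forall>j<ntapes M. thd s ! j \<longrightarrow> trd s ! j = tsy s ! j)}"

text \<open>A halting state rewrites what is read and stays, so that the tableau can continue to its
  last row.\<close>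

definition trans :: "tm \<Rightarrow> nat \<Rightarrow> nat list \<Rightarrow> nat \<times> (nat \<times> dir) list" where
  "trans M q rs = (if q < nstates M then delta M q rs else (q, map (\<lambda>r. (r, Stay)) rs))"

definition horiz :: "tile \<Rightarrow> tile \<Rightarrow> bool" where
  "horiz s s' \<longleftrightarrow> tflag s = tflag s' \<and> tst s = tst s' \<and> trd s = trd s'"

definition blank_mono :: "tile \<Rightarrow> tile \<Rightarrow> bool" where
  "blank_mono s s' \<longleftrightarrow> (tflag s \<and> tsy s ! 1 = 0 \<longrightarrow> tsy s' ! 1 = 0)"

definition vert :: "tm \<Rightarrow> tile \<Rightarrow> tile \<Rightarrow> bool" where
  "vert M s s' \<longleftrightarrow> (case trans M (tst s) (trd s) of (q', as) \<Rightarrow>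
     \<not> tflag s' \<and> tst s' = q' \<and>
     (\<forall>j<ntapes M. tsy s' ! j = (if thd s ! j then fst (as ! j) else tsy s ! j)))"

text \<open>\<open>local_ok\<close> supplies the two cells: the mark of a head that moves in
  direction \<open>d\<close> reappears in the next row in the cell on that side.\<close>

definition head_move :: "tm \<Rightarrow> dir \<Rightarrow> tile \<Rightarrow> tile \<Rightarrow> bool" where
  "head_move M d s s' \<longleftrightarrow> (case trans M (tst s) (trd s) of (q', as) \<Rightarrow>
     (\<forall>j<ntapes M. snd (as ! j) = d \<longrightarrow> thd s' ! j = thd s ! j))"

text \<open>The columns are cyclic, so that a tape is folded to a cylinder that its head cannot go around.
  All tiles of a row agree on the state and on the symbols read.\<close>

definition local_ok :: "tm \<Rightarrow> nat \<Rightarrow> (nat \<Rightarrow> nat \<Rightarrow> tile) \<Rightarrow> bool" where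
  "local_ok M N T \<longleftrightarrow> (\<forall>t<N. \<forall>i<N. T t i \<in> tiles M \<and> horiz (T t i) (T t ((i + 1) mod N)) \<and>
     (i + 1 < N \<longrightarrow> blank_mono (T t i) (T t (i + 1))) \<and>
     (t + 1 < N \<longrightarrow> vert M (T t i) (T (t + 1) i) \<and> head_move M Stay (T t i) (T (t + 1) i) \<and>
        head_move M Go_Right (T t i) (T (t + 1) ((i + 1) mod N)) \<and>
        head_move M Go_Left (T t ((i + 1) mod N)) (T (t + 1) i)))"

text \<open>The certificate may have any length up to \<open>r\<close>: its cells form a prefix of the first \<open>r\<close> cells,
  which \<open>blank_mono\<close> enforces in the initial row, the only one with \<open>tflag\<close>.\<close>

definition initial_ok :: "bool list \<Rightarrow> nat \<Rightarrow> nat \<Rightarrow> nat \<Rightarrow> tile \<Rightarrow> bool" where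
  "initial_ok x r K i s \<longleftrightarrow> tflag s \<and> tst s = 0 \<and> (\<forall>j<K. thd s ! j \<longleftrightarrow> i = 0) \<and>
     (\<forall>j<K. 2 \<le> j \<longrightarrow> tsy s ! j = 0) \<and> tsy s ! 0 = contents_of x (int i) \<and>
     (if i < r then tsy s ! 1 \<le> 2 else tsy s ! 1 = 0)"

lemma finite_tiles: "finite (tiles M)"
proof -
  let ?L = "{xs :: nat list. set xs \<subseteq> {..<nsymbols M} \<and> length xs = ntapes M}"
  let ?B = "{xs :: bool list. set xs \<subseteq> UNIV \<and> length xs = ntapes M}"
  have "finite ?L" "finite ?B" by (intro finite_lists_length_eq; simp)+
  then have "finite ((UNIV :: bool set) \<times> {..nstates M + 1} \<times> ?L \<times> ?L \<times> ?B)"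
    by (intro finite_cartesian_product) simp_all
  moreover have "tiles M \<subseteq> (\<lambda>(f, q, rs, ss, hs). \<lparr>tflag = f, tst = q, trd = rs, tsy = ss, thd = hs\<rparr>) `
      ((UNIV :: bool set) \<times> {..nstates M + 1} \<times> ?L \<times> ?L \<times> ?B)"
  proof
    fix s assume "s \<in> tiles M"
    then show "s \<in> (\<lambda>(f, q, rs, ss, hs). \<lparr>tflag = f, tst = q, trd = rs, tsy = ss, thd = hs\<rparr>) `
      ((UNIV :: bool set) \<times> {..nstates M + 1} \<times> ?L \<times> ?L \<times> ?B)"
      by (intro image_eqI[of _ _ "(tflag s, tst s, trd s, tsy s, thd s)"]) (auto simp: tiles_def)
  qed
  ultimately show ?thesis by (rule finite_surj)
qed

lemma act_Stay [simp]: "act (read tp, Stay) tp = tp"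
  by (cases tp) simp

lemma step_trans:
  "step M (q, ts) = (case trans M q (map read ts) of (q', as) \<Rightarrow> (q', map2 act as ts))"
proof (cases "q < nstates M")
  case False
  have "map2 act (map (\<lambda>r. (r, Stay)) (map read ts)) ts = ts"
    by (rule nth_equalityI) (auto simp: act_Stay)
  with False show ?thesis by (simp add: trans_def step.simps)
qed (simp add: trans_def step.simps)

lemma trans_wf:
  assumes "wf_tm M" "q \<le> nstates M + 1" "length rs = ntapes M" "set rs \<subseteq> {..<nsymbols M}"
    and "trans M q rs = (q', as)"
  shows "q' \<le> nstates M + 1 \<and> length as = ntapes M \<and> fst ` set as \<subseteq> {..<nsymbols M}"
proof (cases "q < nstates M")
  case True
  then show ?thesis using assms unfolding wf_tm_def trans_def by fastforce
next
  case False
  then show ?thesis using assms unfolding trans_def by auto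
qed

declare step.simps [simp del]

lemma set_map_below:
  assumes "\<And>j. j < length xs \<Longrightarrow> f (xs ! j) < (m :: nat)"
  shows "set (map f xs) \<subseteq> {..<m}"
proof
  fix y assume "y \<in> set (map f xs)"
  then obtain j where "j < length (map f xs)" "map f xs ! j = y"
    unfolding in_set_conv_nth by blast
  with assms show "y \<in> {..<m}" by auto
qed

lemma run_Suc: "run M inputs (Suc t) = step M (run M inputs t)"
  by (simp add: run_def)

text \<open>The bound on the head positions is what allows folding a tape to a cylinder without
  collisions.\<close>

lemma run_inv:
  assumes wf: "wf_tm M" and "run M [x, u] t = (q, ts)"
  shows "q \<le> nstates M + 1 \<and> length ts = ntapes M \<and>
    (\<forall>j<ntapes M. (\<forall>i. fst (ts ! j) i < nsymbols M) \<and> \<bar>snd (ts ! j)\<bar> \<le> int t)"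
  using assms(2)
proof (induction t arbitrary: q ts)
  case 0
  have "3 \<le> nsymbols M" using wf by (simp add: wf_tm_def)
  with 0 show ?case by (auto simp: run_def init_def contents_of_def)
next
  case (Suc t)
  obtain q0 ts0 where 0: "run M [x, u] t = (q0, ts0)" by fastforce
  note IH = Suc.IH[OF 0]
  obtain as where tr: "trans M q0 (map read ts0) = (q, as)" and ts: "ts = map2 act as ts0"
    using Suc.prems unfolding run_Suc 0 step_trans by (auto split: prod.splits)
  have rd: "read (ts0 ! j) < nsymbols M" if "j < ntapes M" for j
    using IH that by (cases "ts0 ! j") (metis fst_conv read.simps)
  have *: "q \<le> nstates M + 1 \<and> length as = ntapes M \<and> fst ` set as \<subseteq> {..<nsymbols M}"
  proof (rule trans_wf[OF wf _ _ _ tr])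
    show "set (map read ts0) \<subseteq> {..<nsymbols M}"
      using IH rd by (intro set_map_below) simp
  qed (use IH in simp_all)
  moreover have "fst (as ! j) < nsymbols M" if "j < ntapes M" for j
  proof -
    have "as ! j \<in> set as" using that * by simp
    then show ?thesis using * by blast
  qed
  moreover have "(\<forall>i. fst (act a tp) i < nsymbols M) \<and> \<bar>snd (act a tp)\<bar> \<le> int (Suc t)"
    if "\<forall>i. fst tp i < nsymbols M" "\<bar>snd tp\<bar> \<le> int t" "fst a < nsymbols M" for a tp
    using that by (cases tp; cases a; cases "snd a") auto
  ultimately show ?case using IH unfolding ts by simp
qed

lemma run_halted_mono:
  assumes "halted M (run M inputs p)" "p \<le> t"
  shows "run M inputs t = run M inputs p"
  using assms(2)
proof (induction t rule: dec_induct)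
  case (step t)
  obtain q ts where "run M inputs p = (q, ts)" by fastforce
  with step assms(1) show ?case by (simp add: run_Suc halted_def step.simps)
qed simp

section \<open>Runs of a verifier as tableaux on a cylinder\<close>

locale tableau =
  fixes M :: tm and x :: "bool list" and p r N :: nat
  assumes wf: "wf_tm M"
    and N: "2 * (p + r + length x + 2) \<le> N"
    and halts: "\<And>u. length u \<le> r \<Longrightarrow> halted M (run M [x, u] p)"
begin

text \<open>The columns in the second half of the cylinder stand for negative tape
  positions.\<close>

definition rep :: "nat \<Rightarrow> int" where
  "rep i = (if 2 * i < N then int i else int i - int N)"

definition expected :: "bool list \<Rightarrow> nat \<Rightarrow> nat \<Rightarrow> tile" where
  "expected u t i = (case run M [x, u] t of (q, ts) \<Rightarrow>
     \<lparr>tflag = (t = 0), tst = q, trd = map read ts, tsy = map (\<lambda>tp. fst tp (rep i)) ts,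
      thd = map (\<lambda>tp. snd tp mod int N = int i) ts\<rparr>)"

lemma mod_rep:
  assumes "i < N" "2 * \<bar>h\<bar> < int N"
  shows "h mod int N = int i \<longleftrightarrow> h = rep i"
proof (cases "0 \<le> h")
  case True
  then have "h mod int N = h" using assms by (intro mod_pos_pos_trivial) auto
  then show ?thesis using assms True by (auto simp: rep_def)
next
  case False
  have "h mod int N = (h + int N) mod int N" by simp
  also have "\<dots> = h + int N" using assms False by (intro mod_pos_pos_trivial) auto
  finally show ?thesis using assms False by (auto simp: rep_def)
qed

text \<open>The head bound holds at all times \<open>t\<close>, since after \<open>p\<close> steps
  the machine has halted and its heads no longer move.\<close>

lemma run_expected:
  assumes u: "length u \<le> r" and run: "run M [x, u] t = (q, ts)"
  shows "q \<le> nstates M + 1" "length ts = ntapes M"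
    "\<And>j i. j < ntapes M \<Longrightarrow> fst (ts ! j) i < nsymbols M"
    "\<And>j. j < ntapes M \<Longrightarrow> 2 * \<bar>snd (ts ! j)\<bar> < int N"
proof -
  note * = run_inv[OF wf run]
  then show "q \<le> nstates M + 1" "length ts = ntapes M"
    "\<And>j i. j < ntapes M \<Longrightarrow> fst (ts ! j) i < nsymbols M" by auto
  fix j assume j: "j < ntapes M"
  have "\<bar>snd (ts ! j)\<bar> \<le> int p"
  proof (cases "t \<le> p")
    case True
    with * j show ?thesis by force
  next
    case False
    with run_halted_mono[OF halts[OF u], of t] run have "run M [x, u] p = (q, ts)" by simp
    from run_inv[OF wf this] j show ?thesis by blast
  qed
  moreover have "int (2 * p) < int N" using N by (intro iffD2[OF of_nat_less_iff]) simp
  ultimately show "2 * \<bar>snd (ts ! j)\<bar> < int N" by simp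
qed

lemma read_conv: "read tp = fst tp (snd tp)"
  by (cases tp) simp

lemma expected_tiles:
  assumes u: "length u \<le> r" and "i < N"
  shows "expected u t i \<in> tiles M"
proof -
  obtain q ts where run: "run M [x, u] t = (q, ts)" by fastforce
  note R = run_expected[OF u run]
  have "set (map read ts) \<subseteq> {..<nsymbols M}" "set (map (\<lambda>tp. fst tp (rep i)) ts) \<subseteq> {..<nsymbols M}"
    using R(2,3) by (intro set_map_below; simp add: read_conv)+
  then show ?thesis
    using R(1,2) mod_rep[OF \<open>i < N\<close> R(4)]
    by (simp add: tiles_def expected_def run read_conv)
qed

lemma mod_shift:
  assumes "i < N"
  shows "(h + 1) mod int N = int ((i + 1) mod N) \<longleftrightarrow> h mod int N = int i"
    and "h mod int N = int ((i + 1) mod N) \<longleftrightarrow> (h - 1) mod int N = int i"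
proof -
  have *: "(h + 1) mod int N = int ((i + 1) mod N) \<longleftrightarrow> h mod int N = int i" for h
  proof -
    have "(h + 1) mod int N = int ((i + 1) mod N) \<longleftrightarrow> (h + 1) mod int N = (int i + 1) mod int N"
      by (simp add: zmod_int add.commute)
    also have "\<dots> \<longleftrightarrow> h mod int N = int i mod int N"
      by (simp add: mod_eq_dvd_iff)
    finally show ?thesis using assms by simp
  qed
  show "(h + 1) mod int N = int ((i + 1) mod N) \<longleftrightarrow> h mod int N = int i" by (rule *)
  show "h mod int N = int ((i + 1) mod N) \<longleftrightarrow> (h - 1) mod int N = int i" using *[of "h - 1"] by simp
qed

lemma expected_ok:
  assumes u: "length u \<le> r"
  shows "local_ok M N (expected u)"
  unfolding local_ok_def
proof (intro allI impI conjI)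
  fix t i assume t: "t < N" and i: "i < N"
  show "expected u t i \<in> tiles M" using u i by (rule expected_tiles)
  obtain q ts where run: "run M [x, u] t = (q, ts)" by fastforce
  note R = run_expected[OF u run]
  show "horiz (expected u t i) (expected u t ((i + 1) mod N))"
    by (simp add: horiz_def expected_def run)
  have K: "2 \<le> ntapes M" using wf by (simp add: wf_tm_def)
  \<comment> \<open>The wrap-around is excluded: column \<open>N - 1\<close> is blank in the initial
    row, but the certificate may start in column 0.\<close>
  show "blank_mono (expected u t i) (expected u t (i + 1))" if "i + 1 < N"
  proof (cases "t = 0")
    case True
    with run K have "fst (ts ! 1) = contents_of u" by (auto simp: run_def init_def)
    then show ?thesis
      using K R(2) that by (auto simp: blank_mono_def expected_def run contents_of_def rep_def split: if_splits)
  next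
    case False
    then show ?thesis by (simp add: blank_mono_def expected_def run)
  qed
  obtain q' as where tr: "trans M q (map read ts) = (q', as)" by fastforce
  have run': "run M [x, u] (Suc t) = (q', map2 act as ts)"
    by (simp add: run_Suc run step_trans tr)
  have "length as = ntapes M"
  proof -
    have "set (map read ts) \<subseteq> {..<nsymbols M}"
      using R(2,3) by (intro set_map_below) (simp add: read_conv)
    from trans_wf[OF wf R(1) _ this tr] R(2) show ?thesis by simp
  qed
  then have len: "length as = ntapes M" "length (zip as ts) = ntapes M" using R(2) by auto
  have act_sel: "fst (act a tp) k = (if k = snd tp then fst a else fst tp k)"
    "snd (act a tp) = move (snd a) (snd tp)" for a tp k by (cases a; cases tp; simp)+
  show "vert M (expected u t i) (expected u (t + 1) i)"
    using R(2) len mod_rep[OF i R(4)] by (auto simp: vert_def expected_def run run' tr act_sel)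
  show "head_move M Stay (expected u t i) (expected u (t + 1) i)"
    using R(2) len by (auto simp: head_move_def expected_def run run' tr act_sel)
  show "head_move M Go_Right (expected u t i) (expected u (t + 1) ((i + 1) mod N))"
    using R(2) len mod_shift(1)[OF i] by (auto simp: head_move_def expected_def run run' tr act_sel)
  show "head_move M Go_Left (expected u t ((i + 1) mod N)) (expected u (t + 1) i)"
    using R(2) len mod_shift(2)[OF i] by (auto simp: head_move_def expected_def run run' tr act_sel)
qed

lemma expected_initial:
  assumes u: "length u \<le> r" and i: "i < N"
  shows "initial_ok x r (ntapes M) i (expected u 0 i)"
proof -
  have K: "2 \<le> ntapes M" using wf by (simp add: wf_tm_def)
  have run: "run M [x, u] 0 = (0, map (\<lambda>i. (contents_of (if i < 2 then [x, u] ! i else []), 0)) [0..<ntapes M])"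
    by (simp add: run_def init_def)
  have c: "contents_of y (rep i) = contents_of y (int i)" if "2 * length y \<le> N" for y
    using that i by (auto simp: contents_of_def rep_def)
  have "2 * length x \<le> N" "2 * length u \<le> N" using N u by auto
  note c = c[OF this(1)] c[OF this(2)]
  have "contents_of u k \<le> 2" for k by (simp add: contents_of_def)
  moreover have "contents_of u (int i) = 0" if "\<not> i < r" using that u by (simp add: contents_of_def)
  ultimately show ?thesis
    using K i c by (auto simp: initial_ok_def expected_def run contents_of_def[of "[]"])
qed

lemma row_constant:
  assumes "local_ok M N T" "t < N" "i < N"
  shows "horiz (T t 0) (T t i)"
  using assms(3)
proof (induction i)
  case 0
  then show ?case by (simp add: horiz_def)
next
  case (Suc i)
  then have "horiz (T t i) (T t ((i + 1) mod N))" "horiz (T t 0) (T t i)"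
    using assms(1)[unfolded local_ok_def, rule_format, OF assms(2), of i] by simp_all
  with Suc.prems show ?case by (simp add: horiz_def)
qed

text \<open>The read symbols of a row are pinned down by the column that holds the respective head.\<close>

lemma row_agree:
  assumes u: "length u \<le> r" and T: "local_ok M N T" and t: "t < N"
    and eq: "\<And>i. i < N \<Longrightarrow> tflag (T t i) = tflag (expected u t i) \<and> tst (T t i) = tst (expected u t i) \<and>
      (\<forall>j<ntapes M. tsy (T t i) ! j = tsy (expected u t i) ! j \<and> thd (T t i) ! j = thd (expected u t i) ! j)"
    and i: "i < N"
  shows "T t i = expected u t i"
proof -
  obtain q ts where run: "run M [x, u] t = (q, ts)" by fastforce
  note R = run_expected[OF u run]
  have Tt: "T t i' \<in> tiles M" "expected u t i' \<in> tiles M" if "i' < N" for i'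
    using T that t expected_tiles[OF u that] by (auto simp: local_ok_def)
  have N0: "0 < N" using t by simp
  have "trd (T t i) = trd (expected u t i)"
  proof (rule nth_equalityI)
    show "length (trd (T t i)) = length (trd (expected u t i))" using Tt[OF i] by (simp add: tiles_def)
    fix j assume "j < length (trd (T t i))"
    then have j: "j < ntapes M" using Tt(1)[OF i] by (simp add: tiles_def)
    define k where "k = nat (snd (ts ! j) mod int N)"
    have k: "k < N" "int k = snd (ts ! j) mod int N" using N0 by (auto simp: k_def nat_less_iff)
    have h: "thd (expected u t k) ! j" using R(2) j k by (simp add: expected_def run)
    then have "thd (T t k) ! j" using eq[OF k(1)] j by blast
    then have "trd (T t k) ! j = tsy (T t k) ! j" using Tt(1)[OF k(1)] j by (simp add: tiles_def)
    also have "\<dots> = tsy (expected u t k) ! j" using eq[OF k(1)] j by blast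
    also have "\<dots> = trd (expected u t k) ! j" using Tt(2)[OF k(1)] h j by (simp add: tiles_def)
    finally show "trd (T t i) ! j = trd (expected u t i) ! j"
      using row_constant[OF T t i] row_constant[OF T t k(1)] row_constant[OF expected_ok[OF u] t i]
        row_constant[OF expected_ok[OF u] t k(1)] by (simp add: horiz_def)
  qed
  moreover have "tsy (T t i) = tsy (expected u t i)" "thd (T t i) = thd (expected u t i)"
    by (rule nth_equalityI; use Tt[OF i] eq[OF i] in \<open>simp add: tiles_def\<close>)+
  ultimately show ?thesis using eq[OF i] by (intro tile.equality) simp_all
qed

text \<open>The certificate is read off the initial row. From then on every row is forced by the one
  before: the transition is the same in all its cells and determines the symbols, the state and the
  marks of the heads.\<close>

lemma tableau_unique:
  assumes T: "local_ok M N T" and init: "\<And>i. i < N \<Longrightarrow> initial_ok x r (ntapes M) i (T 0 i)"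
  shows "\<exists>u. length u \<le> r \<and> (\<forall>t<N. \<forall>i<N. T t i = expected u t i)"
proof -
  define c where "c = (\<lambda>i. tsy (T 0 i) ! 1)"
  have K: "2 \<le> ntapes M" using wf by (simp add: wf_tm_def)
  have N0: "0 < N" "r < N" using N by auto
  have c2: "c i \<le> 2" "r \<le> i \<Longrightarrow> c i = 0" if "i < N" for i
    using init[OF that] by (auto simp: initial_ok_def c_def split: if_splits)
  \<comment> \<open>The first blank ends the certificate; by \<open>blank_mono\<close> everything
    behind it is blank too.\<close>
  define l where "l = (LEAST i. c i = 0)"
  have l: "c l = 0" "l \<le> r" "\<And>i. i < l \<Longrightarrow> c i \<noteq> 0"
    unfolding l_def using c2(2)[OF N0(2)] by (auto intro: LeastI Least_le dest: not_less_Least)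
  have mono: "c i = 0" if "l \<le> i" "i < N" for i
    using that
  proof (induction i rule: dec_induct)
    case (step i)
    then have "blank_mono (T 0 i) (T 0 (i + 1))" "initial_ok x r (ntapes M) i (T 0 i)"
      using T init N0 by (auto simp: local_ok_def)
    with step show ?case by (simp add: blank_mono_def initial_ok_def c_def)
  qed (rule l(1))
  define u where "u = map (\<lambda>i. c i = 2) [0..<l]"
  have u: "length u \<le> r" using l by (simp add: u_def)
  have cu: "contents_of u (int i) = c i" if "i < N" for i
  proof (cases "i < l")
    case True
    with l(3)[OF this] c2(1)[OF that] show ?thesis by (auto simp: contents_of_def u_def)
  next
    case False
    with mono that show ?thesis by (auto simp: contents_of_def u_def)
  qed
  have "\<forall>i<N. T t i = expected u t i" if "t < N" for t
    using that
  proof (induction t)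
    case 0
    show ?case
    proof (intro allI impI row_agree[OF u T 0], goal_cases)
      case (1 _ i)
      have eu: "tsy (expected u 0 i) ! 1 = c i"
      proof -
        have "contents_of u (rep i) = contents_of u (int i)"
          using N u 1(2) by (auto simp: contents_of_def rep_def)
        with cu[OF 1(2)] K show ?thesis by (simp add: expected_def run_def init_def)
      qed
      have "tsy (T 0 i) ! j = tsy (expected u 0 i) ! j" if "j < ntapes M" for j
      proof (cases "j = 1")
        case True
        then show ?thesis using eu by (simp add: c_def)
      next
        case False
        then have "j = 0 \<or> 2 \<le> j" by auto
        then show ?thesis
          using init[OF 1(2)] expected_initial[OF u 1(2)] that by (auto simp: initial_ok_def)
      qed
      then show ?case
        using init[OF 1(2)] expected_initial[OF u 1(2)] by (auto simp: initial_ok_def)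
    qed
  next
    case (Suc t)
    then have eq: "T t i = expected u t i" if "i < N" for i using that by simp
    have t: "t < N" "t + 1 < N" using Suc.prems by auto
    show ?case
    proof (intro allI impI row_agree[OF u T Suc.prems], goal_cases)
      case (1 _ i)
      then have i: "i < N" by simp
      \<comment> \<open>The left neighbour of column \<open>i\<close> on the cylinder.\<close>
      define b where "b = (i + (N - 1)) mod N"
      have b: "b < N" "(b + 1) mod N = i" "(i + 1) mod N < N"
        using i N0 by (auto simp: b_def mod_simps)
      note A = T[unfolded local_ok_def, rule_format, OF t(1), THEN conjunct2, THEN conjunct2, THEN conjunct2, rule_format, OF _ t(2)]
      note B = expected_ok[OF u, unfolded local_ok_def, rule_format, OF t(1), THEN conjunct2, THEN conjunct2, THEN conjunct2, rule_format, OF _ t(2)]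
      obtain q' as where tr: "trans M (tst (expected u t 0)) (trd (expected u t 0)) = (q', as)" by fastforce
      have trk: "trans M (tst (expected u t k)) (trd (expected u t k)) = (q', as)" if "k < N" for k
        using row_constant[OF expected_ok[OF u] t(1) that] tr by (simp add: horiz_def)
      \<comment> \<open>Depending on the move of head \<open>j\<close>, its mark in column
        \<open>i\<close> comes from the right neighbour, from the same column or from the left
        neighbour.\<close>
      have "thd (T (Suc t) i) ! j = thd (expected u (Suc t) i) ! j" if j: "j < ntapes M" for j
      proof (cases "snd (as ! j)")
        case Go_Left
        then show ?thesis
          using A[OF i] B[OF i] eq[OF b(3)] trk[OF b(3)] j by (simp add: head_move_def)
      next
        case Stay
        then show ?thesis
          using A[OF i] B[OF i] eq[OF i] trk[OF i] j by (simp add: head_move_def)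
      next
        case Go_Right
        then show ?thesis
          using A[OF b(1)] B[OF b(1)] eq[OF b(1)] trk[OF b(1)] j b(2) by (simp add: head_move_def)
      qed
      then show ?case
        using A[OF i] B[OF i] eq[OF i] trk[OF i] by (simp add: vert_def)
    qed
  qed
  with u show ?thesis by blast
qed

theorem tableau_iff:
  "(\<exists>T. local_ok M N T \<and> (\<forall>i<N. initial_ok x r (ntapes M) i (T 0 i)) \<and> (\<forall>i<N. tst (T (N - 1) i) = nstates M)) \<longleftrightarrow>
   (\<exists>u. length u \<le> r \<and> accepting M (run M [x, u] p))"
proof -
  \<comment> \<open>The last row shows a time of at least \<open>p\<close>, when the machine has
    already halted.\<close>
  have e: "tst (expected u (N - 1) i) = nstates M \<longleftrightarrow> accepting M (run M [x, u] p)" if "length u \<le> r" for u i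
    using run_halted_mono[OF halts[OF that], of "N - 1"] N
    by (auto simp: expected_def accepting_def split: prod.splits)
  have N0: "0 < N" "N - 1 < N" using N by auto
  show ?thesis
  proof
    assume "\<exists>T. local_ok M N T \<and> (\<forall>i<N. initial_ok x r (ntapes M) i (T 0 i)) \<and> (\<forall>i<N. tst (T (N - 1) i) = nstates M)"
    then obtain T where T: "local_ok M N T" "\<forall>i<N. initial_ok x r (ntapes M) i (T 0 i)" "\<forall>i<N. tst (T (N - 1) i) = nstates M"
      by blast
    from tableau_unique[OF T(1)] T(2) obtain u
      where u: "length u \<le> r" "\<forall>t<N. \<forall>i<N. T t i = expected u t i" by blast
    then have "tst (expected u (N - 1) 0) = nstates M" using T(3) N0 by simp
    with e[OF u(1)] u(1) show "\<exists>u. length u \<le> r \<and> accepting M (run M [x, u] p)" by blast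
  next
    assume "\<exists>u. length u \<le> r \<and> accepting M (run M [x, u] p)"
    then obtain u where u: "length u \<le> r" "accepting M (run M [x, u] p)" by blast
    show "\<exists>T. local_ok M N T \<and> (\<forall>i<N. initial_ok x r (ntapes M) i (T 0 i)) \<and> (\<forall>i<N. tst (T (N - 1) i) = nstates M)"
    proof (intro exI[of _ "expected u"] conjI allI impI)
      show "local_ok M N (expected u)" by (rule expected_ok[OF u(1)])
      show "initial_ok x r (ntapes M) i (expected u 0 i)" if "i < N" for i by (rule expected_initial[OF u(1) that])
      show "tst (expected u (N - 1) i) = nstates M" for i using e[OF u(1)] u(2) by simp
    qed
  qed
qed

end


section \<open>Tableaux as local constraints\<close>

fun add_step :: "bool \<times> bool \<Rightarrow> bool \<times> bool \<Rightarrow> bool \<times> bool" where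
  "add_step (ok, c) (a, b) = (ok \<and> b = (a \<noteq> c), a \<and> c)"

fun num :: "bool list \<Rightarrow> nat" where
  "num [] = 0"
| "num (b # bs) = of_bool b + 2 * num bs"

lemma num_less: "num bs < 2 ^ length bs"
  by (induction bs) auto

text \<open>This is ripple-carry addition, least significant bit first. The carry-in
  \<open>False\<close> tests for equality and \<open>True\<close> for the successor modulo
  \<open>2 ^ length ps\<close>; the carry-out tells whether the successor wraps around.\<close>

lemma foldl_add_step:
  "foldl add_step (ok, c) ps =
     (ok \<and> num (map snd ps) = (num (map fst ps) + of_bool c) mod 2 ^ length ps,
      2 ^ length ps \<le> num (map fst ps) + of_bool c)"
proof (induction ps arbitrary: ok c)
  case Nil
  then show ?case by (cases c) auto
next
  case (Cons p ps)
  obtain a b where p: "p = (a, b)" by fastforce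
  have *: "num (map fst (p # ps)) + of_bool c = of_bool (a \<noteq> c) + 2 * (num (map fst ps) + of_bool (a \<and> c))"
    by (cases a; cases c) (simp_all add: p)
  have md: "(of_bool e + 2 * m) mod (2 * k) = of_bool e + 2 * (m mod k)" for e m and k :: nat
    by (subst mod_mult2_eq) (cases e; simp)
  have le: "2 * k \<le> of_bool e + 2 * m \<longleftrightarrow> k \<le> m" for e and m k :: nat
    by (cases e) auto
  have eq: "of_bool b + 2 * m = of_bool e + 2 * n \<longleftrightarrow> b = e \<and> m = n" for e and m n :: nat
    by (cases b; cases e) (simp_all, presburger+)
  show ?case
    unfolding * by (simp only: p foldl.simps add_step.simps Cons.IH list.map snd_conv num.simps
      length_Cons power_Suc md le eq prod.inject) blast
qed

text \<open>A finite automaton that reads the least significant digits first decides for two cells whether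
  their rows and columns are equal or consecutive; the second components are the carries.\<close>

type_synonym pair_class = "(bool \<times> bool) \<times> (bool \<times> bool) \<times> (bool \<times> bool) \<times> (bool \<times> bool) \<times> (bool \<times> bool)"

fun class_step :: "pair_class \<Rightarrow> nat \<Rightarrow> pair_class" where
  "class_step (p, q, r, s, u) d =
     (let i = odd d; t = odd (d div 2); i' = odd (d div 4); t' = odd (d div 8) in
      (add_step p (t, t'), add_step q (t, t'), add_step r (i, i'), add_step s (i, i'), add_step u (i', i)))"

text \<open>The components test for the same row, the next row, the same column, the next column
  and, with the roles of the cells exchanged, the previous column.\<close>

definition class_start :: pair_class where
  "class_start = ((True, False), (True, True), (True, False), (True, True), (True, True))"

definition pair_class :: "nat list \<Rightarrow> pair_class" where
  "pair_class ds = foldl class_step class_start ds"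

definition row :: "nat list \<Rightarrow> nat" where
  "row w = num (map (\<lambda>d. odd (d div 2)) w)"

definition col :: "nat list \<Rightarrow> nat" where
  "col w = num (map odd w)"

lemma row_less: "w \<in> words B L \<Longrightarrow> row w < 2 ^ L" and col_less: "w \<in> words B L \<Longrightarrow> col w < 2 ^ L"
  using num_less[of "map (\<lambda>d. odd (d div 2)) w"] num_less[of "map odd w"] by (auto simp: row_def col_def words_def)

lemma foldl_class_step:
  "foldl class_step (p, q, r, s, u) ds =
     (foldl add_step p (map (\<lambda>d. (odd (d div 2), odd (d div 8))) ds),
      foldl add_step q (map (\<lambda>d. (odd (d div 2), odd (d div 8))) ds),
      foldl add_step r (map (\<lambda>d. (odd d, odd (d div 4))) ds),
      foldl add_step s (map (\<lambda>d. (odd d, odd (d div 4))) ds),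
      foldl add_step u (map (\<lambda>d. (odd (d div 4), odd d)) ds))"
  by (induction ds arbitrary: p q r s u) (simp_all add: Let_def)

lemma cell_num:
  "row (cell False ds) = num (map (\<lambda>d. odd (d div 2)) ds)"
  "col (cell False ds) = num (map odd ds)"
  "row (cell True ds) = num (map (\<lambda>d. odd (d div 8)) ds)"
  "col (cell True ds) = num (map (\<lambda>d. odd (d div 4)) ds)"
proof -
  have *: "odd (d mod 4 div 2) \<longleftrightarrow> odd (d div 2)" "odd (d mod 4) \<longleftrightarrow> odd d" "d div 4 div 2 = d div 8" for d :: nat
    by presburger+
  show "row (cell False ds) = num (map (\<lambda>d. odd (d div 2)) ds)"
    "col (cell False ds) = num (map odd ds)"
    "row (cell True ds) = num (map (\<lambda>d. odd (d div 8)) ds)"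
    "col (cell True ds) = num (map (\<lambda>d. odd (d div 4)) ds)"
    by (simp_all add: row_def col_def cell_def o_def *)
qed

lemma pair_class_eq:
  assumes ds: "ds \<in> words 16 L"
  defines "N \<equiv> 2 ^ L" and "t \<equiv> row (cell False ds)" and "i \<equiv> col (cell False ds)"
    and "t' \<equiv> row (cell True ds)" and "i' \<equiv> col (cell True ds)"
  shows "pair_class ds = ((t' = t, False), (t' = (t + 1) mod N, N \<le> t + 1), (i' = i, False),
     (i' = (i + 1) mod N, N \<le> i + 1), (i = (i' + 1) mod N, N \<le> i' + 1))"
proof -
  have len: "length ds = L" using ds by (simp add: words_def)
  have "t < N" "i < N" using row_less[OF cell_words[OF ds]] col_less[OF cell_words[OF ds]] by (auto simp: t_def i_def N_def)
  then have "t mod N = t" "i mod N = i" "\<not> N \<le> t" "\<not> N \<le> i" by auto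
  then show ?thesis
    unfolding pair_class_def class_start_def foldl_class_step foldl_add_step
    by (simp add: o_def len N_def[symmetric] cell_num t_def t'_def i_def i'_def)
qed

lemma word_exists: "t < 2 ^ L \<Longrightarrow> i < 2 ^ L \<Longrightarrow> \<exists>w \<in> words 4 L. row w = t \<and> col w = i"
proof (induction L arbitrary: t i)
  case 0
  then show ?case by (simp add: row_def col_def)
next
  case (Suc L)
  then have "t div 2 < 2 ^ L" "i div 2 < 2 ^ L" by auto
  from Suc.IH[OF this] obtain w where w: "w \<in> words 4 L" "row w = t div 2" "col w = i div 2" by blast
  have *: "i mod 2 + 2 * (t mod 2) < 4" "odd (i mod 2 + 2 * (t mod 2)) \<longleftrightarrow> odd i"
    "odd ((i mod 2 + 2 * (t mod 2)) div 2) \<longleftrightarrow> odd t" by presburger+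
  have "of_bool (odd n) + 2 * (n div 2) = n" for n :: nat by (cases "odd n") auto
  with w * show ?case
    by (intro bexI[of _ "(i mod 2 + 2 * (t mod 2)) # w"]) (auto simp: words_Suc row_def col_def)
qed

lemma word_unique: "w \<in> words 4 L \<Longrightarrow> w' \<in> words 4 L \<Longrightarrow> row w = row w' \<Longrightarrow> col w = col w' \<Longrightarrow> w = w'"
proof (induction L arbitrary: w w')
  case (Suc L)
  then obtain d v d' v' where *: "w = d # v" "d < 4" "v \<in> words 4 L" "w' = d' # v'" "d' < 4" "v' \<in> words 4 L"
    by (auto simp: words_Suc)
  have eq: "of_bool b + 2 * m = of_bool e + 2 * n \<longleftrightarrow> b = e \<and> m = n" for b e and m n :: nat
    by (cases b; cases e) (simp_all, presburger+)
  from Suc.prems * have "odd (d div 2) = odd (d' div 2)" "odd d = odd d'" "row v = row v'" "col v = col v'"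
    by (simp_all add: row_def col_def eq)
  moreover from this *(2,5) have "d = d'" by presburger
  ultimately show ?case using * Suc.IH[of v v'] by simp
qed simp

text \<open>A binary digit is a digit of a cell whose row bit is zero, so a binary counter addresses
  the cells of the initial row.\<close>

lemma digits2_word: 
  assumes "i < 2 ^ L"
  shows "digits 2 L i \<in> words 4 L" "row (digits 2 L i) = 0" "col (digits 2 L i) = i"
proof -
  have "digits 2 L i \<in> words 2 L" by (rule digits_words) simp
  then show "digits 2 L i \<in> words 4 L" by (force simp: words_def)
  show "row (digits 2 L i) = 0" for i
    by (induction L arbitrary: i) (simp_all add: row_def)
  show "col (digits 2 L i) = i" using assms
  proof (induction L arbitrary: i)
    case (Suc L)
    then have "i div 2 < 2 ^ L" by auto
    moreover have "of_bool (odd (i mod 2)) + 2 * (i div 2) = i" by (cases "odd i") auto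
    ultimately show ?case using Suc.IH[of "i div 2"] by (simp add: col_def)
  qed (simp add: col_def)
qed

text \<open>In the last clause the row index overflows: the first cell is in the last row.\<close>

definition conflict :: "tm \<Rightarrow> pair_class \<Rightarrow> tile \<Rightarrow> tile \<Rightarrow> bool" where
  "conflict M z s s' \<longleftrightarrow> (case z of ((t0, _), (t1, tw), (i0, _), (i1, iw), (im, _)) \<Rightarrow>
     (t0 \<and> i0 \<and> s \<noteq> s') \<or> (t0 \<and> i1 \<and> \<not> horiz s s') \<or> (t0 \<and> (i1 \<and> \<not> iw) \<and> \<not> blank_mono s s') \<or>
     ((t1 \<and> \<not> tw) \<and> i0 \<and> \<not> (vert M s s' \<and> head_move M Stay s s')) \<or>
     ((t1 \<and> \<not> tw) \<and> i1 \<and> \<not> head_move M Go_Right s s') \<or>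
     ((t1 \<and> \<not> tw) \<and> im \<and> \<not> head_move M Go_Left s s') \<or>
     ((t1 \<and> tw) \<and> i0 \<and> tst s \<noteq> nstates M))"

definition same_cell :: "pair_class \<Rightarrow> bool" where
  "same_cell z \<longleftrightarrow> (case z of ((t0, _), _, (i0, _), _) \<Rightarrow> t0 \<and> i0)"

lemma same_cell_iff: "ds \<in> words 16 L \<Longrightarrow> same_cell (pair_class ds) \<longleftrightarrow> cell False ds = cell True ds"
  using word_unique[OF cell_words cell_words, of ds L ds False True]
  by (auto simp: same_cell_def pair_class_eq)

lemma conflict_iff:
  assumes ds: "ds \<in> words 16 L"
  defines "N \<equiv> 2 ^ L" and "t \<equiv> row (cell False ds)" and "i \<equiv> col (cell False ds)"
    and "t' \<equiv> row (cell True ds)" and "i' \<equiv> col (cell True ds)"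
  shows "\<not> conflict M (pair_class ds) s s' \<longleftrightarrow>
     (t' = t \<and> i' = i \<longrightarrow> s = s') \<and> (t' = t \<and> i' = (i + 1) mod N \<longrightarrow> horiz s s') \<and>
     (t' = t \<and> i' = i + 1 \<longrightarrow> blank_mono s s') \<and>
     (t' = t + 1 \<and> i' = i \<longrightarrow> vert M s s' \<and> head_move M Stay s s') \<and>
     (t' = t + 1 \<and> i' = (i + 1) mod N \<longrightarrow> head_move M Go_Right s s') \<and>
     (t' = t + 1 \<and> i = (i' + 1) mod N \<longrightarrow> head_move M Go_Left s s') \<and>
     (t + 1 = N \<and> t' = 0 \<and> i' = i \<longrightarrow> tst s = nstates M)"
proof -
  have lt: "t < N" "i < N" "t' < N" "i' < N"
    using row_less[OF cell_words[OF ds]] col_less[OF cell_words[OF ds]] by (auto simp: t_def i_def t'_def i'_def N_def)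
  have *: "k' = (k + 1) mod N \<and> \<not> N \<le> k + 1 \<longleftrightarrow> k' = k + 1" "k' = (k + 1) mod N \<and> N \<le> k + 1 \<longleftrightarrow> k + 1 = N \<and> k' = 0"
    if "k < N" "k' < N" for k k'
    using that by (cases "k + 1 = N"; auto)+
  note T = *[OF lt(1,3)] and I = *[OF lt(2,4)]
  show ?thesis
    unfolding conflict_def pair_class_eq[OF ds] prod.case
    unfolding N_def[symmetric] t_def[symmetric] i_def[symmetric] t'_def[symmetric] i'_def[symmetric]
    unfolding T I by blast
qed

section \<open>Conditions on the initial row\<close>

definition bad_input :: "nat \<Rightarrow> tile \<Rightarrow> bool" where
  "bad_input a s \<longleftrightarrow> tsy s ! 0 \<noteq> a"

definition bad_cert :: "bool \<Rightarrow> tile \<Rightarrow> bool" where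
  "bad_cert inside s \<longleftrightarrow> (if inside then 2 < tsy s ! 1 else tsy s ! 1 \<noteq> 0)"

definition bad_start :: "nat \<Rightarrow> bool \<Rightarrow> tile \<Rightarrow> bool" where
  "bad_start k first s \<longleftrightarrow> \<not> (tflag s \<and> tst s = 0 \<and> (\<forall>j<k. thd s ! j \<longleftrightarrow> first) \<and> (\<forall>j<k. 2 \<le> j \<longrightarrow> tsy s ! j = 0))"

text \<open>The condition is split by what a single pass over the columns knows: the input symbol,
  whether the cell may belong to the certificate, and whether the column is the first. Each has
  finitely many values, so fixed programs write the forbidding people.\<close>

lemma initial_ok_iff:
  "initial_ok x r k i s \<longleftrightarrow> \<not> bad_input (contents_of x (int i)) s \<and> \<not> bad_cert (i < r) s \<and> \<not> bad_start k (i = 0) s"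
  by (auto simp: initial_ok_def bad_input_def bad_cert_def bad_start_def)

definition bads :: "tile list \<Rightarrow> (tile \<Rightarrow> bool) \<Rightarrow> nat list" where
  "bads tls Q = filter (\<lambda>a. Q (tls ! a)) [0..<length tls]"

definition row_forbs :: "tile list \<Rightarrow> nat \<Rightarrow> (nat \<Rightarrow> tile \<Rightarrow> bool) \<Rightarrow> (nat list \<times> nat) list" where
  "row_forbs tls L Q = concat (map (\<lambda>i. map (Pair (digits 2 L i)) (bads tls (Q i))) [0..<2 ^ L])"

definition forbs :: "tm \<Rightarrow> tile list \<Rightarrow> bool list \<Rightarrow> nat \<Rightarrow> nat \<Rightarrow> (nat list \<times> nat) list" where
  "forbs M tls x r L = row_forbs tls L (\<lambda>i. bad_input (contents_of x (int i))) @
     row_forbs tls L (\<lambda>i. bad_cert (i < r)) @ row_forbs tls L (\<lambda>i. bad_start (ntapes M) (i = 0))"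

lemma set_row_forbs: "set (row_forbs tls L Q) = {(digits 2 L i, a) | i a. i < 2 ^ L \<and> a < length tls \<and> Q i (tls ! a)}"
  by (auto simp: row_forbs_def bads_def)

lemma set_forbs:
  "set (forbs M tls x r L) =
     {(digits 2 L i, a) | i a. i < 2 ^ L \<and> a < length tls \<and> \<not> initial_ok x r (ntapes M) i (tls ! a)}"
  unfolding forbs_def set_append set_row_forbs initial_ok_iff by blast

locale tiling = tableau M x p r N for M x p r N +
  fixes tls :: "tile list" and L :: nat
  assumes N_eq: "N = 2 ^ L" and tls: "distinct tls" "set tls = tiles M"
begin

definition consistent :: "(nat list \<Rightarrow> nat) \<Rightarrow> bool" where
  "consistent T \<longleftrightarrow> (\<forall>w \<in> words 4 L. T w < length tls) \<and>
     (\<forall>ds \<in> words 16 L. \<not> conflict M (pair_class ds) (tls ! T (cell False ds)) (tls ! T (cell True ds))) \<and>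
     (\<forall>(ds, s) \<in> set (forbs M tls x r L). T ds \<noteq> s)"

text \<open>Words correspond one to one to coordinates, and every condition on a tableau beyond
  single tiles of the initial row compares two cells whose class says which condition
  applies.\<close>

theorem consistent_iff: "(\<exists>T. consistent T) \<longleftrightarrow> (\<exists>u. length u \<le> r \<and> accepting M (run M [x, u] p))"
  unfolding tableau_iff[symmetric]
proof
  assume "\<exists>T. consistent T"
  then obtain T where T: "consistent T" ..
  define pt where "pt = (\<lambda>t i. SOME w. w \<in> words 4 L \<and> row w = t \<and> col w = i)"
  have pt: "pt t i \<in> words 4 L \<and> row (pt t i) = t \<and> col (pt t i) = i" if "t < N" "i < N" for t i
    unfolding pt_def by (rule someI_ex) (use word_exists that N_eq in blast)
  define U where "U = (\<lambda>t i. tls ! T (pt t i))"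
  have no: "\<not> conflict M (pair_class ds) (U t i) (U t' i')"
    if "ds \<in> words 16 L" "cell False ds = pt t i" "cell True ds = pt t' i'" for ds t i t' i'
    using T that by (auto simp: consistent_def U_def)
  have C: "(t' = t \<and> i' = i \<longrightarrow> U t i = U t' i') \<and> (t' = t \<and> i' = (i + 1) mod N \<longrightarrow> horiz (U t i) (U t' i')) \<and>
     (t' = t \<and> i' = i + 1 \<longrightarrow> blank_mono (U t i) (U t' i')) \<and>
     (t' = t + 1 \<and> i' = i \<longrightarrow> vert M (U t i) (U t' i') \<and> head_move M Stay (U t i) (U t' i')) \<and>
     (t' = t + 1 \<and> i' = (i + 1) mod N \<longrightarrow> head_move M Go_Right (U t i) (U t' i')) \<and>
     (t' = t + 1 \<and> i = (i' + 1) mod N \<longrightarrow> head_move M Go_Left (U t i) (U t' i')) \<and>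
     (t + 1 = N \<and> t' = 0 \<and> i' = i \<longrightarrow> tst (U t i) = nstates M)"
    if lt: "t < N" "i < N" "t' < N" "i' < N" for t i t' i'
  proof -
    obtain ds where ds: "ds \<in> words 16 L" "cell False ds = pt t i" "cell True ds = pt t' i'"
      using pair_word pt lt by blast
    show ?thesis
      using no[OF ds] unfolding conflict_iff[OF ds(1)] ds(2,3) N_eq[symmetric]
      using pt[OF lt(1,2)] pt[OF lt(3,4)] by simp
  qed
  have N0: "0 < N" using N by simp
  show "\<exists>T. local_ok M N T \<and> (\<forall>i<N. initial_ok x r (ntapes M) i (T 0 i)) \<and> (\<forall>i<N. tst (T (N - 1) i) = nstates M)"
  proof (intro exI[of _ U] conjI allI impI)
    show "local_ok M N U"
      unfolding local_ok_def
    proof (intro allI impI conjI)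
      fix t i assume ti: "t < N" "i < N"
      have s: "(i + 1) mod N < N" using N0 by simp
      show "U t i \<in> tiles M" using T pt[OF ti] tls(2) by (auto simp: U_def consistent_def)
      show "horiz (U t i) (U t ((i + 1) mod N))" using C[OF ti ti(1) s] by blast
      show "blank_mono (U t i) (U t (i + 1))" if "i + 1 < N" using C[OF ti ti(1) that] by blast
      show "vert M (U t i) (U (t + 1) i)" "head_move M Stay (U t i) (U (t + 1) i)" if "t + 1 < N"
        using C[OF ti that ti(2)] by blast+
      show "head_move M Go_Right (U t i) (U (t + 1) ((i + 1) mod N))" if "t + 1 < N" using C[OF ti that s] by blast
      show "head_move M Go_Left (U t ((i + 1) mod N)) (U (t + 1) i)" if "t + 1 < N" using C[OF ti(1) s that ti(2)] by blast
    qed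
    show "initial_ok x r (ntapes M) i (U 0 i)" if i: "i < N" for i
    proof (rule ccontr)
      assume "\<not> initial_ok x r (ntapes M) i (U 0 i)"
      moreover have "pt 0 i = digits 2 L i"
        using word_unique[of "pt 0 i" L "digits 2 L i"] pt[OF N0 i] digits2_word[of i L] i N_eq by simp
      moreover have "T (pt 0 i) < length tls" using T pt[OF N0 i] by (simp add: consistent_def)
      ultimately have "(digits 2 L i, T (digits 2 L i)) \<in> set (forbs M tls x r L)"
        using i N_eq by (auto simp: set_forbs U_def)
      with T show False by (auto simp: consistent_def)
    qed
    \<comment> \<open>Acceptance is imposed on the pair of the last row and row 0 in the same
      column, where the row index overflows.\<close>
    show "tst (U (N - 1) i) = nstates M" if i: "i < N" for i
      using C[of "N - 1" i 0 i] N0 i by simp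
  qed
next
  assume "\<exists>T. local_ok M N T \<and> (\<forall>i<N. initial_ok x r (ntapes M) i (T 0 i)) \<and> (\<forall>i<N. tst (T (N - 1) i) = nstates M)"
  then obtain U where U: "local_ok M N U" "\<And>i. i < N \<Longrightarrow> initial_ok x r (ntapes M) i (U 0 i)"
      "\<And>i. i < N \<Longrightarrow> tst (U (N - 1) i) = nstates M" by blast
  have N0: "0 < N" using N by simp
  have "\<exists>a<length tls. tls ! a = U (row w) (col w)" if "w \<in> words 4 L" for w
  proof -
    have "U (row w) (col w) \<in> set tls"
      using U(1) row_less[OF that] col_less[OF that] N_eq tls(2) by (simp add: local_ok_def)
    then show ?thesis by (simp add: in_set_conv_nth)
  qed
  then obtain T where T: "\<And>w. w \<in> words 4 L \<Longrightarrow> T w < length tls \<and> tls ! T w = U (row w) (col w)" by metis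
  have "consistent T"
    unfolding consistent_def
  proof (intro conjI ballI)
    fix ds assume ds: "ds \<in> words 16 L"
    define t i t' i' where "t = row (cell False ds)" "i = col (cell False ds)" "t' = row (cell True ds)" "i' = col (cell True ds)"
    note ti_def = this
    have lt: "t < N" "i < N" "t' < N" "i' < N"
      using row_less[OF cell_words[OF ds]] col_less[OF cell_words[OF ds]] by (auto simp: ti_def N_eq)
    have e: "tls ! T (cell False ds) = U t i" "tls ! T (cell True ds) = U t' i'" using T cell_words[OF ds] by (auto simp: ti_def)
    note A = U(1)[unfolded local_ok_def, rule_format]
    show "\<not> conflict M (pair_class ds) (tls ! T (cell False ds)) (tls ! T (cell True ds))"
      unfolding conflict_iff[OF ds] e
      unfolding ti_def[symmetric] N_eq[symmetric]
    proof (intro conjI impI; elim conjE)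
      show "blank_mono (U t i) (U t' i')" if "t' = t" "i' = i + 1" using A[OF lt(1,2)] lt that by simp
      show "vert M (U t i) (U t' i')" "head_move M Stay (U t i) (U t' i')" if "t' = t + 1" "i' = i" using A[OF lt(1,2)] lt that by auto
      show "head_move M Go_Right (U t i) (U t' i')" if "t' = t + 1" "i' = (i + 1) mod N" using A[OF lt(1,2)] lt that by auto
      show "head_move M Go_Left (U t i) (U t' i')" if "t' = t + 1" "i = (i' + 1) mod N" using A[OF lt(1,4)] lt that by auto
      show "tst (U t i) = nstates M" if "t + 1 = N" using U(3)[OF lt(2)] that by auto
    qed (use A[OF lt(1,2)] in auto)
  next
    fix q assume "q \<in> set (forbs M tls x r L)"
    then obtain i a where q: "q = (digits 2 L i, a)" "i < N" "\<not> initial_ok x r (ntapes M) i (tls ! a)"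
      by (auto simp: set_forbs N_eq)
    have d: "digits 2 L i \<in> words 4 L" "row (digits 2 L i) = 0" "col (digits 2 L i) = i" using digits2_word[of i L] q(2) N_eq by auto
    then have "tls ! T (digits 2 L i) = U 0 i" using T[OF d(1)] by simp
    then show "case q of (ds, s) \<Rightarrow> T ds \<noteq> s" using q U(2)[OF q(2)] by auto
  qed (use T in blast)
  then show "\<exists>T. consistent T" by (rule exI[of _ T])
qed

end


section \<open>While programs on tapes\<close>

type_synonym store = "nat \<Rightarrow> tape"

datatype com =
    Skip
  | Act nat "(nat \<Rightarrow> nat) \<Rightarrow> nat \<times> dir"
  | Seq com com  (infixr ";;" 60)
  | Cond "(nat \<Rightarrow> nat) \<Rightarrow> bool" com com
  | While "(nat \<Rightarrow> nat) \<Rightarrow> bool" com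

section \<open>Small-step semantics and running times\<close>

fun next_com :: "com \<Rightarrow> (nat \<Rightarrow> nat) \<Rightarrow> com" where
  "next_com Skip r = Skip"
| "next_com (Act k g) r = Skip"
| "next_com (a ;; b) r = (if a = Skip then b else next_com a r ;; b)"
| "next_com (Cond c a b) r = (if c r then a else b)"
| "next_com (While c a) r = (if c r then a ;; While c a else Skip)"

fun next_act :: "com \<Rightarrow> (nat \<Rightarrow> nat) \<Rightarrow> (nat \<times> nat \<times> dir) option" where
  "next_act (Act k g) r = Some (k, g r)"
| "next_act (a ;; b) r = next_act a r"
| "next_act _ r = None"

text \<open>A finite set closed under steps: a loop body is only ever followed by its loop.\<close>

fun residuals :: "com \<Rightarrow> com set" where
  "residuals Skip = {Skip}"
| "residuals (Act k g) = {Act k g, Skip}"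
| "residuals (a ;; b) = (\<lambda>a'. a' ;; b) ` residuals a \<union> residuals b"
| "residuals (Cond c a b) = insert (Cond c a b) (residuals a \<union> residuals b)"
| "residuals (While c a) = {While c a, Skip} \<union> (\<lambda>a'. a' ;; While c a) ` residuals a"

text \<open>A machine with \<open>K\<close> tapes can only branch on the symbols of these
  tapes.\<close>

definition local :: "nat \<Rightarrow> ((nat \<Rightarrow> nat) \<Rightarrow> 'a) \<Rightarrow> bool" where
  "local K f \<longleftrightarrow> (\<forall>r r'. (\<forall>i<K. r i = r' i) \<longrightarrow> f r = f r')"

definition writes_below :: "nat \<Rightarrow> nat \<Rightarrow> ((nat \<Rightarrow> nat) \<Rightarrow> nat \<times> dir) \<Rightarrow> bool" where
  "writes_below K m g \<longleftrightarrow> (\<forall>r. (\<forall>i<K. r i < m) \<longrightarrow> fst (g r) < m)"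

fun wf_com :: "nat \<Rightarrow> nat \<Rightarrow> com \<Rightarrow> bool" where
  "wf_com K m Skip = True"
| "wf_com K m (Act k g) = (k < K \<and> local K g \<and> writes_below K m g)"
| "wf_com K m (a ;; b) = (wf_com K m a \<and> wf_com K m b)"
| "wf_com K m (Cond c a b) = (local K c \<and> wf_com K m a \<and> wf_com K m b)"
| "wf_com K m (While c a) = (local K c \<and> wf_com K m a)"

definition reads :: "store \<Rightarrow> nat \<Rightarrow> nat" where
  "reads s = (\<lambda>i. read (s i))"

definition perform :: "(nat \<times> nat \<times> dir) option \<Rightarrow> store \<Rightarrow> store" where
  "perform x s = (case x of None \<Rightarrow> s | Some (k, a) \<Rightarrow> s(k := act a (s k)))"

definition com_step :: "com \<times> store \<Rightarrow> com \<times> store" where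
  "com_step = (\<lambda>(c, s). (next_com c (reads s), perform (next_act c (reads s)) s))"

text \<open>An upper bound on the time is enough, because \<open>Skip\<close> steps to
  itself.\<close>

definition runs :: "com \<Rightarrow> store \<Rightarrow> store \<Rightarrow> nat \<Rightarrow> bool" where
  "runs c s s' b \<longleftrightarrow> (\<exists>t\<le>b. (com_step ^^ t) (c, s) = (Skip, s'))"

lemma finite_residuals: "finite (residuals c)"
  by (induction c) auto

lemma self_residuals: "c \<in> residuals c"
  by (induction c) auto

lemma Skip_residuals: "Skip \<in> residuals c"
  by (induction c) auto

lemma next_residuals: "d \<in> residuals c \<Longrightarrow> next_com d r \<in> residuals c"
proof (induction c arbitrary: d)
  case (Seq a b)
  then consider a' where "a' \<in> residuals a" "d = a' ;; b" | "d \<in> residuals b" by auto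
  then show ?case
  proof cases
    case 1
    with Seq.IH(1)[of a'] self_residuals[of b] show ?thesis by simp
  next
    case 2
    with Seq.IH(2)[of d] show ?thesis by simp
  qed
next
  case (Cond p a b)
  then consider "d = Cond p a b" | "d \<in> residuals a" | "d \<in> residuals b" by auto
  then show ?case
  proof cases
    case 1
    then show ?thesis using self_residuals[of a] self_residuals[of b] by simp
  next
    case 2
    with Cond.IH(1)[of d] show ?thesis by simp
  next
    case 3
    with Cond.IH(2)[of d] show ?thesis by simp
  qed
next
  case (While p a)
  then consider "d = While p a" | "d = Skip" | a' where "a' \<in> residuals a" "d = a' ;; While p a" by auto
  then show ?case
  proof cases
    case 3
    with While.IH[of a'] show ?thesis by simp
  qed (use self_residuals[of a] in simp_all)
qed auto

lemma wf_residuals: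
  assumes "wf_com K m c"
  shows "d \<in> residuals c \<Longrightarrow> wf_com K m d"
  using assms
proof (induction c arbitrary: d)
  case (Seq a b)
  then have "(\<exists>a' \<in> residuals a. d = a' ;; b) \<or> d \<in> residuals b" "wf_com K m a" "wf_com K m b" by auto
  with Seq.IH show ?case by (metis wf_com.simps(3))
next
  case (Cond p a b)
  then have "d = Cond p a b \<or> d \<in> residuals a \<or> d \<in> residuals b" "wf_com K m a" "wf_com K m b" by auto
  with Cond.IH Cond.prems show ?case by blast
next
  case (While p a)
  then have "d = While p a \<or> d = Skip \<or> (\<exists>a' \<in> residuals a. d = a' ;; While p a)" "wf_com K m a" by auto
  with While.IH While.prems show ?case by (metis wf_com.simps(1,3))
qed auto

lemma localD: "local K f \<Longrightarrow> \<forall>i<K. r i = r' i \<Longrightarrow> f r = f r'"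
  unfolding local_def by blast

lemma next_com_cong:
  "wf_com K m c \<Longrightarrow> \<forall>i<K. r i = r' i \<Longrightarrow> next_com c r = next_com c r' \<and> next_act c r = next_act c r'"
  by (induction c) (simp_all add: localD[of K _ r r'])

lemma wf_next_act:
  "wf_com K m c \<Longrightarrow> next_act c r = Some (k, a) \<Longrightarrow> k < K \<and> ((\<forall>i<K. r i < m) \<longrightarrow> fst a < m)"
proof (induction c)
  case (Act j g)
  then have "j < K" "writes_below K m g" "k = j" "a = g r" by auto
  then show ?case unfolding writes_below_def by blast
next
  case (Seq a b)
  then show ?case unfolding wf_com.simps next_act.simps by blast
qed (simp_all only: next_act.simps option.distinct)

lemma runs_Skip: "runs Skip s s b"
  unfolding runs_def by (rule exI[of _ 0]) simp

lemma runs_weaken: "runs c s s' b \<Longrightarrow> b \<le> b' \<Longrightarrow> runs c s s' b'"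
  unfolding runs_def using le_trans by blast

lemma runs_step:
  assumes "runs (next_com c (reads s)) (perform (next_act c (reads s)) s) s' b"
  shows "runs c s s' (Suc b)"
proof -
  from assms obtain t where "t \<le> b"
    "(com_step ^^ t) (next_com c (reads s), perform (next_act c (reads s)) s) = (Skip, s')"
    unfolding runs_def by blast
  then have "(com_step ^^ Suc t) (c, s) = (Skip, s')"
    by (simp only: funpow_Suc_right o_apply) (simp add: com_step_def)
  then show ?thesis unfolding runs_def using \<open>t \<le> b\<close> by (intro exI[of _ "Suc t"]) simp
qed

lemma runs_Act: "b \<ge> 1 \<Longrightarrow> runs (Act k g) s (s(k := act (g (reads s)) (s k))) b"
  by (rule runs_weaken[OF runs_step[of _ _ _ 0]]) (simp_all add: perform_def runs_Skip)

text \<open>\<open>a\<close> may reach \<open>Skip\<close> before step \<open>t\<close>, and there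
  the steps of the first component end, hence \<open>t' \<le> t\<close>.\<close>

lemma steps_Seq:
  "(com_step ^^ t) (a, s) = (Skip, s') \<Longrightarrow> \<exists>t'\<le>t. (com_step ^^ t') (a ;; b, s) = (Skip ;; b, s')"
proof (induction t arbitrary: a s)
  case 0
  then show ?case by simp
next
  case (Suc t)
  show ?case
  proof (cases "a = Skip")
    case True
    have "(com_step ^^ j) (Skip, s) = (Skip, s)" for j
      by (induction j) (simp_all add: com_step_def perform_def)
    with Suc.prems True have "s = s'" by (metis Pair_inject)
    with True show ?thesis by (intro exI[of _ 0]) simp
  next
    case False
    from Suc.prems have "(com_step ^^ t) (next_com a (reads s), perform (next_act a (reads s)) s) = (Skip, s')"
      by (simp only: funpow_Suc_right o_apply) (simp add: com_step_def)
    from Suc.IH[OF this] obtain t' where "t' \<le> t"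
      "(com_step ^^ t') (next_com a (reads s) ;; b, perform (next_act a (reads s)) s) = (Skip ;; b, s')"
      by blast
    then show ?thesis using False
      by (intro exI[of _ "Suc t'"], simp only: funpow_Suc_right o_apply) (simp add: com_step_def)
  qed
qed

lemma runs_Seq:
  assumes "runs a s s1 b1" "runs b s1 s2 b2" "b1 + b2 + 1 \<le> n"
  shows "runs (a ;; b) s s2 n"
proof -
  from assms(1) obtain t1 where t1: "t1 \<le> b1" "(com_step ^^ t1) (a, s) = (Skip, s1)"
    unfolding runs_def by blast
  from steps_Seq[OF t1(2), of b] obtain t1' where t1': "t1' \<le> t1"
    "(com_step ^^ t1') (a ;; b, s) = (Skip ;; b, s1)" by blast
  from assms(2) obtain t2 where t2: "t2 \<le> b2" "(com_step ^^ t2) (b, s1) = (Skip, s2)"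
    unfolding runs_def by blast
  \<comment> \<open>This step accounts for the 1 in the time bound.\<close>
  have "com_step (Skip ;; b, s1) = (b, s1)" by (simp add: com_step_def perform_def)
  with t2 have "(com_step ^^ (Suc t2)) (Skip ;; b, s1) = (Skip, s2)"
    by (simp only: funpow_Suc_right o_apply)
  with t1' have "(com_step ^^ (Suc t2 + t1')) (a ;; b, s) = (Skip, s2)"
    by (simp only: funpow_add o_apply)
  then show ?thesis unfolding runs_def using t1(1) t1'(1) t2(1) assms(3)
    by (intro exI[of _ "Suc t2 + t1'"]) simp
qed

lemma runs_Cond:
  assumes "runs (if c (reads s) then a else b) s s' n" "Suc n \<le> n'"
  shows "runs (Cond c a b) s s' n'"
  using assms by - (rule runs_weaken[OF runs_step[of _ _ _ n]], (auto simp: perform_def))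

lemma runs_While_False:
  assumes "\<not> c (reads s)" "1 \<le> n"
  shows "runs (While c a) s s n"
  using assms by - (rule runs_weaken[OF runs_step[of _ _ _ 0]], (auto simp: perform_def runs_Skip))

lemma runs_While_True:
  assumes "c (reads s)" "runs a s s1 b1" "runs (While c a) s1 s2 b2" "b1 + b2 + 2 \<le> n"
  shows "runs (While c a) s s2 n"
proof -
  have "runs (a ;; While c a) s s2 (b1 + b2 + 1)"
    by (rule runs_Seq[OF assms(2,3)]) simp
  then show ?thesis using assms
    by - (rule runs_weaken[OF runs_step[of _ _ _ "b1 + b2 + 1"]], (auto simp: perform_def))
qed

text \<open>The family \<open>S\<close> serves as the loop invariant: one store per round fixes the
  final store and the number of rounds at once.\<close>

lemma runs_While:
  fixes S :: "nat \<Rightarrow> store"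
  assumes "\<And>i. i < N \<Longrightarrow> c (reads (S i))"
    and "\<And>i. i < N \<Longrightarrow> runs a (S i) (S (Suc i)) b"
    and "\<not> c (reads (S N))"
    and "N * (b + 2) + 1 \<le> n"
  shows "runs (While c a) (S 0) (S N) n"
proof -
  have "j \<le> N \<Longrightarrow> runs (While c a) (S (N - j)) (S N) (j * (b + 2) + 1)" for j
  proof (induction j)
    case 0
    then show ?case using assms(3) by (simp add: runs_While_False)
  next
    case (Suc j)
    then have *: "N - Suc j < N" "Suc (N - Suc j) = N - j" by auto
    have "runs a (S (N - Suc j)) (S (N - j)) b" using assms(2)[OF *(1)] unfolding *(2) .
    moreover have "runs (While c a) (S (N - j)) (S N) (j * (b + 2) + 1)" by (rule Suc.IH) (use Suc.prems in simp)
    ultimately show ?case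
      by (rule runs_While_True[where c = c, OF assms(1)[OF *(1)]]) simp
  qed
  from runs_weaken[OF this[of N], of n] show ?thesis using assms(4) by simp
qed


text \<open>The states of the machine are the finitely many residual programs.\<close>

definition com_tm :: "nat \<Rightarrow> nat \<Rightarrow> com list \<Rightarrow> tm" where
  "com_tm K m cs = \<lparr>ntapes = K, nstates = length cs - 1, nsymbols = m,
     delta = (\<lambda>q ss. let r = (\<lambda>i. if i < K then ss ! i else 0) in
       ((SOME q'. q' < length cs \<and> cs ! q' = next_com (cs ! q) r),
        map (\<lambda>i. case next_act (cs ! q) r of
                   Some (k, a) \<Rightarrow> if i = k then a else (ss ! i, Stay)
                 | None \<Rightarrow> (ss ! i, Stay)) [0..<K]))\<rparr>"

definition initial_store :: "bool list \<Rightarrow> store" where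
  "initial_store x = (\<lambda>i. (contents_of (if i = 0 then x else []), 0))"

theorem com_tm_correct:
  assumes wf: "wf_com K m c" and K: "2 \<le> K" and m: "3 \<le> m" and c: "c \<noteq> Skip"
  shows "\<exists>M. wf_tm M \<and> (\<forall>x s b t. runs c (initial_store x) s b \<longrightarrow> b \<le> t \<longrightarrow>
           halted M (run M [x] t) \<and> snd (run M [x] t) = map s [0..<K])"
proof -
  obtain ds where ds: "set ds = residuals c - {Skip} - {c}" "distinct ds"
    using finite_distinct_list[of "residuals c - {Skip} - {c}"] finite_residuals by auto
  \<comment> \<open>\<open>c\<close> comes first because state 0 is initial, and \<open>Skip\<close>
    last because its position is then the accepting halting state.\<close>
  define cs where "cs = c # ds @ [Skip]"
  define n where "n = Suc (length ds)"
  define M where "M = com_tm K m cs"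
  have set_cs: "set cs = residuals c"
    using self_residuals[of c] Skip_residuals[of c] unfolding cs_def by (simp add: ds(1)) blast
  have dist: "distinct cs" using ds c by (auto simp: cs_def)
  have len: "length cs = Suc n" by (simp add: cs_def n_def)
  have last: "cs ! n = Skip" by (simp add: cs_def n_def nth_append)
  have nst: "nstates M = n" "ntapes M = K" "nsymbols M = m" by (simp_all add: M_def com_tm_def len)
  have code: "\<exists>q'<length cs. cs ! q' = next_com (cs ! q) r" if "q < length cs" for q r
  proof -
    have "cs ! q \<in> set cs" using that by (rule nth_mem)
    then have "next_com (cs ! q) r \<in> set cs" unfolding set_cs by (rule next_residuals)
    then show ?thesis unfolding in_set_conv_nth .
  qed
  have wfM: "wf_tm M"
    unfolding wf_tm_def nst
  proof (intro conjI K m allI impI)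
    fix q ss assume q: "q < n" and ss: "length ss = K \<and> set ss \<subseteq> {..<m}"
    define r where "r = (\<lambda>i. if i < K then ss ! i else 0)"
    have r: "\<forall>i<K. r i < m" using ss by (auto simp: r_def subset_iff)
    have "(SOME q'. q' < length cs \<and> cs ! q' = next_com (cs ! q) r) < length cs"
      using someI_ex[OF code[of q r]] q len by simp
    moreover have "wf_com K m (cs ! q)" 
      using wf_residuals[OF wf] nth_mem[of q cs] q unfolding len set_cs by simp
    note wf_next_act[OF this, of r]
    then have "fst (case next_act (cs ! q) r of
                   Some (k, a) \<Rightarrow> if i = k then a else (ss ! i, Stay)
                 | None \<Rightarrow> (ss ! i, Stay)) < m" if "i < K" for i
      using r that by (auto simp: r_def split: option.splits)
    moreover have "delta M q ss = ((SOME q'. q' < length cs \<and> cs ! q' = next_com (cs ! q) r),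
        map (\<lambda>i. case next_act (cs ! q) r of
                   Some (k, a) \<Rightarrow> if i = k then a else (ss ! i, Stay)
                 | None \<Rightarrow> (ss ! i, Stay)) [0..<K])"
      by (simp add: M_def com_tm_def Let_def r_def)
    ultimately show "case delta M q ss of (q', as) \<Rightarrow>
           q' \<le> n + 1 \<and> length as = K \<and> fst ` set as \<subseteq> {..<m}"
      by (auto simp only: len prod.case length_map length_upt set_map set_upt image_iff subset_iff lessThan_iff atLeastLessThan_iff diff_zero)
  qed
  have step: "\<exists>q'<length cs. cs ! q' = next_com (cs ! q) (reads s) \<and>
      step M (q, map s [0..<K]) = (q', map (perform (next_act (cs ! q) (reads s)) s) [0..<K])"
    if "q < length cs" for q s
  proof (cases "q = n")
    case True
    then show ?thesis using last len by (intro exI[of _ n]) (simp add: nst perform_def step.simps)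
  next
    case False
    with that have q: "q < n" by (simp add: len)
    define ss where "ss = map read (map s [0..<K])"
    define r where "r = (\<lambda>i. if i < K then ss ! i else 0)"
    have wfq: "wf_com K m (cs ! q)" 
      using wf_residuals[OF wf] nth_mem[OF that] unfolding set_cs by simp
    have eq: "next_com (cs ! q) r = next_com (cs ! q) (reads s)" "next_act (cs ! q) r = next_act (cs ! q) (reads s)"
      using next_com_cong[OF wfq, of r "reads s"] by (auto simp: r_def ss_def reads_def)
    define q' where "q' = (SOME q'. q' < length cs \<and> cs ! q' = next_com (cs ! q) r)"
    have q': "q' < length cs" "cs ! q' = next_com (cs ! q) (reads s)"
      using someI_ex[OF code[OF that, of r]] unfolding q'_def eq by auto
    have "map2 act (map (\<lambda>i. case next_act (cs ! q) r of
                   Some (k, a) \<Rightarrow> if i = k then a else (ss ! i, Stay)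
                 | None \<Rightarrow> (ss ! i, Stay)) [0..<K]) (map s [0..<K])
         = map (perform (next_act (cs ! q) (reads s)) s) [0..<K]"
      unfolding eq by (rule nth_equalityI) (auto simp: perform_def ss_def split: option.splits)
    then have "step M (q, map s [0..<K]) = (q', map (perform (next_act (cs ! q) (reads s)) s) [0..<K])"
      using q unfolding step.simps nst ss_def[symmetric]
      by (simp add: M_def com_tm_def Let_def r_def[symmetric] q'_def)
    with q' show ?thesis by blast
  qed
  have steps: "\<exists>q'<length cs. cs ! q' = fst ((com_step ^^ t) (cs ! q, s)) \<and>
      (step M ^^ t) (q, map s [0..<K]) = (q', map (snd ((com_step ^^ t) (cs ! q, s))) [0..<K])"
    if "q < length cs" for q s t
  proof (induction t)
    case 0
    then show ?case using that by auto
  next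
    case (Suc t)
    then obtain q' where q': "q' < length cs" "cs ! q' = fst ((com_step ^^ t) (cs ! q, s))"
      "(step M ^^ t) (q, map s [0..<K]) = (q', map (snd ((com_step ^^ t) (cs ! q, s))) [0..<K])"
      by blast
    obtain d s' where ds': "(com_step ^^ t) (cs ! q, s) = (d, s')" by fastforce
    from step[OF q'(1), of s'] obtain q'' where q'': "q'' < length cs" "cs ! q'' = next_com (cs ! q') (reads s')"
      "step M (q', map s' [0..<K]) = (q'', map (perform (next_act (cs ! q') (reads s')) s') [0..<K])"
      by blast
    have "(com_step ^^ Suc t) (cs ! q, s) = (next_com d (reads s'), perform (next_act d (reads s')) s')"
      by (simp only: funpow.simps o_apply ds') (simp only: com_step_def prod.case)
    moreover have "(step M ^^ Suc t) (q, map s [0..<K]) = (q'', map (perform (next_act d (reads s')) s') [0..<K])"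
      using q' q'' by (simp only: funpow.simps o_apply ds' fst_conv snd_conv)
    ultimately show ?case
      using q' q'' by (intro exI[of _ q'']) (simp only: ds' fst_conv snd_conv simp_thms)
  qed
  show ?thesis
  proof (intro exI[of _ M] conjI wfM allI impI)
    fix x s b t assume rn: "runs c (initial_store x) s b" and "b \<le> t"
    have in0: "init M [x] = (0, map (initial_store x) [0..<K])"
      by (simp add: init_def nst initial_store_def)
    from rn obtain t0 where t0: "t0 \<le> b" "(com_step ^^ t0) (c, initial_store x) = (Skip, s)"
      unfolding runs_def by blast
    have c0: "cs ! 0 = c" by (simp add: cs_def)
    have "0 < length cs" by (simp add: len)
    from steps[OF this, of t0 "initial_store x"] obtain q' where q': "q' < length cs" "cs ! q' = Skip"
      "(step M ^^ t0) (init M [x]) = (q', map s [0..<K])"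
      by (auto simp only: c0 t0(2) in0 fst_conv snd_conv)
    have "q' = n" 
      using q'(1,2) last dist len nth_eq_iff_index_eq[of cs q' n] by simp
    have "(step M ^^ j) (n, map s [0..<K]) = (n, map s [0..<K])" for j
      by (induction j) (simp_all add: nst step.simps)
    then have "(step M ^^ ((t - t0) + t0)) (init M [x]) = (n, map s [0..<K])"
      using q' \<open>q' = n\<close> by (simp only: funpow_add o_apply)
    moreover have "(t - t0) + t0 = t" using t0(1) \<open>b \<le> t\<close> by simp
    ultimately have "run M [x] t = (n, map s [0..<K])" by (simp only: run_def)
    then show "halted M (run M [x] t)" "snd (run M [x] t) = map s [0..<K]"
      by (simp_all only: halted_def nst fst_conv snd_conv order_refl)
  qed
qed


section \<open>Programs that write output\<close>

declare One_nat_def [simp del]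

text \<open>Tape 0 holds the input, tape 1 the output, tape 2 a counter whose digits \<open>d\<close> are stored as
  \<open>Suc d\<close>, tape 3 the state of an automaton, and further tapes hold copies of the input.\<close>

definition tape_of :: "nat list \<Rightarrow> int \<Rightarrow> tape" where
  "tape_of xs h = ((\<lambda>i. if 0 \<le> i \<and> i < int (length xs) then xs ! nat i else 0), h)"

definition bsym :: "bool \<Rightarrow> nat" where
  "bsym b = (if b then 2 else 1)"

definition outp :: "bool list \<Rightarrow> tape" where
  "outp bs = tape_of (map bsym bs) (int (length bs))"

lemma fst_tape_of_bsym: "fst (tape_of (map bsym bs) h) = contents_of bs"
  by (auto simp: tape_of_def contents_of_def bsym_def fun_eq_iff)

lemma contents_of_tape_of: "(contents_of bs, h) = tape_of (map bsym bs) h"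
  by (rule prod_eqI) (simp_all only: fst_conv snd_conv fst_tape_of_bsym, simp add: tape_of_def)

lemma read_tape_of [simp]: "read (tape_of xs h) = (if 0 \<le> h \<and> h < int (length xs) then xs ! nat h else 0)"
  by (simp add: tape_of_def)

lemma act_tape_of_update:
  assumes "i < length xs"
  shows "act (a, d) (tape_of xs (int i)) = tape_of (xs[i := a]) (move d (int i))"
  using assms by (auto simp: tape_of_def fun_eq_iff nth_list_update)

lemma act_tape_of_append: "act (a, d) (tape_of xs (int (length xs))) = tape_of (xs @ [a]) (move d (int (length xs)))"
  by (auto simp: tape_of_def fun_eq_iff nth_append nat_less_iff)

lemma act_outp: "act (bsym b, Go_Right) (outp bs) = outp (bs @ [b])"
  using act_tape_of_append[of "bsym b" Go_Right "map bsym bs"] by (simp add: outp_def add.commute)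

lemma act_tape_of_move: "act (read (tape_of xs h), d) (tape_of xs h) = tape_of xs (move d h)"
  by (auto simp: tape_of_def fun_eq_iff)

lemma reads_apply [simp]: "reads s k = read (s k)"
  by (simp add: reads_def)

lemma bsym_neq_0 [simp]: "bsym b \<noteq> 0" "0 \<noteq> bsym b" "0 \<notin> bsym ` A"
  by (auto simp: bsym_def)

definition mv :: "nat \<Rightarrow> dir \<Rightarrow> com" where
  "mv k d = Act k (\<lambda>r. (r k, d))"

lemma runs_mv:
  assumes "s k = tape_of xs h" "h' = move d h" "1 \<le> b"
  shows "runs (mv k d) s (s(k := tape_of xs h')) b"
proof -
  have eq: "act (reads s k, d) (s k) = tape_of xs h'"
    using act_tape_of_move[of xs h d] unfolding reads_apply assms(1,2) .
  show ?thesis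
    using runs_Act[OF assms(3), of k "\<lambda>r. (r k, d)" s] unfolding mv_def eq .
qed

text \<open>The loop stops at the blank in cell -1. The move before it is needed because the head
  may already stand on the blank behind the word.\<close>

definition rewind :: "nat \<Rightarrow> com" where
  "rewind k = mv k Go_Left ;; While (\<lambda>r. r k \<noteq> 0) (mv k Go_Left) ;; mv k Go_Right"

lemma runs_rewind:
  assumes s: "s k = tape_of xs (int h)" and h: "h \<le> length xs" and xs: "0 \<notin> set xs" and b: "3 * length xs + 5 \<le> b"
  shows "runs (rewind k) s (s(k := tape_of xs 0)) b"
proof -
  define S where "S = (\<lambda>i. s(k := tape_of xs (int h - 1 - int i)))"
  have nz: "xs ! i \<noteq> 0" if "i < length xs" for i using xs nth_mem[OF that] by metis
  have 1: "runs (mv k Go_Left) s (S 0) 1"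
    using runs_mv[of s k xs "int h" "int h - 1" Go_Left 1] s by (simp add: S_def)
  have 2: "runs (While (\<lambda>r. r k \<noteq> 0) (mv k Go_Left)) (S 0) (S h) (3 * h + 1)"
  proof (rule runs_While)
    show "reads (S i) k \<noteq> 0" if "i < h" for i
      using that h nz by (auto simp: S_def)
    show "runs (mv k Go_Left) (S i) (S (Suc i)) 1" if "i < h" for i
    proof -
      have "S (Suc i) = (S i)(k := tape_of xs (int h - 1 - int (Suc i)))" by (simp add: S_def)
      then show ?thesis using runs_mv[of "S i" k xs "int h - 1 - int i" "int h - 1 - int (Suc i)" Go_Left 1]
        by (simp add: S_def)
    qed
    show "\<not> reads (S h) k \<noteq> 0" by (simp add: S_def)
  qed simp
  have 3: "runs (mv k Go_Right) (S h) (s(k := tape_of xs 0)) 1"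
  proof -
    have "s(k := tape_of xs 0) = (S h)(k := tape_of xs 0)" by (simp add: S_def)
    then show ?thesis using runs_mv[of "S h" k xs "- 1" 0 Go_Right 1] by (simp add: S_def)
  qed
  show ?thesis unfolding rewind_def
    by (rule runs_Seq[OF 1 runs_Seq[OF 2 3 order_refl]]) (use b h in simp)
qed

text \<open>The factor \<open>length ds + 1\<close> pays for a scan of the counter. \<open>I\<close>
  constrains the tape of the automaton, which the program must find and leave in the same
  state.\<close>

definition emits :: "(tape \<Rightarrow> bool) \<Rightarrow> com \<Rightarrow> (nat list \<Rightarrow> bool list) \<Rightarrow> nat \<Rightarrow> bool" where
  "emits I c f b \<longleftrightarrow> (\<forall>s out ds. s 1 = outp out \<longrightarrow> s 2 = tape_of (map Suc ds) 0 \<longrightarrow> I (s 3) \<longrightarrow>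
     runs c s (s(1 := outp (out @ f ds))) (b * (length ds + 1)))"

lemma emitsI:
  assumes "\<And>s out ds. s 1 = outp out \<Longrightarrow> s 2 = tape_of (map Suc ds) 0 \<Longrightarrow> I (s 3) \<Longrightarrow>
     runs c s (s(1 := outp (out @ f ds))) (b * (length ds + 1))"
  shows "emits I c f b"
  using assms unfolding emits_def by blast

lemma emitsD:
  assumes "emits I c f b" "s 1 = outp out" "s 2 = tape_of (map Suc ds) 0" "I (s 3)" "b * (length ds + 1) \<le> b'"
  shows "runs c s (s(1 := outp (out @ f ds))) b'"
  using assms runs_weaken unfolding emits_def by blast

lemma emits_weaken: "emits I c f b \<Longrightarrow> (\<And>t. J t \<Longrightarrow> I t) \<Longrightarrow> emits J c f b"
  unfolding emits_def by blast

lemma emits_Skip: "emits I Skip (\<lambda>_. []) 0"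
  by (auto intro!: emitsI simp: runs_Skip fun_upd_idem)

lemma emits_Seq:
  assumes "emits I a f b1" "emits I c g b2"
  shows "emits I (a ;; c) (\<lambda>ds. f ds @ g ds) (b1 + b2 + 1)"
proof (rule emitsI)
  fix s :: store and out ds assume s: "s 1 = outp out" "s 2 = tape_of (map Suc ds) 0" "I (s 3)"
  let ?s = "s(1 := outp (out @ f ds))"
  have 1: "runs a s ?s (b1 * (length ds + 1))" using assms(1) s unfolding emits_def by blast
  have 2: "runs c ?s (?s(1 := outp ((out @ f ds) @ g ds))) (b2 * (length ds + 1))"
    by (rule emitsD[OF assms(2)]) (use s in simp_all)
  show "runs (a ;; c) s (s(1 := outp (out @ f ds @ g ds))) ((b1 + b2 + 1) * (length ds + 1))"
    using runs_Seq[OF 1 2] by (simp add: algebra_simps)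
qed

definition seqs :: "com list \<Rightarrow> com" where
  "seqs cs = foldr Seq cs Skip"

lemma seqs_simps [simp]: "seqs [] = Skip" "seqs (c # cs) = c ;; seqs cs"
  by (simp_all add: seqs_def)

lemma emits_seqs:
  assumes "\<And>x. x \<in> set xs \<Longrightarrow> \<exists>b. emits I (P x) (f x) b"
  shows "\<exists>b. emits I (seqs (map P xs)) (\<lambda>ds. concat (map (\<lambda>x. f x ds) xs)) b"
  using assms
proof (induction xs)
  case Nil
  then show ?case using emits_Skip by auto
next
  case (Cons x xs)
  from Cons.prems[of x] obtain b1 where "emits I (P x) (f x) b1" by auto
  moreover from Cons obtain b2 where "emits I (seqs (map P xs)) (\<lambda>ds. concat (map (\<lambda>x. f x ds) xs)) b2" by auto
  ultimately show ?case using emits_Seq by fastforce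
qed

definition emit :: "bool list \<Rightarrow> com" where
  "emit bs = seqs (map (\<lambda>b. Act 1 (\<lambda>_. (bsym b, Go_Right))) bs)"

lemma emits_emit: "\<exists>b. emits I (emit bs) (\<lambda>_. bs) b"
proof -
  have "emits I (Act 1 (\<lambda>_. (bsym b, Go_Right))) (\<lambda>_. [b]) 1" for b
  proof (rule emitsI)
    fix s :: store and out ds assume "s 1 = outp out"
    then show "runs (Act 1 (\<lambda>_. (bsym b, Go_Right))) s (s(1 := outp (out @ [b]))) (1 * (length (ds :: nat list) + 1))"
      using runs_Act[of "1 * (length ds + 1)" 1 "\<lambda>_. (bsym b, Go_Right)" s] act_outp[of b out] by simp
  qed
  then show ?thesis
    using emits_seqs[of bs I "\<lambda>b. Act 1 (\<lambda>_. (bsym b, Go_Right))" "\<lambda>b _. [b]"] by (auto simp: emit_def)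
qed

definition digit_emit :: "(nat \<Rightarrow> bool) list \<Rightarrow> com" where
  "digit_emit gs = seqs (map (\<lambda>g. Act 1 (\<lambda>r. (bsym (g (r 2 - 1)), Go_Right))) gs)"

lemma runs_digit_emit:
  assumes "s 1 = outp out" "read (s 2) = Suc d" "2 * length gs \<le> b"
  shows "runs (digit_emit gs) s (s(1 := outp (out @ map (\<lambda>g. g d) gs))) b"
  using assms
proof (induction gs arbitrary: s out b)
  case Nil
  then show ?case by (simp add: digit_emit_def runs_Skip fun_upd_idem)
next
  case (Cons g gs)
  let ?s = "s(1 := outp (out @ [g d]))"
  have 1: "runs (Act 1 (\<lambda>r. (bsym (g (r 2 - 1)), Go_Right))) s ?s 1"
    using runs_Act[of 1 1 "\<lambda>r. (bsym (g (r 2 - 1)), Go_Right)" s] Cons.prems(1,2) act_outp[of "g d" out] by simp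
  have 2: "runs (digit_emit gs) ?s (?s(1 := outp ((out @ [g d]) @ map (\<lambda>g. g d) gs))) (2 * length gs)"
    by (rule Cons.IH) (use Cons.prems in simp_all)
  have eq: "?s(1 := outp ((out @ [g d]) @ map (\<lambda>g. g d) gs)) = s(1 := outp (out @ map (\<lambda>g. g d) (g # gs)))"
    by (simp only: fun_upd_upd append_assoc append.simps list.map)
  show ?case
    using runs_Seq[OF 1 2[unfolded eq], of b] Cons.prems(3) unfolding digit_emit_def list.map seqs_simps
    by (simp add: fun_upd_def)
qed

definition digits_emit :: "(nat \<Rightarrow> bool) list \<Rightarrow> com" where
  "digits_emit gs = While (\<lambda>r. r 2 \<noteq> 0) (digit_emit gs ;; mv 2 Go_Right) ;; rewind 2"

lemma emits_digits_emit: "\<exists>b. emits I (digits_emit gs) (\<lambda>ds. concat (map (\<lambda>d. map (\<lambda>g. g d) gs) ds)) b"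
proof (intro exI emitsI)
  fix s :: store and out ds assume s: "s 1 = outp out" "s 2 = tape_of (map Suc ds) 0"
  let ?f = "\<lambda>ds. concat (map (\<lambda>d. map (\<lambda>g. g d) gs) ds)"
  define S where "S = (\<lambda>i. s(1 := outp (out @ ?f (take i ds)), 2 := tape_of (map Suc ds) (int i)))"
  have S0: "s = S 0" using s by (auto simp: S_def fun_eq_iff)
  let ?b = "2 * length gs + 2"
  have 1: "runs (While (\<lambda>r. r 2 \<noteq> 0) (digit_emit gs ;; mv 2 Go_Right)) s (S (length ds)) (length ds * (?b + 2) + 1)"
    unfolding S0
  proof (rule runs_While)
    fix i assume i: "i < length ds"
    then show "reads (S i) 2 \<noteq> 0" by (simp add: S_def)
    have a: "runs (digit_emit gs) (S i) ((S i)(1 := outp ((out @ ?f (take i ds)) @ map (\<lambda>g. g (ds ! i)) gs))) (2 * length gs)"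
      by (rule runs_digit_emit) (use i in \<open>simp_all add: S_def\<close>)
    have eq: "((S i)(1 := outp ((out @ ?f (take i ds)) @ map (\<lambda>g. g (ds ! i)) gs)))(2 := tape_of (map Suc ds) (int (Suc i))) = S (Suc i)"
      using i by (simp add: S_def take_Suc_conv_app_nth fun_upd_twist)
    have b: "runs (mv 2 Go_Right) ((S i)(1 := outp ((out @ ?f (take i ds)) @ map (\<lambda>g. g (ds ! i)) gs))) (S (Suc i)) 1"
      unfolding eq[symmetric] by (rule runs_mv[where h = "int i"]) (simp_all add: S_def)
    show "runs (digit_emit gs ;; mv 2 Go_Right) (S i) (S (Suc i)) ?b"
      by (rule runs_Seq[OF a b]) simp
  next
    show "\<not> reads (S (length ds)) 2 \<noteq> 0" by (simp add: S_def)
  qed simp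
  have 2: "runs (rewind 2) (S (length ds)) ((S (length ds))(2 := tape_of (map Suc ds) 0)) (3 * length ds + 5)"
    by (rule runs_rewind[where h = "length ds"]) (auto simp: S_def)
  have eq: "(S (length ds))(2 := tape_of (map Suc ds) 0) = s(1 := outp (out @ ?f ds))"
    using s by (auto simp: S_def fun_eq_iff)
  show "runs (digits_emit gs) s (s(1 := outp (out @ ?f ds))) ((2 * length gs + 15) * (length ds + 1))"
    unfolding digits_emit_def by (rule runs_Seq[OF 1 2[unfolded eq]]) (simp add: algebra_simps)
qed

text \<open>The tests are made one after another; only one succeeds because each program leaves tape
  3 unchanged.\<close>

fun branch :: "nat \<Rightarrow> (nat \<Rightarrow> com) \<Rightarrow> com" where
  "branch 0 P = Skip"
| "branch (Suc n) P = branch n P ;; Cond (\<lambda>r. r 3 = n) (P n) Skip"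

lemma emits_branch:
  assumes P: "\<And>z. z < n \<Longrightarrow> \<exists>b. emits (\<lambda>_. True) (P z) (f z) b"
  shows "\<exists>b. \<forall>z. emits (\<lambda>t. read t = z) (branch n P) (\<lambda>ds. if z < n then f z ds else []) b"
  using P
proof (induction n)
  case 0
  then show ?case using emits_Skip by auto
next
  case (Suc n)
  obtain b where b: "\<And>z. emits (\<lambda>t. read t = z) (branch n P) (\<lambda>ds. if z < n then f z ds else []) b"
    using Suc.IH Suc.prems less_SucI by blast
  obtain b' where b': "emits (\<lambda>_. True) (P n) (f n) b'" using Suc.prems by blast
  have "emits (\<lambda>t. read t = z) (Cond (\<lambda>r. r 3 = n) (P n) Skip) (\<lambda>ds. if z = n then f z ds else []) (b' + 1)" for z
  proof (rule emitsI)
    fix s :: store and out ds assume s: "s 1 = outp out" "s 2 = tape_of (map Suc ds) 0" "read (s 3) = z"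
    show "runs (Cond (\<lambda>r. r 3 = n) (P n) Skip) s (s(1 := outp (out @ (if z = n then f z ds else []))))
        ((b' + 1) * (length ds + 1))"
    proof (rule runs_Cond)
      show "runs (if reads s 3 = n then P n else Skip) s (s(1 := outp (out @ (if z = n then f z ds else []))))
          (b' * (length ds + 1))"
        using s emitsD[OF b' s(1,2)] by (auto simp: runs_Skip fun_upd_idem)
    qed (simp add: algebra_simps)
  qed
  note e = emits_Seq[OF b this]
  have "emits (\<lambda>t. read t = z) (branch (Suc n) P) (\<lambda>ds. if z < Suc n then f z ds else []) (b + (b' + 1) + 1)" for z
  proof -
    have "(\<lambda>ds. (if z < n then f z ds else []) @ (if z = n then f z ds else [])) =
        (\<lambda>ds. if z < Suc n then f z ds else [])" by (auto simp: fun_eq_iff)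
    with e[of z] show ?thesis by simp
  qed
  then show ?case by blast
qed

text \<open>The last action erases the state of the automaton, so that the next call finds the blank
  tape that it expects.\<close>

definition classify :: "nat \<Rightarrow> (nat \<Rightarrow> nat \<Rightarrow> nat) \<Rightarrow> nat \<Rightarrow> (nat \<Rightarrow> com) \<Rightarrow> com" where
  "classify n dl z0 P = Act 3 (\<lambda>_. (z0, Stay)) ;;
     While (\<lambda>r. r 2 \<noteq> 0) (Act 3 (\<lambda>r. (dl (r 3) (r 2 - 1), Stay)) ;; mv 2 Go_Right) ;; rewind 2 ;;
     branch n P ;; Act 3 (\<lambda>_. (0, Stay))"

definition cell0 :: "nat \<Rightarrow> tape" where
  "cell0 z = ((\<lambda>_. 0)(0 := z), 0)"

lemma cell0_simps [simp]: "read (cell0 z) = z" "act (a, Stay) (cell0 z) = cell0 a" "cell0 0 = tape_of [] 0"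
  by (auto simp: cell0_def tape_of_def)

lemma emits_classify:
  assumes P: "\<And>z. z < n \<Longrightarrow> \<exists>b. emits (\<lambda>_. True) (P z) (f z) b"
    and dl: "z0 < n" "\<And>z d. z < n \<Longrightarrow> dl z d < n"
  shows "\<exists>b. emits (\<lambda>t. t = tape_of [] 0) (classify n dl z0 P) (\<lambda>ds. f (foldl dl z0 ds) ds) b"
proof -
  from emits_branch[of n P f, OF P] obtain b where
    b: "\<And>z. emits (\<lambda>t. read t = z) (branch n P) (\<lambda>ds. if z < n then f z ds else []) b" by blast
  have "emits (\<lambda>t. t = tape_of [] 0) (classify n dl z0 P) (\<lambda>ds. f (foldl dl z0 ds) ds) (b + 30)"
  proof (rule emitsI)
    fix s :: store and out ds assume s: "s 1 = outp out" "s 2 = tape_of (map Suc ds) 0" "s 3 = tape_of [] 0"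
    define S where "S = (\<lambda>i. s(3 := cell0 (foldl dl z0 (take i ds)), 2 := tape_of (map Suc ds) (int i)))"
    define z where "z = foldl dl z0 ds"
    have zn: "z < n"
    proof -
      have "foldl dl w ds < n" if "w < n" for w
        using that by (induction ds arbitrary: w) (simp_all add: dl)
      then show ?thesis using dl(1) by (simp add: z_def)
    qed
    have 1: "runs (Act 3 (\<lambda>_. (z0, Stay))) s (S 0) 1"
    proof -
      have "S 0 = s(3 := cell0 z0)" using s by (auto simp: S_def fun_eq_iff)
      then show ?thesis
        using runs_Act[of 1 3 "\<lambda>_. (z0, Stay)" s] s(3) by (simp flip: cell0_simps(3) del: cell0_simps(3))
    qed
    have 2: "runs (While (\<lambda>r. r 2 \<noteq> 0) (Act 3 (\<lambda>r. (dl (r 3) (r 2 - 1), Stay)) ;; mv 2 Go_Right)) (S 0) (S (length ds))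
        (length ds * (3 + 2) + 1)"
    proof (rule runs_While)
      fix i assume i: "i < length ds"
      then show "reads (S i) 2 \<noteq> 0" by (simp add: S_def)
      let ?s = "(S i)(3 := cell0 (foldl dl z0 (take (Suc i) ds)))"
      have a: "runs (Act 3 (\<lambda>r. (dl (r 3) (r 2 - 1), Stay))) (S i) ?s 1"
        using runs_Act[of 1 3 "\<lambda>r. (dl (r 3) (r 2 - 1), Stay)" "S i"] i
        by (simp add: S_def take_Suc_conv_app_nth)
      have eq: "?s(2 := tape_of (map Suc ds) (int (Suc i))) = S (Suc i)"
        by (auto simp: S_def fun_eq_iff)
      have b: "runs (mv 2 Go_Right) ?s (S (Suc i)) 1"
        unfolding eq[symmetric] by (rule runs_mv[where h = "int i"]) (simp_all add: S_def)
      show "runs (Act 3 (\<lambda>r. (dl (r 3) (r 2 - 1), Stay)) ;; mv 2 Go_Right) (S i) (S (Suc i)) 3"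
        by (rule runs_Seq[OF a b]) simp
    next
      show "\<not> reads (S (length ds)) 2 \<noteq> 0" by (simp add: S_def)
    qed simp
    let ?s3 = "s(3 := cell0 z)"
    have eq: "(S (length ds))(2 := tape_of (map Suc ds) 0) = ?s3"
      using s by (auto simp: S_def fun_eq_iff z_def)
    have 3: "runs (rewind 2) (S (length ds)) ?s3 (3 * length ds + 5)"
      unfolding eq[symmetric] by (rule runs_rewind[where h = "length ds"]) (auto simp: S_def)
    have 4: "runs (branch n P) ?s3 (?s3(1 := outp (out @ f z ds))) (b * (length ds + 1))"
      using emitsD[OF b[of z], of ?s3 out ds] s zn by simp
    have eq5: "s(1 := outp (out @ f z ds)) = (?s3(1 := outp (out @ f z ds)))(3 := cell0 0)"
      using s(3) by (auto simp: fun_eq_iff)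
    have 5: "runs (Act 3 (\<lambda>_. (0, Stay))) (?s3(1 := outp (out @ f z ds))) (s(1 := outp (out @ f z ds))) 1"
      unfolding eq5 using runs_Act[of 1 3 "\<lambda>_. (0, Stay)" "?s3(1 := outp (out @ f z ds))"] by simp
    show "runs (classify n dl z0 P) s (s(1 := outp (out @ f (foldl dl z0 ds) ds))) ((b + 30) * (length ds + 1))"
      unfolding classify_def z_def[symmetric]
      by (rule runs_Seq[OF 1 runs_Seq[OF 2 runs_Seq[OF 3 runs_Seq[OF 4 5 order_refl] order_refl] order_refl]])
        (simp add: algebra_simps)
  qed
  then show ?thesis by blast
qed


section \<open>Counters and polynomial loops\<close>

text \<open>One loop with three uses: resetting digits at a carry, since the digit 0 is stored as 1;
  turning ones into zeros in \<open>grow\<close>; and setting all digits to zero in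
  \<open>clear\<close>.\<close>

definition sweep :: "(nat \<Rightarrow> bool) \<Rightarrow> com" where
  "sweep P = While (\<lambda>r. P (r 2)) (Act 2 (\<lambda>_. (1, Go_Right)))"

lemma swept_update:
  assumes "i < length xs"
  shows "(replicate i a @ drop i xs)[i := b] = replicate i a @ b # drop (Suc i) xs"
proof -
  have d: "drop i xs = xs ! i # drop (Suc i) xs" using assms by (simp add: Cons_nth_drop_Suc)
  show ?thesis unfolding d by (simp add: list_update_append)
qed

lemma runs_sweep:
  fixes s :: store
  assumes s: "s 2 = tape_of xs 0" and P: "\<not> P 0" and b: "3 * length xs + 1 \<le> b"
  defines "k \<equiv> length (takeWhile P xs)"
  shows "runs (sweep P) s (s(2 := tape_of (replicate k 1 @ drop k xs) (int k))) b"
proof -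
  define S where "S = (\<lambda>i. s(2 := tape_of (replicate i 1 @ drop i xs) (int i)))"
  have k: "k \<le> length xs" by (simp add: k_def length_takeWhile_le)
  have sym: "read (S i 2) = (if i < length xs then xs ! i else 0)" if "i \<le> k" for i
    using that k by (auto simp: S_def nth_append)
  have "runs (While (\<lambda>r. P (r 2)) (Act 2 (\<lambda>_. (1, Go_Right)))) (S 0) (S k) (k * (1 + 2) + 1)"
  proof (rule runs_While)
    fix i assume i: "i < k"
    then have "takeWhile P xs ! i \<in> set (takeWhile P xs)" unfolding k_def by (rule nth_mem)
    moreover have "takeWhile P xs ! i = xs ! i" using i unfolding k_def by (rule takeWhile_nth)
    ultimately have "P (xs ! i)" using set_takeWhileD[of "xs ! i" P xs] by simp
    then show "P (reads (S i) 2)" using sym[of i] i k by simp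
    have "(S i)(2 := act (1, Go_Right) (S i 2)) = S (Suc i)"
    proof -
      have "(replicate i 1 @ drop i xs)[i := 1] = replicate (Suc i) 1 @ drop (Suc i) xs"
        using swept_update[of i xs 1 1] i k by (simp add: replicate_app_Cons_same)
      then show ?thesis
        using i k act_tape_of_update[of i "replicate i 1 @ drop i xs" 1 Go_Right] by (simp add: S_def add.commute)
    qed
    then show "runs (Act 2 (\<lambda>_. (1, Go_Right))) (S i) (S (Suc i)) 1"
      using runs_Act[of 1 2 "\<lambda>_. (1, Go_Right)" "S i"] by simp
  next
    show "\<not> P (reads (S k) 2)"
      using sym[of k] P nth_length_takeWhile[of P xs] by (simp add: k_def)
  qed simp
  moreover have "S 0 = s" using s by (simp add: S_def fun_upd_idem)
  ultimately have "runs (sweep P) s (S k) (k * (1 + 2) + 1)" by (simp add: sweep_def)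
  then show ?thesis unfolding S_def by (rule runs_weaken) (use b k in simp)
qed

fun incr :: "nat \<Rightarrow> nat list \<Rightarrow> nat list" where
  "incr B [] = []"
| "incr B (d # ds) = (if Suc d = B then 0 # incr B ds else Suc d # ds)"

text \<open>The place where the carry stops. \<open>inc\<close> leaves the head there, so a blank
  under the head signals an overflow.\<close>

definition carry :: "nat \<Rightarrow> nat list \<Rightarrow> nat" where
  "carry B ds = length (takeWhile (\<lambda>d. Suc d = B) ds)"

lemma carry_le: "carry B ds \<le> length ds"
  by (simp add: carry_def length_takeWhile_le)

lemma incr_eq: "incr B ds = (let k = carry B ds in
    if k < length ds then replicate k 0 @ Suc (ds ! k) # drop (Suc k) ds else replicate (length ds) 0)"
  by (induction ds) (auto simp: Let_def carry_def)

lemma incr_digits: "0 < B \<Longrightarrow> incr B (digits B L j) = digits B L (Suc j)"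
  by (induction L arbitrary: j) (auto simp: mod_Suc div_Suc)

text \<open>Without a carry out of the lowest digit, \<open>Suc j\<close> is no multiple of
  \<open>B\<close> and cannot reach the limit; with such a carry both sides reduce to
  \<open>j div B\<close>.\<close>

lemma carry_digits:
  assumes "0 < B" "j < B ^ L"
  shows "carry B (digits B L j) < L \<longleftrightarrow> Suc j < B ^ L"
  using assms(2)
proof (induction L arbitrary: j)
  case (Suc L)
  then have "j div B < B ^ L" by (simp add: less_mult_imp_div_less mult.commute)
  note IH = Suc.IH[OF this]
  show ?case
  proof (cases "Suc (j mod B) = B")
    case True
    have "Suc j = B * (j div B) + Suc (j mod B)" by simp
    then have "Suc j = B * Suc (j div B)" using True by simp
    then have "Suc j < B * B ^ L \<longleftrightarrow> Suc (j div B) < B ^ L" using assms(1) by (simp only: mult_less_cancel1 simp_thms)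
    with True IH show ?thesis by (simp add: carry_def)
  next
    case False
    have "Suc j \<noteq> B * B ^ L"
    proof
      assume "Suc j = B * B ^ L"
      then have "Suc j mod B = 0" by simp
      with False show False by (simp add: mod_Suc)
    qed
    with False Suc.prems show ?thesis by (simp add: carry_def)
  qed
qed simp

lemma digits_overflow: "0 < B \<Longrightarrow> digits B L (B ^ L) = digits B L 0"
  by (induction L) simp_all

lemma digits_0: "map Suc (digits B L 0) = replicate L 1"
  by (induction L) (simp_all add: One_nat_def)

text \<open>The inner case distinction keeps the written symbol in the alphabet whatever is read, as
  \<open>writes_below\<close> demands.\<close>

definition inc :: "nat \<Rightarrow> com" where
  "inc B = sweep (\<lambda>v. v = B) ;;
     Cond (\<lambda>r. r 2 = 0) Skip (Act 2 (\<lambda>r. (if r 2 < B then Suc (r 2) else 1, Stay)))"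

lemma runs_inc:
  fixes s :: store
  assumes s: "s 2 = tape_of (map Suc ds) 0" and ds: "set ds \<subseteq> {..<B}" and b: "3 * length ds + 5 \<le> b" and B: "0 < B"
  shows "runs (inc B) s (s(2 := tape_of (map Suc (incr B ds)) (int (carry B ds)))) b"
proof -
  let ?k = "carry B ds"
  have k: "length (takeWhile (\<lambda>v. v = B) (map Suc ds)) = ?k"
    by (simp add: carry_def takeWhile_map o_def)
  let ?s = "s(2 := tape_of (replicate ?k 1 @ drop ?k (map Suc ds)) (int ?k))"
  have 1: "runs (sweep (\<lambda>v. v = B)) s ?s (3 * length ds + 1)"
    using runs_sweep[where s = s and P = "\<lambda>v. v = B", OF s] B unfolding k by simp
  have 2: "runs (Cond (\<lambda>r. r 2 = 0) Skip (Act 2 (\<lambda>r. (if r 2 < B then Suc (r 2) else 1, Stay)))) ?s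
      (s(2 := tape_of (map Suc (incr B ds)) (int ?k))) 2"
  proof (cases "?k < length ds")
    case True
    let ?d = "ds ! ?k"
    have "Suc ?d \<noteq> B" using True nth_length_takeWhile[of "\<lambda>d. Suc d = B" ds] by (simp add: carry_def)
    moreover have "?d < B" using ds True nth_mem by blast
    ultimately have d: "Suc ?d < B" by simp
    have "(replicate ?k 1 @ drop ?k (map Suc ds))[?k := Suc (Suc ?d)] = map Suc (incr B ds)"
      using True swept_update[of ?k "map Suc ds" 1 "Suc (Suc ?d)"]
      by (simp add: incr_eq Let_def drop_map One_nat_def)
    then have "act (Suc (Suc ?d), Stay) (?s 2) = tape_of (map Suc (incr B ds)) (int ?k)"
      using True act_tape_of_update[of ?k "replicate ?k 1 @ drop ?k (map Suc ds)" "Suc (Suc ?d)" Stay] by simp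
    moreover have "reads ?s 2 = Suc ?d" using True by (simp add: nth_append)
    ultimately show ?thesis
      using d runs_Act[of 1 2 "\<lambda>r. (if r 2 < B then Suc (r 2) else 1, Stay)" ?s]
      by (intro runs_Cond[where n = 1]) auto
  next
    case False
    then have kl: "?k = length ds" using carry_le[of B ds] by simp
    then have "?s = s(2 := tape_of (map Suc (incr B ds)) (int ?k))" by (simp add: incr_eq Let_def One_nat_def)
    moreover have "reads ?s 2 = 0" using kl by simp
    ultimately show ?thesis by (intro runs_Cond[where n = 1]) (simp_all add: runs_Skip)
  qed
  show ?thesis unfolding inc_def by (rule runs_Seq[OF 1 2]) (use b in simp)
qed

text \<open>The body comes before the test, so the enumeration starts with the current value of the
  counter; the overflow that ends it resets the counter to zero.\<close>

definition odo :: "nat \<Rightarrow> com \<Rightarrow> com" where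
  "odo B body = body ;; inc B ;; While (\<lambda>r. r 2 \<noteq> 0) (rewind 2 ;; body ;; inc B) ;; rewind 2"

lemma runs_odo:
  fixes s :: store
  assumes body: "emits I body f b" and B: "0 < B"
    and s: "s 1 = outp out" "s 2 = tape_of (map Suc (digits B L j)) 0" "I (s 3)" and j: "j < B ^ L"
    and t: "(B ^ L + 1) * ((b + 20) * (L + 1)) \<le> t"
  shows "runs (odo B body) s (s(1 := outp (out @ concat (map (\<lambda>j. f (digits B L j)) [j..<B ^ L])),
    2 := tape_of (map Suc (digits B L 0)) 0)) t"
proof -
  let ?o = "\<lambda>i. outp (out @ concat (map (\<lambda>j. f (digits B L j)) [j..<i]))"
  define S where "S = (\<lambda>i. s(1 := ?o (Suc (j + i)),
    2 := tape_of (map Suc (digits B L (Suc (j + i)))) (int (carry B (digits B L (j + i))))))"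
  have digits_below: "set (digits B L i) \<subseteq> {..<B}" for i using digits_words[OF B, of L i] by (simp add: words_def)
  define c where "c = b * (L + 1) + 3 * L + 6"
  have it: "runs (body ;; inc B) s' (s'(1 := outp (o' @ f (digits B L i)),
      2 := tape_of (map Suc (digits B L (Suc i))) (int (carry B (digits B L i))))) c"
    if "s' 1 = outp o'" "s' 2 = tape_of (map Suc (digits B L i)) 0" "I (s' 3)" for s' o' i
  proof -
    have 1: "runs body s' (s'(1 := outp (o' @ f (digits B L i)))) (b * (L + 1))"
      using emitsD[OF body that] by simp
    have 2: "runs (inc B) (s'(1 := outp (o' @ f (digits B L i))))
        ((s'(1 := outp (o' @ f (digits B L i))))(2 := tape_of (map Suc (incr B (digits B L i))) (int (carry B (digits B L i))))) (3 * L + 5)"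
      by (rule runs_inc) (use that digits_below B in simp_all)
    show ?thesis
      using runs_Seq[OF 1 2, of c] by (simp add: c_def incr_digits[OF B])
  qed
  have 1: "runs (body ;; inc B) s (S 0) c"
    using it[OF s(1-3)] by (simp add: S_def)
  define N where "N = B ^ L - Suc j"
  have jN: "j + N < B ^ L" "Suc (j + N) = B ^ L" using j by (auto simp: N_def)
  have 2: "runs (While (\<lambda>r. r 2 \<noteq> 0) (rewind 2 ;; body ;; inc B)) (S 0) (S N) (N * ((3 * L + 5 + c + 1) + 2) + 1)"
  proof (rule runs_While)
    fix i assume i: "i < N"
    then have less: "j + i < B ^ L" "Suc (j + i) < B ^ L" by (auto simp: N_def)
    have ca: "carry B (digits B L (j + i)) < L" using carry_digits[OF B less(1)] less(2) by simp
    then show "reads (S i) 2 \<noteq> 0" by (simp add: S_def)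
    let ?s = "(S i)(2 := tape_of (map Suc (digits B L (Suc (j + i)))) 0)"
    have a: "runs (rewind 2) (S i) ?s (3 * L + 5)"
      by (rule runs_rewind[where h = "carry B (digits B L (j + i))"]) (use ca in \<open>auto simp: S_def\<close>)
    have e: "?s(1 := outp ((out @ concat (map (\<lambda>j. f (digits B L j)) [j..<Suc (j + i)])) @ f (digits B L (Suc (j + i)))),
        2 := tape_of (map Suc (digits B L (Suc (Suc (j + i))))) (int (carry B (digits B L (Suc (j + i)))))) = S (Suc i)"
      by (auto simp: S_def fun_eq_iff)
    have b: "runs (body ;; inc B) ?s (S (Suc i)) c"
      unfolding e[symmetric] by (rule it) (use s in \<open>simp_all add: S_def\<close>)
    show "runs (rewind 2 ;; body ;; inc B) (S i) (S (Suc i)) (3 * L + 5 + c + 1)"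
      by (rule runs_Seq[OF a b]) simp
  next
    have "carry B (digits B L (j + N)) = L"
      using carry_digits[OF B jN(1)] jN(2) carry_le[of B "digits B L (j + N)"] by simp
    then show "\<not> reads (S N) 2 \<noteq> 0" by (simp add: S_def)
  qed simp
  have 3: "runs (rewind 2) (S N) ((S N)(2 := tape_of (map Suc (digits B L 0)) 0)) (3 * L + 5)"
    by (rule runs_rewind[where h = "carry B (digits B L (j + N))"])
      (use carry_le[of B "digits B L (j + N)"] in \<open>auto simp: S_def jN(2) digits_overflow[OF B]\<close>)
  have e: "(S N)(2 := tape_of (map Suc (digits B L 0)) 0) = s(1 := ?o (B ^ L), 2 := tape_of (map Suc (digits B L 0)) 0)"
    unfolding S_def jN(2) by simp
  have assoc: "odo B body = body ;; (inc B ;; (While (\<lambda>r. r 2 \<noteq> 0) (rewind 2 ;; body ;; inc B) ;; rewind 2))"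
    by (simp add: odo_def)
  have a1: "runs body s (s(1 := outp (out @ f (digits B L j)))) (b * (L + 1))"
    using emitsD[OF body s(1-3)] by simp
  have a2: "runs (inc B) (s(1 := outp (out @ f (digits B L j)))) (S 0) (3 * L + 5)"
  proof -
    have "S 0 = (s(1 := outp (out @ f (digits B L j))))(2 := tape_of (map Suc (incr B (digits B L j))) (int (carry B (digits B L j))))"
      by (simp add: S_def incr_digits[OF B])
    then show ?thesis using runs_inc[of "s(1 := outp (out @ f (digits B L j)))" "digits B L j" B] s digits_below B by simp
  qed
  show ?thesis
    unfolding assoc
  proof (rule runs_Seq[OF a1 runs_Seq[OF a2 runs_Seq[OF 2 3[unfolded e] order_refl] order_refl]])
    have "N + 1 \<le> B ^ L" using jN by simp
    \<comment> \<open>\<open>D\<close> bounds a round, whose cost is \<open>E\<close>; the first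
      call of the body and the closing steps fit into \<open>2 * D\<close>.\<close>
    define D where "D = (b + 20) * (L + 1)"
    define E where "E = 3 * L + 5 + c + 1 + 2"
    have "E \<le> D" by (simp add: c_def D_def E_def algebra_simps)
    then have "N * E \<le> N * D" by (rule mult_le_mono2)
    moreover have "b * (L + 1) + (3 * L + 5) + 1 + (3 * L + 5) + 4 \<le> 2 * D" by (simp add: D_def algebra_simps)
    moreover have "N * D + 2 * D \<le> (B ^ L + 1) * D"
      using mult_le_mono1[of "N + 2" "B ^ L + 1" D] \<open>N + 1 \<le> B ^ L\<close> by (simp add: algebra_simps)
    ultimately show "b * (L + 1) + (3 * L + 5 + (N * (3 * L + 5 + c + 1 + 2) + 1 + (3 * L + 5) + 1) + 1) + 1 \<le> t"
      using t unfolding D_def[symmetric] E_def[symmetric] by linarith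
  qed
qed

definition for_tape :: "nat \<Rightarrow> com \<Rightarrow> com" where
  "for_tape k body = While (\<lambda>r. r k \<noteq> 0) (body ;; mv k Go_Right) ;; rewind k"

text \<open>\<open>S (Suc i)\<close> includes the move on tape \<open>k\<close> that follows the
  body; the update in the first assumption undoes it.\<close>

lemma runs_for_tape:
  fixes S :: "nat \<Rightarrow> store"
  assumes S: "\<And>i. i < length xs \<Longrightarrow> runs body (S i) ((S (Suc i))(k := tape_of xs (int i))) b"
    and k: "\<And>i. i \<le> length xs \<Longrightarrow> S i k = tape_of xs (int i)"
    and xs: "0 \<notin> set xs" and t: "length xs * (b + 4) + 3 * length xs + 7 \<le> t"
  shows "runs (for_tape k body) (S 0) ((S (length xs))(k := tape_of xs 0)) t"
proof -
  have 1: "runs (While (\<lambda>r. r k \<noteq> 0) (body ;; mv k Go_Right)) (S 0) (S (length xs)) (length xs * ((b + 2) + 2) + 1)"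
  proof (rule runs_While)
    fix i assume i: "i < length xs"
    have "xs ! i \<noteq> 0" using xs nth_mem[OF i] by metis
    then show "reads (S i) k \<noteq> 0" using k[of i] i by simp
    have e: "((S (Suc i))(k := tape_of xs (int i)))(k := tape_of xs (int (Suc i))) = S (Suc i)"
      using k[of "Suc i"] i by (auto simp: fun_eq_iff)
    have "runs (mv k Go_Right) ((S (Suc i))(k := tape_of xs (int i))) (((S (Suc i))(k := tape_of xs (int i)))(k := tape_of xs (int (Suc i)))) 1"
      by (rule runs_mv[where h = "int i"]) simp_all
    from runs_Seq[OF S[OF i] this[unfolded e], of "b + 2"]
    show "runs (body ;; mv k Go_Right) (S i) (S (Suc i)) (b + 2)" by simp
  next
    show "\<not> reads (S (length xs)) k \<noteq> 0" using k[of "length xs"] by simp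
  qed simp
  have 2: "runs (rewind k) (S (length xs)) ((S (length xs))(k := tape_of xs 0)) (3 * length xs + 5)"
    by (rule runs_rewind[where h = "length xs"]) (use k xs in simp_all)
  show ?thesis unfolding for_tape_def by (rule runs_Seq[OF 1 2]) (use t in \<open>simp add: algebra_simps\<close>)
qed

text \<open>Horner's scheme: the body runs exactly as often as the value of the polynomial at the
  length of the loop tapes.\<close>

fun poly_loop :: "nat list \<Rightarrow> nat \<Rightarrow> com \<Rightarrow> com" where
  "poly_loop [] k body = Skip"
| "poly_loop (a # as) k body = seqs (replicate a body) ;; for_tape k (poly_loop as (Suc k) body)"

fun horner :: "nat list \<Rightarrow> nat \<Rightarrow> nat" where
  "horner [] n = 0"
| "horner (a # as) n = a + n * horner as n"

fun loop_time :: "nat list \<Rightarrow> nat \<Rightarrow> nat \<Rightarrow> nat" where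
  "loop_time [] n b = 0"
| "loop_time (a # as) n b = a * (b + 1) + n * (loop_time as n b + 4) + 3 * n + 8"

text \<open>Tapes 1 and 2 are functions of the number of finished rounds, so that nested loops
  compose by adding up rounds.\<close>

definition advances :: "com \<Rightarrow> (nat \<Rightarrow> tape) \<Rightarrow> (nat \<Rightarrow> tape) \<Rightarrow> (tape \<Rightarrow> bool) \<Rightarrow> nat \<Rightarrow> nat \<Rightarrow> bool" where
  "advances body A C I N b \<longleftrightarrow> (\<forall>s i. i < N \<longrightarrow> s 1 = A i \<longrightarrow> s 2 = C i \<longrightarrow> I (s 3) \<longrightarrow>
     runs body s (s(1 := A (Suc i), 2 := C (Suc i))) b)"

lemma advancesD:
  fixes s :: store
  shows "advances body A C I N b \<Longrightarrow> i < N \<Longrightarrow> s 1 = A i \<Longrightarrow> s 2 = C i \<Longrightarrow> I (s 3) \<Longrightarrow>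
    runs body s (s(1 := A (Suc i), 2 := C (Suc i))) b"
  unfolding advances_def by blast

lemma runs_replicate:
  fixes s :: store
  assumes adv: "advances body A C I N b"
  shows "s 1 = A i \<Longrightarrow> s 2 = C i \<Longrightarrow> I (s 3) \<Longrightarrow> i + a \<le> N \<Longrightarrow>
    runs (seqs (replicate a body)) s (s(1 := A (i + a), 2 := C (i + a))) (a * (b + 1))"
proof (induction a arbitrary: s i)
  case 0
  then have "s(1 := A i, 2 := C i) = s" by (auto simp: fun_eq_iff)
  then have "runs Skip s (s(1 := A i, 2 := C i)) 0" by (simp add: runs_Skip)
  then show ?case by (simp add: fun_upd_def)
next
  case (Suc a)
  let ?s = "s(1 := A (Suc i), 2 := C (Suc i))"
  have 1: "runs body s ?s b" by (rule advancesD[OF adv]) (use Suc.prems in simp_all)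
  have 2: "runs (seqs (replicate a body)) ?s (?s(1 := A (Suc i + a), 2 := C (Suc i + a))) (a * (b + 1))"
    by (rule Suc.IH) (use Suc.prems in simp_all)
  have e: "?s(1 := A (Suc i + a), 2 := C (Suc i + a)) = s(1 := A (i + Suc a), 2 := C (i + Suc a))"
    by (auto simp: fun_eq_iff)
  show ?case using runs_Seq[OF 1 2[unfolded e], of "Suc a * (b + 1)"] by (simp add: fun_upd_def)
qed

lemma runs_poly_loop:
  fixes s :: store
  assumes adv: "advances body A C I N b" and xs: "0 \<notin> set xs" "length xs = n"
  shows "4 \<le> k \<Longrightarrow> s 1 = A i \<Longrightarrow> s 2 = C i \<Longrightarrow> I (s 3) \<Longrightarrow> \<forall>j<length as. s (k + j) = tape_of xs 0 \<Longrightarrow>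
    i + horner as n \<le> N \<Longrightarrow>
    runs (poly_loop as k body) s (s(1 := A (i + horner as n), 2 := C (i + horner as n))) (loop_time as n b)"
proof (induction as arbitrary: k i s)
  case Nil
  then have "s(1 := A i, 2 := C i) = s" by (auto simp: fun_eq_iff)
  then have "runs Skip s (s(1 := A i, 2 := C i)) 0" by (simp add: runs_Skip)
  then show ?case by (simp add: fun_upd_def)
next
  case (Cons a as)
  let ?h = "horner as n"
  let ?s = "s(1 := A (i + a), 2 := C (i + a))"
  \<comment> \<open>All intermediate counts stay below \<open>N\<close>, up to which the body is
    known to work.\<close>
  have le: "i + a + m * ?h \<le> N" if "m \<le> n" for m
    using Cons.prems(6) mult_le_mono1[OF that, of ?h] unfolding horner.simps by linarith
  have 1: "runs (seqs (replicate a body)) s ?s (a * (b + 1))"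
    by (rule runs_replicate[OF adv]) (use Cons.prems le[of 0] in simp_all)
  define S where "S = (\<lambda>m. s(1 := A (i + a + m * ?h), 2 := C (i + a + m * ?h), k := tape_of xs (int m)))"
  have sk: "s k = tape_of xs 0" using Cons.prems(5) by force
  have S0: "S 0 = ?s" using sk Cons.prems(1) by (auto simp: S_def fun_eq_iff)
  have 2: "runs (for_tape k (poly_loop as (Suc k) body)) (S 0) ((S (length xs))(k := tape_of xs 0))
      (n * (loop_time as n b + 4) + 3 * n + 7)"
  proof (rule runs_for_tape)
    fix m assume m: "m < length xs"
    have e: "(S m)(1 := A (i + a + m * ?h + ?h), 2 := C (i + a + m * ?h + ?h)) = (S (Suc m))(k := tape_of xs (int m))"
      using Cons.prems(1) by (auto simp: S_def fun_eq_iff algebra_simps)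
    have "runs (poly_loop as (Suc k) body) (S m)
        ((S m)(1 := A (i + a + m * ?h + ?h), 2 := C (i + a + m * ?h + ?h))) (loop_time as n b)"
    proof (rule Cons.IH)
      show "\<forall>j<length as. S m (Suc k + j) = tape_of xs 0"
        using Cons.prems(1,5) by (force simp: S_def)
      show "i + a + m * ?h + ?h \<le> N" using le[of "Suc m"] m xs(2) by (simp add: algebra_simps)
    qed (use Cons.prems in \<open>simp_all add: S_def\<close>)
    then show "runs (poly_loop as (Suc k) body) (S m) ((S (Suc m))(k := tape_of xs (int m))) (loop_time as n b)"
      unfolding e .
  qed (use xs in \<open>simp_all add: S_def\<close>)
  have e: "(S (length xs))(k := tape_of xs 0) = s(1 := A (i + horner (a # as) n), 2 := C (i + horner (a # as) n))"
    using sk Cons.prems(1) xs(2) by (auto simp: S_def fun_eq_iff algebra_simps)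
  show ?case
    using runs_Seq[OF 1 2[unfolded S0 e], of "loop_time (a # as) n b"] by (simp add: fun_upd_def)
qed

section \<open>Binary counting and the width of the counter\<close>

fun bit_incr :: "bool list \<Rightarrow> bool list" where
  "bit_incr [] = [True]"
| "bit_incr (b # bs) = (if b then False # bit_incr bs else True # bs)"

lemma bits_Suc: "bits (Suc n) = bit_incr (bits n)"
proof (induction n rule: less_induct)
  case (less n)
  show ?case
  proof (cases "n = 0")
    case True
    then show ?thesis by (simp add: bits.simps[of "Suc 0"] bits.simps[of 0])
  next
    case False
    then have b: "bits n = odd n # bits (n div 2)" by (simp add: bits.simps[of n])
    show ?thesis
    proof (cases "odd n")
      case True
      then have "Suc n div 2 = Suc (n div 2)" by presburger
      with True less.IH[of "n div 2"] False b show ?thesis by (simp add: bits.simps[of "Suc n"])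
    next
      case e: False
      then have "Suc n div 2 = n div 2" by presburger
      with e b show ?thesis by (simp add: bits.simps[of "Suc n"])
    qed
  qed
qed

lemma bit_incr_eq: "bit_incr bs = (let k = length (takeWhile (\<lambda>b. b) bs) in replicate k False @ True # drop (Suc k) bs)"
  by (induction bs) (auto simp: Let_def)

text \<open>With \<open>L\<close> binary digits the side \<open>2 ^ L\<close> of the tableau exceeds
  \<open>n\<close> but stays linear in it.\<close>

lemma length_bits:
  "n < 2 ^ length (bits n)" "2 ^ length (bits n) \<le> 2 * n + 1"
proof (induction n rule: less_induct)
  case (less n)
  {
    case 1
    show ?case
    proof (cases "n = 0")
      case False
      with less(1)[of "n div 2"] show ?thesis by (simp add: bits.simps[of n])
    qed simp
  next
    case 2
    show ?case
    proof (cases "n = 0")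
      case True
      then show ?thesis by (simp add: bits.simps[of 0])
    next
      case False
      show ?thesis
      proof (cases "n = 1")
        case True
        then show ?thesis by (simp add: bits.simps[of 1] bits.simps[of 0])
      next
        case n: False
        have "2 ^ length (bits (n div 2)) \<le> 2 * (n div 2) + 1" by (rule less(2)) (use False in simp)
        \<comment> \<open>Parity removes the \<open>+ 1\<close> for the half, so that doubling stays
          within the bound.\<close>
        moreover have "even (2 ^ length (bits (n div 2)) :: nat)"
          using n False by (simp add: bits.simps[of "n div 2"])
        ultimately have "2 ^ length (bits (n div 2)) \<le> 2 * (n div 2)" by presburger
        then show ?thesis using False by (simp add: bits.simps[of n])
      qed
    qed
  }
qed

text \<open>The carry ripples through the leading ones; the next cell becomes a one, whether it
  holds a zero or is the blank behind the word.\<close>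

definition grow :: com where
  "grow = sweep (\<lambda>v. v = 2) ;; Act 2 (\<lambda>_. (2, Stay)) ;; rewind 2"

lemma runs_grow:
  fixes s :: store
  assumes s: "s 2 = tape_of (map bsym bs) 0" and t: "6 * length bs + 20 \<le> t"
  shows "runs grow s (s(2 := tape_of (map bsym (bit_incr bs)) 0)) t"
proof -
  let ?k = "length (takeWhile (\<lambda>b. b) bs)"
  have k: "length (takeWhile (\<lambda>v. v = 2) (map bsym bs)) = ?k"
    by (simp add: takeWhile_map o_def bsym_def)
  have kle: "?k \<le> length bs" by (rule length_takeWhile_le)
  let ?xs = "replicate ?k 1 @ drop ?k (map bsym bs)"
  let ?s = "s(2 := tape_of ?xs (int ?k))"
  have 1: "runs (sweep (\<lambda>v. v = 2)) s ?s (3 * length bs + 1)"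
    using runs_sweep[where s = s and P = "\<lambda>v. v = 2", OF s] unfolding k by simp
  let ?ys = "map bsym (bit_incr bs)"
  have a: "act (2, Stay) (tape_of ?xs (int ?k)) = tape_of ?ys (int ?k)"
  proof (cases "?k < length bs")
    case True
    have "?xs[?k := 2] = ?ys"
      using True swept_update[of ?k "map bsym bs" 1 2] by (simp add: bit_incr_eq Let_def drop_map bsym_def)
    then show ?thesis using True act_tape_of_update[of ?k ?xs 2 Stay] by simp
  next
    case False
    with kle have "?k = length bs" by simp
    then show ?thesis using act_tape_of_append[of 2 Stay ?xs] by (simp add: bit_incr_eq Let_def bsym_def)
  qed
  have 2: "runs (Act 2 (\<lambda>_. (2, Stay))) ?s (s(2 := tape_of ?ys (int ?k))) 1"
    using runs_Act[of 1 2 "\<lambda>_. (2, Stay)" ?s] a by simp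
  have len: "length (bit_incr bs) \<le> Suc (length bs)" "?k \<le> length (bit_incr bs)"
    using kle by (auto simp: bit_incr_eq Let_def)
  have 3: "runs (rewind 2) (s(2 := tape_of ?ys (int ?k))) ((s(2 := tape_of ?ys (int ?k)))(2 := tape_of ?ys 0)) (3 * length ?ys + 5)"
    by (rule runs_rewind[where h = ?k]) (use len in auto)
  show ?thesis
    unfolding grow_def using runs_Seq[OF 1 runs_Seq[OF 2 3 order_refl], of t] t len by simp
qed

text \<open>A binary number becomes a counter at zero; only its length survives.\<close>

definition clear :: com where
  "clear = sweep (\<lambda>v. v \<noteq> 0) ;; rewind 2"

lemma runs_clear:
  fixes s :: store
  assumes s: "s 2 = tape_of xs 0" and xs: "0 \<notin> set xs" and t: "6 * length xs + 10 \<le> t"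
  shows "runs clear s (s(2 := tape_of (replicate (length xs) 1) 0)) t"
proof -
  have k: "takeWhile (\<lambda>v. v \<noteq> 0) xs = xs" unfolding takeWhile_eq_all_conv using xs by metis
  let ?s = "s(2 := tape_of (replicate (length xs) 1) (int (length xs)))"
  have 1: "runs (sweep (\<lambda>v. v \<noteq> 0)) s ?s (3 * length xs + 1)"
    using runs_sweep[where s = s and P = "\<lambda>v. v \<noteq> 0", OF s] unfolding k by simp
  have 2: "runs (rewind 2) ?s (?s(2 := tape_of (replicate (length xs) 1) 0)) (3 * length xs + 5)"
    by (rule runs_rewind[where h = "length xs"]) auto
  show ?thesis unfolding clear_def using runs_Seq[OF 1 2, of t] t by simp
qed

fun copies :: "nat \<Rightarrow> com" where
  "copies 0 = Skip"
| "copies (Suc D) = copies D ;; Act (4 + D) (\<lambda>r. (r 0, Go_Right))"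

fun rewinds :: "nat \<Rightarrow> com" where
  "rewinds 0 = Skip"
| "rewinds (Suc D) = rewinds D ;; rewind (4 + D)"

text \<open>Each level of a nested loop scans a copy of the input of its own.\<close>

definition copy_input :: "nat \<Rightarrow> com" where
  "copy_input D = for_tape 0 (copies D) ;; rewinds D"

definition with_copies :: "nat \<Rightarrow> tape \<Rightarrow> store \<Rightarrow> store" where
  "with_copies D t s = (\<lambda>i. if 4 \<le> i \<and> i < 4 + D then t else s i)"

lemma with_copies_simps [simp]:
  "with_copies 0 t s = s"
  "k < 4 \<Longrightarrow> with_copies D t s k = s k"
  "j < D \<Longrightarrow> with_copies D t s (4 + j) = t"
  by (auto simp: with_copies_def fun_eq_iff)

lemma with_copies_Suc: "with_copies (Suc D) t s = (with_copies D t s)(4 + D := t)"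
  by (auto simp: with_copies_def fun_eq_iff)

lemma runs_copies:
  fixes s :: store
  assumes "s 0 = tape_of xs (int i)" "i < length xs" "\<And>k. k < D \<Longrightarrow> s (4 + k) = tape_of (take i xs) (int i)"
  shows "runs (copies D) s (with_copies D (tape_of (take (Suc i) xs) (int (Suc i))) s) (2 * D)"
  using assms(3)
proof (induction D)
  case 0
  then show ?case by (simp add: runs_Skip)
next
  case (Suc D)
  let ?t = "tape_of (take (Suc i) xs) (int (Suc i))"
  have 1: "runs (copies D) s (with_copies D ?t s) (2 * D)" using Suc by simp
  have "with_copies D ?t s (4 + D) = tape_of (take i xs) (int (length (take i xs)))"
    using Suc.prems[of D] assms(2) by (simp add: with_copies_def)
  then have "act (reads (with_copies D ?t s) 0, Go_Right) (with_copies D ?t s (4 + D)) = ?t"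
    using assms(1,2) act_tape_of_append[of "xs ! i" Go_Right "take i xs"]
    by (simp add: take_Suc_conv_app_nth add.commute)
  then have 2: "runs (Act (4 + D) (\<lambda>r. (r 0, Go_Right))) (with_copies D ?t s) (with_copies (Suc D) ?t s) 1"
    using runs_Act[of 1 "4 + D" "\<lambda>r. (r 0, Go_Right)" "with_copies D ?t s"] by (simp only: with_copies_Suc order_refl)
  show ?case using runs_Seq[OF 1 2, of "2 * Suc D"] by simp
qed

lemma runs_rewinds:
  fixes s :: store
  assumes "0 \<notin> set xs"
  shows "runs (rewinds D) (with_copies D (tape_of xs (int (length xs))) s) (with_copies D (tape_of xs 0) s) (D * (3 * length xs + 6))"
proof -
  have "runs (rewinds d) (with_copies D (tape_of xs (int (length xs))) s)
      (with_copies d (tape_of xs 0) (with_copies D (tape_of xs (int (length xs))) s)) (d * (3 * length xs + 6))" if "d \<le> D" for d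
    using that
  proof (induction d)
    case 0
    then show ?case by (simp add: runs_Skip)
  next
    case (Suc d)
    let ?s = "with_copies d (tape_of xs 0) (with_copies D (tape_of xs (int (length xs))) s)"
    have "runs (rewind (4 + d)) ?s (?s(4 + d := tape_of xs 0)) (3 * length xs + 5)"
      by (rule runs_rewind[where h = "length xs"]) (use assms Suc.prems in \<open>simp_all add: with_copies_def\<close>)
    from runs_Seq[OF Suc.IH this, of "Suc d * (3 * length xs + 6)"] Suc.prems
    show ?case by (simp add: with_copies_Suc fun_upd_def)
  qed
  from this[of D] show ?thesis by (simp add: with_copies_def cong: if_cong)
qed

lemma runs_copy_input:
  fixes s :: store
  assumes s: "s 0 = tape_of xs 0" "\<And>k. k < D \<Longrightarrow> s (4 + k) = tape_of [] 0" and xs: "0 \<notin> set xs"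
    and t: "length xs * (2 * D + 4) + 3 * length xs + 8 + D * (3 * length xs + 6) \<le> t"
  shows "runs (copy_input D) s (with_copies D (tape_of xs 0) s) t"
proof -
  define S where "S = (\<lambda>i. (with_copies D (tape_of (take i xs) (int i)) s)(0 := tape_of xs (int i)))"
  have S0: "S 0 = s"
  proof
    fix i
    show "S 0 i = s i"
      using s(1) s(2)[of "i - 4"] by (cases "4 \<le> i \<and> i < 4 + D") (auto simp: S_def with_copies_def)
  qed
  have 1: "runs (for_tape 0 (copies D)) (S 0) ((S (length xs))(0 := tape_of xs 0)) (length xs * (2 * D + 4) + 3 * length xs + 7)"
  proof (rule runs_for_tape)
    fix i assume i: "i < length xs"
    have e: "with_copies D (tape_of (take (Suc i) xs) (int (Suc i))) (S i) = (S (Suc i))(0 := tape_of xs (int i))"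
    proof
      fix j
      show "with_copies D (tape_of (take (Suc i) xs) (int (Suc i))) (S i) j = ((S (Suc i))(0 := tape_of xs (int i))) j"
        by (cases "j = 0") (simp_all add: S_def with_copies_def)
    qed
    have "S i (4 + k) = tape_of (take i xs) (int i)" if "k < D" for k using that by (simp add: S_def with_copies_def)
    moreover have "S i 0 = tape_of xs (int i)" by (simp add: S_def)
    ultimately show "runs (copies D) (S i) ((S (Suc i))(0 := tape_of xs (int i))) (2 * D)"
      using runs_copies[of "S i" xs i D] i unfolding e by blast
  next
    show "S i 0 = tape_of xs (int i)" for i by (simp add: S_def)
  qed (use xs in simp_all)
  have e: "(S (length xs))(0 := tape_of xs 0) = with_copies D (tape_of xs (int (length xs))) s"
    using s by (auto simp: S_def with_copies_def fun_eq_iff)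
  show ?thesis
    unfolding copy_input_def using runs_Seq[OF 1[unfolded S0 e] runs_rewinds[OF xs], of t] t by simp
qed


section \<open>Writing the instance\<close>

lemma enc_nat_bits: "enc_nat n = concat (map (\<lambda>b. [True, b]) (bits n)) @ [False]"
  by (simp add: enc_nat_def enc_list_def)

text \<open>A positive \<open>c\<close> keeps the zeros at the upper end of the word from being
  dropped as leading zeros.\<close>

lemma bits_word:
  assumes "0 < c"
  shows "w \<in> words 4 L \<Longrightarrow> bits (val 4 w + 4 ^ L * c) = concat (map (\<lambda>e. [odd e, odd (e div 2)]) w) @ bits c"
proof (induction L arbitrary: w)
  case (Suc L)
  then obtain d v where w: "w = d # v" "d < 4" "v \<in> words 4 L" by (auto simp: words_Suc)
  let ?m = "val 4 v + 4 ^ L * c"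
  have m: "0 < ?m" using assms by simp
  have e: "val 4 w + 4 ^ Suc L * c = d + 4 * ?m" by (simp add: w algebra_simps)
  have d: "odd (d + 4 * ?m) = odd d" "(d + 4 * ?m) div 2 = d div 2 + 2 * ?m" by simp_all
  have d2: "odd (d div 2 + 2 * ?m) = odd (d div 2)" "(d div 2 + 2 * ?m) div 2 = ?m" using w(2) by simp_all
  have nz: "d + 4 * ?m \<noteq> 0" "d div 2 + 2 * ?m \<noteq> 0" using m by simp_all
  have "bits (d + 4 * ?m) = odd d # odd (d div 2) # bits ?m"
    using bits.simps[of "d + 4 * ?m"] bits.simps[of "d div 2 + 2 * ?m"] nz by (simp only: d d2 if_False)
  with Suc.IH[OF w(3)] show ?case unfolding e by (simp add: w(1))
qed simp

lemma bits_shift: "0 < c \<Longrightarrow> bits (c * 2 ^ n) = replicate n False @ bits c"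
proof (induction n)
  case (Suc n)
  then show ?case using bits.simps[of "c * 2 ^ Suc n"] by simp
qed simp

lemma enc_rat_of_nat: "enc_rat (of_nat n) = enc_nat n @ enc_nat 1"
proof -
  have "quotient_of (of_nat n :: rat) = (int n, 1)"
    using quotient_of_int[of "int n"] by (simp add: Rat.of_int_def)
  then show ?thesis by (simp add: enc_rat_def One_nat_def)
qed

text \<open>Each digit of a cell yields two bits, and \<open>enc_list\<close> puts
  \<open>True\<close> before every bit.\<close>

definition item_digits :: "bool \<Rightarrow> (nat \<Rightarrow> bool) list" where
  "item_digits sel = [\<lambda>_. True, \<lambda>d. odd (if sel then d div 4 else d mod 4),
     \<lambda>_. True, \<lambda>d. odd ((if sel then d div 4 else d mod 4) div 2)]"

definition item_com :: "bool \<times> nat \<Rightarrow> com" where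
  "item_com p = emit [True, True] ;; digits_emit (item_digits (fst p)) ;;
     emit (concat (map (\<lambda>b. [True, b]) (bits (snd p))) @ [False, False])"

definition person_com :: "person \<Rightarrow> com" where
  "person_com us = emit [True] ;; seqs (map item_com us) ;; emit [False]"

definition block_com :: "person list \<Rightarrow> com" where
  "block_com tm = seqs (map person_com tm)"

definition item_bits :: "nat list \<Rightarrow> bool \<times> nat \<Rightarrow> bool list" where
  "item_bits ds p = [True, True] @ concat (map (\<lambda>d. map (\<lambda>g. g d) (item_digits (fst p))) ds) @
     (concat (map (\<lambda>b. [True, b]) (bits (snd p))) @ [False, False])"

definition person_bits :: "nat list \<Rightarrow> person \<Rightarrow> bool list" where
  "person_bits ds us = [True] @ concat (map (item_bits ds) us) @ [False]"

definition block_bits :: "person list \<Rightarrow> nat list \<Rightarrow> bool list" where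
  "block_bits tm ds = concat (map (person_bits ds) tm)"

lemma emits_Seq_ex: "\<exists>b. emits I a f b \<Longrightarrow> \<exists>b. emits I c g b \<Longrightarrow> \<exists>b. emits I (a ;; c) (\<lambda>ds. f ds @ g ds) b"
  using emits_Seq by blast

lemma emits_item: "\<exists>b. emits I (item_com p) (\<lambda>ds. item_bits ds p) b"
  unfolding item_com_def item_bits_def by (intro emits_Seq_ex emits_emit emits_digits_emit)

lemma emits_person: "\<exists>b. emits I (person_com us) (\<lambda>ds. person_bits ds us) b"
  unfolding person_com_def person_bits_def
  by (intro emits_Seq_ex emits_emit emits_seqs[where f = "\<lambda>p ds. item_bits ds p"] emits_item)

lemma emits_block: "\<exists>b. emits I (block_com tm) (block_bits tm) b"
  unfolding block_com_def block_bits_def by (intro emits_seqs[where f = "\<lambda>us ds. person_bits ds us"] emits_person)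

lemma item_bits_eq:
  assumes "ds \<in> words 16 L" "0 < c"
  shows "item_bits ds (sel, c) = True # enc_list enc_nat [index sel ds c]"
proof -
  have len: "length ds = L" using assms(1) by (simp add: words_def)
  have "bits (index sel ds c) = concat (map (\<lambda>e. [odd e, odd (e div 2)]) (cell sel ds)) @ bits c"
    unfolding index_def len by (rule bits_word[OF assms(2) cell_words[OF assms(1)]])
  then have "enc_nat (index sel ds c) = concat (map (\<lambda>b. [True, b]) (concat (map (\<lambda>e. [odd e, odd (e div 2)]) (cell sel ds)))) @
      concat (map (\<lambda>b. [True, b]) (bits c)) @ [False]"
    by (simp add: enc_nat_bits)
  moreover have "concat (map (\<lambda>b. [True, b]) (concat (map (\<lambda>e. [odd e, odd (e div 2)]) (cell sel ds)))) =
      concat (map (\<lambda>d. map (\<lambda>g. g d) (item_digits sel)) ds)"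
    by (induction ds) (auto simp: cell_def item_digits_def)
  ultimately show ?thesis by (simp add: item_bits_def)
qed

lemma person_bits_eq:
  assumes "ds \<in> words 16 L" "\<forall>p \<in> set us. 0 < snd p"
  shows "person_bits ds us = True # enc_list (enc_list enc_nat) (strict_pref (map (\<lambda>(sel, c). index sel ds c) us))"
proof -
  have "concat (map (item_bits ds) us) @ [False] = enc_list (enc_list enc_nat) (strict_pref (map (\<lambda>(sel, c). index sel ds c) us))"
    using assms(2)
  proof (induction us)
    case Nil
    then show ?case by (simp add: strict_pref_def)
  next
    case (Cons p us)
    obtain sel c where p: "p = (sel, c)" by fastforce
    with Cons.prems item_bits_eq[OF assms(1), of c sel]
    have "item_bits ds p = True # enc_list enc_nat [index sel ds c]" by simp
    moreover have "concat (map (item_bits ds) us) @ [False] = enc_list (enc_list enc_nat) (strict_pref (map (\<lambda>(sel, c). index sel ds c) us))"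
      using Cons by simp
    ultimately show ?case by (simp add: strict_pref_def p)
  qed
  then show ?thesis by (simp add: person_bits_def)
qed

lemma block_bits_eq:
  assumes "ds \<in> words 16 L" "\<forall>us \<in> set tm. \<forall>p \<in> set us. 0 < snd p"
  shows "block_bits tm ds = concat (map (\<lambda>us. True # enc_list (enc_list enc_nat) (strict_pref us)) (inst ds tm))"
  using assms(2)
proof (induction tm)
  case (Cons us tm)
  then show ?case using person_bits_eq[OF assms(1), of us] by (simp add: block_bits_def inst_def)
qed (simp add: block_bits_def inst_def)

text \<open>The standard store between two stages: counter at zero, automaton tape blank, loop tapes
  rewound. Since it depends on nothing but the output so far, stages can be chained freely.\<close>

definition base :: "nat list \<Rightarrow> nat \<Rightarrow> nat \<Rightarrow> bool list \<Rightarrow> store" where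
  "base xs D L out = (\<lambda>i. if i = 0 \<or> 4 \<le> i \<and> i < 4 + D then tape_of xs 0 else if i = 1 then outp out
     else if i = 2 then tape_of (replicate L 1) 0 else tape_of [] 0)"

definition stage :: "nat list \<Rightarrow> nat \<Rightarrow> nat \<Rightarrow> com \<Rightarrow> bool list \<Rightarrow> nat \<Rightarrow> bool" where
  "stage xs D L c f t \<longleftrightarrow> (\<forall>out. runs c (base xs D L out) (base xs D L (out @ f)) t)"

lemma base_simps [simp]:
  "base xs D L out 0 = tape_of xs 0" "base xs D L out 1 = outp out"
  "base xs D L out 2 = tape_of (map Suc (digits B L 0)) 0" "base xs D L out 3 = tape_of [] 0"
  "j < D \<Longrightarrow> base xs D L out (4 + j) = tape_of xs 0"
  by (simp_all add: base_def digits_0)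

lemma base_upd:
  "(base xs D L out)(1 := outp out') = base xs D L out'"
  "(base xs D L out)(2 := tape_of (map Suc (digits B L 0)) 0) = base xs D L out"
  by (auto simp: base_def digits_0 fun_eq_iff)

lemma stage_Seq:
  assumes "stage xs D L a f t1" "stage xs D L c g t2" "t1 + t2 + 1 \<le> t"
  shows "stage xs D L (a ;; c) (f @ g) t"
  unfolding stage_def
proof
  fix out
  have "runs a (base xs D L out) (base xs D L (out @ f)) t1" using assms(1) by (simp add: stage_def)
  moreover have "runs c (base xs D L (out @ f)) (base xs D L (out @ f @ g)) t2"
    using assms(2) unfolding stage_def by (metis append_assoc)
  ultimately show "runs (a ;; c) (base xs D L out) (base xs D L (out @ f @ g)) t"
    by (rule runs_Seq) (rule assms(3))
qed

lemma stage_seqs: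
  assumes "\<And>c. c \<in> set cs \<Longrightarrow> stage xs D L (P c) (f c) t"
  shows "stage xs D L (seqs (map P cs)) (concat (map f cs)) (length cs * (t + 1))"
  using assms
proof (induction cs)
  case Nil
  then show ?case by (simp add: stage_def runs_Skip)
next
  case (Cons c cs)
  have "stage xs D L (P c ;; seqs (map P cs)) (f c @ concat (map f cs)) (length (c # cs) * (t + 1))"
    by (rule stage_Seq[of _ _ _ _ _ t _ _ "length cs * (t + 1)"]) (use Cons in simp_all)
  then show ?case by simp
qed

lemma stage_emits:
  assumes "emits I c f b" "I (tape_of [] 0)" "b * (L + 1) \<le> t"
  shows "stage xs D L c (f (digits B L 0)) t"
  unfolding stage_def
proof
  fix out
  have "runs c (base xs D L out) ((base xs D L out)(1 := outp (out @ f (digits B L 0)))) t"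
    by (rule emitsD[OF assms(1)]) (use assms in simp_all)
  then show "runs c (base xs D L out) (base xs D L (out @ f (digits B L 0))) t" by (simp only: base_upd)
qed

lemma stage_odo:
  assumes "emits I c f b" "I (tape_of [] 0)" "0 < B" "(B ^ L + 1) * ((b + 20) * (L + 1)) \<le> t"
  shows "stage xs D L (odo B c) (concat (map (\<lambda>j. f (digits B L j)) [0..<B ^ L])) t"
  unfolding stage_def
proof
  fix out
  have "runs (odo B c) (base xs D L out) ((base xs D L out)(1 := outp (out @ concat (map (\<lambda>j. f (digits B L j)) [0..<B ^ L])),
    2 := tape_of (map Suc (digits B L 0)) 0)) t"
    by (rule runs_odo[OF assms(1,3)]) (use assms in simp_all)
  then show "runs (odo B c) (base xs D L out) (base xs D L (out @ concat (map (\<lambda>j. f (digits B L j)) [0..<B ^ L]))) t"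
    by (simp only: base_upd)
qed

definition next_col :: "com \<Rightarrow> com" where
  "next_col body = body ;; inc 2 ;; rewind 2"

lemma runs_next_col:
  fixes s :: store
  assumes body: "runs body s (s(1 := o')) (b * (L + 1))" and s: "s 2 = tape_of (map Suc (digits 2 L i)) 0"
  shows "runs (next_col body) s (s(1 := o', 2 := tape_of (map Suc (digits 2 L (Suc i))) 0)) ((b + 20) * (L + 1))"
proof -
  have digits_below: "set (digits 2 L i) \<subseteq> {..<2}" using digits_words[of 2 L i] by (simp add: words_def)
  let ?s = "(s(1 := o'))(2 := tape_of (map Suc (digits 2 L (Suc i))) (int (carry 2 (digits 2 L i))))"
  have 2: "runs (inc 2) (s(1 := o')) ?s (3 * L + 5)"
    using runs_inc[of "s(1 := o')" "digits 2 L i" 2 "3 * L + 5"] s digits_below by (simp add: incr_digits)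
  have 3: "runs (rewind 2) ?s (?s(2 := tape_of (map Suc (digits 2 L (Suc i))) 0)) (3 * L + 5)"
    by (rule runs_rewind[where h = "carry 2 (digits 2 L i)"]) (use carry_le[of 2 "digits 2 L i"] in auto)
  have e: "?s(2 := tape_of (map Suc (digits 2 L (Suc i))) 0) = s(1 := o', 2 := tape_of (map Suc (digits 2 L (Suc i))) 0)" by simp
  show ?thesis
    unfolding next_col_def by (rule runs_Seq[OF body runs_Seq[OF 2 3[unfolded e] order_refl]]) (simp add: algebra_simps)
qed

text \<open>After the first \<open>k\<close> columns the odometer continues from the counter value
  \<open>k\<close> to the end of the row and leaves the counter at zero.\<close>

lemma stage_rest:
  assumes k: "k < 2 ^ L"
    and c: "\<And>out. runs c (base xs D L out)
      ((base xs D L out)(1 := outp (out @ concat (map (\<lambda>j. f j (digits 2 L j)) [0..<k])), 2 := tape_of (map Suc (digits 2 L k)) 0)) t"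
    and b: "emits (\<lambda>_. True) E g b" "t + (2 ^ L + 1) * ((b + 20) * (L + 1)) + 1 \<le> t'"
  shows "stage xs D L (c ;; odo 2 E) (concat (map (\<lambda>j. (if j < k then f j else g) (digits 2 L j)) [0..<2 ^ L])) t'"
  unfolding stage_def
proof
  fix out
  let ?o = "out @ concat (map (\<lambda>j. f j (digits 2 L j)) [0..<k])"
  let ?s = "(base xs D L out)(1 := outp ?o, 2 := tape_of (map Suc (digits 2 L k)) 0)"
  have "runs (odo 2 E) ?s (?s(1 := outp (?o @ concat (map (\<lambda>j. g (digits 2 L j)) [k..<2 ^ L])),
    2 := tape_of (map Suc (digits 2 L 0)) 0)) ((2 ^ L + 1) * ((b + 20) * (L + 1)))"
    by (rule runs_odo[OF b(1) _ _ _ _ k]) simp_all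
  moreover have "?s(1 := outp (?o @ concat (map (\<lambda>j. g (digits 2 L j)) [k..<2 ^ L])), 2 := tape_of (map Suc (digits 2 L 0)) 0) =
      base xs D L (out @ concat (map (\<lambda>j. (if j < k then f j else g) (digits 2 L j)) [0..<2 ^ L]))"
  proof -
    have "[0..<2 ^ L] = [0..<k] @ [k..<2 ^ L]" using k upt_add_eq_append[of 0 k "2 ^ L - k"] by simp
    then have "concat (map (\<lambda>j. (if j < k then f j else g) (digits 2 L j)) [0..<2 ^ L]) =
        concat (map (\<lambda>j. f j (digits 2 L j)) [0..<k]) @ concat (map (\<lambda>j. g (digits 2 L j)) [k..<2 ^ L])"
      by (auto intro!: arg_cong[of _ _ concat] map_cong arg_cong2[of _ _ _ _ "(@)"])
    then show ?thesis by (simp add: base_upd fun_upd_twist)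
  qed
  ultimately have "runs (odo 2 E) ?s (base xs D L (out @ concat (map (\<lambda>j. (if j < k then f j else g) (digits 2 L j)) [0..<2 ^ L])))
      ((2 ^ L + 1) * ((b + 20) * (L + 1)))" by simp
  from runs_Seq[OF c this b(2)]
  show "runs (c ;; odo 2 E) (base xs D L out)
      (base xs D L (out @ concat (map (\<lambda>j. (if j < k then f j else g) (digits 2 L j)) [0..<2 ^ L]))) t'" .
qed

text \<open>The threshold is never written down: the coefficients in \<open>cs\<close> make the
  nested loops treat exactly that many columns.\<close>

definition count_pass :: "nat list \<Rightarrow> com \<Rightarrow> com \<Rightarrow> com" where
  "count_pass cs E E' = poly_loop cs 4 (next_col E) ;; odo 2 E'"

lemma stage_count_pass:
  assumes E: "emits (\<lambda>_. True) E g b" and E': "emits (\<lambda>_. True) E' g' b'"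
    and k: "horner cs (length xs) < 2 ^ L" and D: "length cs \<le> D" and xs: "0 \<notin> set xs"
    and t: "loop_time cs (length xs) ((b + 20) * (L + 1)) + (2 ^ L + 1) * ((b' + 20) * (L + 1)) + 1 \<le> t"
  shows "stage xs D L (count_pass cs E E')
    (concat (map (\<lambda>j. (if j < horner cs (length xs) then g else g') (digits 2 L j)) [0..<2 ^ L])) t"
proof -
  let ?k = "horner cs (length xs)"
  have R: "runs (poly_loop cs 4 (next_col E)) (base xs D L out)
      ((base xs D L out)(1 := outp (out @ concat (map (\<lambda>j. g (digits 2 L j)) [0..<?k])), 2 := tape_of (map Suc (digits 2 L ?k)) 0))
      (loop_time cs (length xs) ((b + 20) * (L + 1)))" for out
  proof -
    define A where "A = (\<lambda>i. outp (out @ concat (map (\<lambda>j. g (digits 2 L j)) [0..<i])))"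
    define C where "C = (\<lambda>i. tape_of (map Suc (digits 2 L i)) 0)"
    have adv: "advances (next_col E) A C (\<lambda>_. True) ?k ((b + 20) * (L + 1))"
      unfolding advances_def
    proof (intro allI impI)
      fix s :: store and i assume s: "s 1 = A i" "s 2 = C i"
      have "runs E s (s(1 := outp ((out @ concat (map (\<lambda>j. g (digits 2 L j)) [0..<i])) @ g (digits 2 L i)))) (b * (L + 1))"
        by (rule emitsD[OF E]) (use s in \<open>simp_all add: A_def C_def\<close>)
      from runs_next_col[OF this] s
      show "runs (next_col E) s (s(1 := A (Suc i), 2 := C (Suc i))) ((b + 20) * (L + 1))" by (simp add: A_def C_def)
    qed
    have "runs (poly_loop cs 4 (next_col E)) (base xs D L out)
        ((base xs D L out)(1 := A (0 + ?k), 2 := C (0 + ?k))) (loop_time cs (length xs) ((b + 20) * (L + 1)))"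
      by (rule runs_poly_loop[OF adv xs refl]) (use D in \<open>simp_all add: A_def C_def\<close>)
    then show ?thesis by (simp add: A_def C_def)
  qed
  show ?thesis
    unfolding count_pass_def by (rule stage_rest[where f = "\<lambda>_. g", OF k R E' t])
qed

text \<open>The argument of \<open>E\<close> is the symbol in the cell: 1 and 2 along the input,
  then the blank 0.\<close>

definition input_pass :: "(nat \<Rightarrow> com) \<Rightarrow> com" where
  "input_pass E = for_tape 0 (next_col (Cond (\<lambda>r. r 0 = 1) (E 1) (E 2))) ;; odo 2 (E 0)"

lemma stage_input_pass:
  assumes E: "\<And>v. emits (\<lambda>_. True) (E v) (g v) b"
    and k: "length x < 2 ^ L"
    and t: "length x * ((b + 21) * (L + 1) + 4) + 3 * length x + 7 + (2 ^ L + 1) * ((b + 20) * (L + 1)) + 1 \<le> t"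
  shows "stage (map bsym x) D L (input_pass E)
    (concat (map (\<lambda>j. g (contents_of x (int j)) (digits 2 L j)) [0..<2 ^ L])) t"
proof -
  let ?xs = "map bsym x" and ?n = "length x"
  let ?f = "\<lambda>j. g (bsym (x ! j))"
  let ?c = "next_col (Cond (\<lambda>r. r 0 = 1) (E 1) (E 2))"
  have R: "runs (for_tape 0 ?c) (base ?xs D L out)
      ((base ?xs D L out)(1 := outp (out @ concat (map (\<lambda>j. ?f j (digits 2 L j)) [0..<?n])), 2 := tape_of (map Suc (digits 2 L ?n)) 0))
      (?n * ((b + 21) * (L + 1) + 4) + 3 * ?n + 7)" for out
  proof -
    define A where "A = (\<lambda>i. outp (out @ concat (map (\<lambda>j. ?f j (digits 2 L j)) [0..<i])))"
    define S where "S = (\<lambda>i. (base ?xs D L out)(1 := A i, 2 := tape_of (map Suc (digits 2 L i)) 0, 0 := tape_of ?xs (int i)))"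
    have S0: "S 0 = base ?xs D L out" by (auto simp: S_def A_def fun_eq_iff base_simps(3)[where B = 2])
    have "runs (for_tape 0 ?c) (S 0) ((S (length ?xs))(0 := tape_of ?xs 0)) (?n * ((b + 21) * (L + 1) + 4) + 3 * ?n + 7)"
    proof (rule runs_for_tape)
      fix i assume "i < length ?xs"
      then have i: "i < ?n" by simp
      have r: "reads (S i) 0 = bsym (x ! i)" using i by (simp add: S_def)
      have "runs (if reads (S i) 0 = 1 then E 1 else E 2) (S i)
          ((S i)(1 := outp ((out @ concat (map (\<lambda>j. ?f j (digits 2 L j)) [0..<i])) @ ?f i (digits 2 L i)))) (b * (L + 1))"
      proof -
        have "runs (E (bsym (x ! i))) (S i)
            ((S i)(1 := outp ((out @ concat (map (\<lambda>j. ?f j (digits 2 L j)) [0..<i])) @ ?f i (digits 2 L i)))) (b * (L + 1))"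
          by (rule emitsD[OF E]) (simp_all add: S_def A_def)
        then show ?thesis unfolding r by (cases "x ! i") (simp_all add: bsym_def)
      qed
      then have "runs (Cond (\<lambda>r. r 0 = 1) (E 1) (E 2)) (S i)
          ((S i)(1 := outp ((out @ concat (map (\<lambda>j. ?f j (digits 2 L j)) [0..<i])) @ ?f i (digits 2 L i)))) ((b + 1) * (L + 1))"
        by (rule runs_Cond) (simp add: algebra_simps)
      from runs_next_col[OF this, of i]
      have "runs ?c (S i) ((S i)(1 := outp ((out @ concat (map (\<lambda>j. ?f j (digits 2 L j)) [0..<i])) @ ?f i (digits 2 L i)),
          2 := tape_of (map Suc (digits 2 L (Suc i))) 0)) ((b + 1 + 20) * (L + 1))"
        by (simp add: S_def)
      moreover have "(S i)(1 := outp ((out @ concat (map (\<lambda>j. ?f j (digits 2 L j)) [0..<i])) @ ?f i (digits 2 L i)),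
          2 := tape_of (map Suc (digits 2 L (Suc i))) 0) = (S (Suc i))(0 := tape_of ?xs (int i))"
        by (auto simp: S_def A_def fun_eq_iff)
      ultimately show "runs ?c (S i) ((S (Suc i))(0 := tape_of ?xs (int i))) ((b + 21) * (L + 1))" by (simp add: add.assoc)
    next
      show "S i 0 = tape_of ?xs (int i)" for i by (simp add: S_def)
    qed auto
    moreover have "(S (length ?xs))(0 := tape_of ?xs 0) =
        (base ?xs D L out)(1 := outp (out @ concat (map (\<lambda>j. ?f j (digits 2 L j)) [0..<?n])), 2 := tape_of (map Suc (digits 2 L ?n)) 0)"
      by (auto simp: S_def A_def fun_eq_iff)
    ultimately show ?thesis unfolding S0 by simp
  qed
  have "stage ?xs D L (input_pass E) (concat (map (\<lambda>j. (if j < ?n then ?f j else g 0) (digits 2 L j)) [0..<2 ^ L])) t"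
    unfolding input_pass_def by (rule stage_rest[where f = ?f, OF k R E t])
  moreover have "(if j < ?n then ?f j else g 0) = g (contents_of x (int j))" for j
    by (auto simp: contents_of_def bsym_def)
  ultimately show ?thesis by simp
qed

text \<open>The width of the counter is found by counting up to the value of a polynomial in binary
  and then resetting all digits.\<close>

definition prepare :: "nat \<Rightarrow> nat list \<Rightarrow> com" where
  "prepare D cs = copy_input D ;; poly_loop cs 4 grow ;; clear"

lemma runs_prepare:
  fixes x :: "bool list" and cs :: "nat list"
  defines "n \<equiv> length x" and "N \<equiv> horner cs (length x)" and "L \<equiv> length (bits (horner cs (length x)))"
  assumes D: "length cs \<le> D"
    and t: "n * (2 * D + 4) + 3 * n + 8 + D * (3 * n + 6) + loop_time cs n (6 * N + 20) + 6 * L + 12 \<le> t"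
  shows "runs (prepare D cs) (initial_store x) (base (map bsym x) D L []) t"
proof -
  let ?xs = "map bsym x"
  let ?s = "with_copies D (tape_of ?xs 0) (initial_store x)"
  have init: "initial_store x 0 = tape_of ?xs 0" "i \<noteq> 0 \<Longrightarrow> initial_store x i = tape_of [] 0" for i
    unfolding initial_store_def contents_of_tape_of by simp_all
  have 1: "runs (copy_input D) (initial_store x) ?s (n * (2 * D + 4) + 3 * n + 8 + D * (3 * n + 6))"
    by (rule runs_copy_input) (use init in \<open>auto simp: n_def\<close>)
  have lenle: "length (bits i) \<le> i" for i
  proof (induction i)
    case 0
    then show ?case by (simp add: bits.simps[of 0])
  next
    case (Suc i)
    have "length (bit_incr bs) \<le> Suc (length bs)" for bs
      using length_takeWhile_le[of "\<lambda>b. b" bs] by (auto simp: bit_incr_eq Let_def)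
    from le_trans[OF this] Suc show ?case by (simp add: bits_Suc)
  qed
  define A where "A = (\<lambda>_ :: nat. outp [])"
  define C where "C = (\<lambda>i. tape_of (map bsym (bits i)) 0)"
  have adv: "advances grow A C (\<lambda>_. True) N (6 * N + 20)"
    unfolding advances_def
  proof (intro allI impI)
    fix s :: store and i assume i: "i < N" and s: "s 1 = A i" "s 2 = C i"
    have "runs grow s (s(2 := tape_of (map bsym (bit_incr (bits i))) 0)) (6 * N + 20)"
      by (rule runs_grow) (use s lenle[of i] i in \<open>auto simp: C_def\<close>)
    moreover have "s(2 := tape_of (map bsym (bit_incr (bits i))) 0) = s(1 := A (Suc i), 2 := C (Suc i))"
      using s by (auto simp: A_def C_def bits_Suc fun_eq_iff)
    ultimately show "runs grow s (s(1 := A (Suc i), 2 := C (Suc i))) (6 * N + 20)" by simp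
  qed
  let ?s2 = "?s(1 := A (0 + horner cs n), 2 := C (0 + horner cs n))"
  have 2: "runs (poly_loop cs 4 grow) ?s ?s2 (loop_time cs n (6 * N + 20))"
    by (rule runs_poly_loop[OF adv, of ?xs])
      (use D init(2) in \<open>auto simp: n_def N_def A_def C_def outp_def bits.simps[of 0]\<close>)
  have e: "?s2(2 := tape_of (replicate (length (map bsym (bits N))) 1) 0) = base ?xs D L []"
    using init by (auto simp: base_def with_copies_def A_def outp_def L_def N_def fun_eq_iff)
  have "runs clear ?s2 (?s2(2 := tape_of (replicate (length (map bsym (bits N))) 1) 0)) (6 * L + 10)"
    by (rule runs_clear) (auto simp: C_def n_def N_def L_def)
  then have 3: "runs clear ?s2 (base ?xs D L []) (6 * L + 10)" unfolding e .
  show ?thesis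
    unfolding prepare_def by (rule runs_Seq[OF 1 runs_Seq[OF 2 3 order_refl]]) (use t in simp)
qed


section \<open>The reduction\<close>

lemma local_read: "k < K \<Longrightarrow> local K (\<lambda>r. f (r k))"
  unfolding local_def by simp

lemma local_read2: "k < K \<Longrightarrow> j < K \<Longrightarrow> local K (\<lambda>r. f (r k) (r j))"
  unfolding local_def by simp

lemma local_const: "local K (\<lambda>_. a)"
  unfolding local_def by simp

lemma writes_below_const: "a < m \<Longrightarrow> writes_below K m (\<lambda>_. (a, d))"
  unfolding writes_below_def by simp

lemma writes_below_read: "(\<And>v. v < m \<Longrightarrow> f v < m) \<Longrightarrow> k < K \<Longrightarrow> writes_below K m (\<lambda>r. (f (r k), d))"
  unfolding writes_below_def by simp

lemma writes_below_any: "(\<And>v w. f v w < m) \<Longrightarrow> writes_below K m (\<lambda>r. (f (r k) (r j), d))"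
  unfolding writes_below_def by simp

lemma wf_mv: "k < K \<Longrightarrow> wf_com K m (mv k d)"
  unfolding mv_def wf_com.simps
  by (intro conjI local_read[where f = "\<lambda>v. (v, d)"] writes_below_read[where f = "\<lambda>v. v"])

lemma wf_rewind: "k < K \<Longrightarrow> wf_com K m (rewind k)"
  unfolding rewind_def wf_com.simps by (intro conjI wf_mv local_read[where f = "\<lambda>v. v \<noteq> 0"])

lemma wf_seqs: "(\<And>c. c \<in> set cs \<Longrightarrow> wf_com K m c) \<Longrightarrow> wf_com K m (seqs cs)"
  by (induction cs) simp_all

lemma bsym_less: "3 \<le> m \<Longrightarrow> bsym b < m"
  by (simp add: bsym_def)

lemma wf_emit: "1 < K \<Longrightarrow> 3 \<le> m \<Longrightarrow> wf_com K m (emit bs)"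
  unfolding emit_def by (auto intro!: wf_seqs local_const writes_below_const bsym_less)

lemma wf_digits_emit:
  assumes "2 < K" "3 \<le> m"
  shows "wf_com K m (digits_emit gs)"
proof -
  have "wf_com K m (digit_emit gs)"
    unfolding digit_emit_def
  proof (rule wf_seqs)
    fix c assume "c \<in> set (map (\<lambda>g. Act 1 (\<lambda>r. (bsym (g (r 2 - 1)), Go_Right))) gs)"
    then obtain g where c: "c = Act 1 (\<lambda>r. (bsym (g (r 2 - 1)), Go_Right))" by auto
    have "local K (\<lambda>r. (bsym (g (r 2 - 1)), Go_Right))"
      by (rule local_read[where f = "\<lambda>v. (bsym (g (v - 1)), Go_Right)"]) (use assms in simp)
    moreover have "writes_below K m (\<lambda>r. (bsym (g (r 2 - 1)), Go_Right))"
      by (rule writes_below_read[where f = "\<lambda>v. bsym (g (v - 1))"]) (use assms bsym_less in auto)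
    ultimately show "wf_com K m c" using assms unfolding c by simp
  qed
  then show ?thesis
    using assms unfolding digits_emit_def wf_com.simps
    by (intro conjI wf_rewind wf_mv local_read[where f = "\<lambda>v. v \<noteq> 0"]) auto
qed

lemma wf_sweep: "2 < K \<Longrightarrow> 1 < m \<Longrightarrow> wf_com K m (sweep P)"
  unfolding sweep_def wf_com.simps by (intro conjI local_read local_const writes_below_const)

lemma wf_inc:
  assumes "2 < K" "B < m" "1 < m"
  shows "wf_com K m (inc B)"
proof -
  have "local K (\<lambda>r. (if r 2 < B then Suc (r 2) else 1, Stay))"
    by (rule local_read[where f = "\<lambda>v. (if v < B then Suc v else 1, Stay)"]) (rule assms(1))
  moreover have "writes_below K m (\<lambda>r. (if r 2 < B then Suc (r 2) else 1, Stay))"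
    by (rule writes_below_read[where f = "\<lambda>v. if v < B then Suc v else 1"]) (use assms in auto)
  ultimately show ?thesis
    unfolding inc_def wf_com.simps
    using assms by (intro conjI wf_sweep local_read[where f = "\<lambda>v. v = 0"]) auto
qed

lemma wf_odo: "2 < K \<Longrightarrow> B < m \<Longrightarrow> 1 < m \<Longrightarrow> wf_com K m c \<Longrightarrow> wf_com K m (odo B c)"
  unfolding odo_def wf_com.simps by (intro conjI wf_inc wf_rewind local_read[where f = "\<lambda>v. v \<noteq> 0"])

lemma wf_branch: "3 < K \<Longrightarrow> (\<And>z. z < n \<Longrightarrow> wf_com K m (P z)) \<Longrightarrow> wf_com K m (branch n P)"
proof (induction n)
  case (Suc n)
  then show ?case by (simp add: local_read[where f = "\<lambda>v. v = n"])
qed simp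

lemma wf_classify:
  assumes "3 < K" "z0 < m" "\<And>z d. dl z d < m" "\<And>z. z < n \<Longrightarrow> wf_com K m (P z)" "0 < m"
  shows "wf_com K m (classify n dl z0 P)"
  unfolding classify_def wf_com.simps
  using assms
  by (intro conjI wf_branch wf_rewind wf_mv local_const writes_below_const local_read[where f = "\<lambda>v. v \<noteq> 0"]
      local_read2[where f = "\<lambda>v w. (dl v (w - 1), Stay)"] writes_below_any[where f = "\<lambda>v w. dl v (w - 1)"]) auto

lemma wf_for_tape: "k < K \<Longrightarrow> wf_com K m c \<Longrightarrow> wf_com K m (for_tape k c)"
  unfolding for_tape_def wf_com.simps by (intro conjI wf_mv wf_rewind local_read[where f = "\<lambda>v. v \<noteq> 0"])

lemma wf_poly_loop: "k + length cs \<le> K \<Longrightarrow> wf_com K m c \<Longrightarrow> wf_com K m (poly_loop cs k c)"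
  by (induction cs arbitrary: k) (auto intro!: wf_for_tape wf_seqs)

lemma wf_grow: "2 < K \<Longrightarrow> 3 \<le> m \<Longrightarrow> wf_com K m grow"
  unfolding grow_def wf_com.simps by (intro conjI wf_sweep wf_rewind local_const writes_below_const) auto

lemma wf_clear: "2 < K \<Longrightarrow> 3 \<le> m \<Longrightarrow> wf_com K m clear"
  unfolding clear_def wf_com.simps by (intro conjI wf_sweep wf_rewind) auto

lemma wf_copy_input:
  assumes "4 + D \<le> K"
  shows "wf_com K m (copy_input D)"
proof -
  have "wf_com K m (copies d)" if "d \<le> D" for d
    using that
  proof (induction d)
    case (Suc d)
    have "local K (\<lambda>r. (r 0, Go_Right))" using local_read[where f = "\<lambda>v. (v, Go_Right)"] assms by simp
    moreover have "writes_below K m (\<lambda>r. (r 0, Go_Right))"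
      using writes_below_read[where f = "\<lambda>v. v" and k = 0] assms by simp
    ultimately show ?case using Suc assms by simp
  qed simp
  moreover have "wf_com K m (rewinds d)" if "d \<le> D" for d
    using that
  proof (induction d)
    case (Suc d)
    then show ?case using assms wf_rewind[of "4 + d" K m] by simp
  qed simp
  ultimately show ?thesis using assms unfolding copy_input_def wf_com.simps by (intro conjI wf_for_tape) auto
qed

lemma wf_block_com: "2 < K \<Longrightarrow> 3 \<le> m \<Longrightarrow> wf_com K m (block_com tm)"
  unfolding block_com_def person_com_def item_com_def
  by (auto intro!: wf_seqs wf_emit wf_digits_emit)

lemma wf_next_col: "2 < K \<Longrightarrow> 3 \<le> m \<Longrightarrow> wf_com K m c \<Longrightarrow> wf_com K m (next_col c)"
  unfolding next_col_def wf_com.simps by (intro conjI wf_inc wf_rewind) auto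

section \<open>Polynomial bounds on running times\<close>

definition poly_bounded :: "(nat \<Rightarrow> nat) \<Rightarrow> bool" where
  "poly_bounded g \<longleftrightarrow> (\<exists>p :: nat poly. \<forall>n. g n \<le> poly p n)"

lemma poly_bounded_mono: "poly_bounded h \<Longrightarrow> (\<And>n. g n \<le> h n) \<Longrightarrow> poly_bounded g"
  unfolding poly_bounded_def using le_trans by blast

lemma poly_bounded_poly: "poly_bounded (poly p)"
  unfolding poly_bounded_def by blast

lemma poly_bounded_const: "poly_bounded (\<lambda>_. c)"
  unfolding poly_bounded_def by (intro exI[of _ "[:c:]"]) simp

lemma poly_bounded_id: "poly_bounded (\<lambda>n. n)"
  unfolding poly_bounded_def by (intro exI[of _ "[:0, 1:]"]) simp

lemma poly_bounded_add: "poly_bounded g \<Longrightarrow> poly_bounded h \<Longrightarrow> poly_bounded (\<lambda>n. g n + h n)"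
  unfolding poly_bounded_def by (metis add_mono poly_add)

lemma poly_bounded_mult: "poly_bounded g \<Longrightarrow> poly_bounded h \<Longrightarrow> poly_bounded (\<lambda>n. g n * h n)"
  unfolding poly_bounded_def by (metis mult_le_mono poly_mult)

lemma poly_bounded_loop_time: "poly_bounded g \<Longrightarrow> poly_bounded (\<lambda>n. loop_time cs n (g n))"
proof (induction cs)
  case Nil
  then show ?case by (simp add: poly_bounded_const)
next
  case (Cons a cs)
  then show ?case
    by (simp only: loop_time.simps)
      (intro poly_bounded_add poly_bounded_mult poly_bounded_const poly_bounded_id Cons)
qed

lemmas poly_bounded_intros =
  poly_bounded_poly poly_bounded_const poly_bounded_id poly_bounded_add poly_bounded_mult poly_bounded_loop_time

lemma horner_coeffs: "horner (coeffs p) n = poly p n"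
proof (induction p)
  case (pCons a p)
  then show ?case by (cases "a = 0 \<and> p = 0") (auto simp: cCons_def)
qed simp

lemma emits_mono: "emits I c f b \<Longrightarrow> b \<le> b' \<Longrightarrow> emits I c f b'"
  unfolding emits_def by (meson mult_le_mono1 runs_weaken)

lemma emits_uniform:
  fixes S :: "nat set"
  assumes "finite S" "\<And>v. v \<in> S \<Longrightarrow> \<exists>b. emits I (c v) (f v) b"
  shows "\<exists>b. \<forall>v\<in>S. emits I (c v) (f v) b"
  using assms
proof (induction S)
  case (insert v S)
  then obtain b where "\<forall>v\<in>S. emits I (c v) (f v) b" by auto
  moreover obtain b' where "emits I (c v) (f v) b'" using insert by auto
  ultimately have "\<forall>w\<in>insert v S. emits I (c w) (f w) (b + b')"
    using emits_mono[of I _ _ b "b + b'"] emits_mono[of I _ _ b' "b + b'"] by auto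
  then show ?case by blast
qed simp

lemma foldl_hom: "(\<And>z d. g (e z) d = e (h z d)) \<Longrightarrow> foldl g (e z) ds = e (foldl h z ds)"
  by (induction ds arbitrary: z) simp_all

definition person_enc :: "nat list \<Rightarrow> bool list" where
  "person_enc us = True # enc_list (enc_list enc_nat) (strict_pref us)"

section \<open>The reduction from a fixed verifier\<close>

locale verifier =
  fixes M :: tm and p r :: "nat poly"
  assumes wf: "wf_tm M"
    and halts: "\<And>x u. length u \<le> poly r (length x) \<Longrightarrow> halted M (run M [x, u] (poly p (length x)))"
begin

definition tls :: "tile list" where
  "tls = (SOME ts. distinct ts \<and> set ts = tiles M)"

lemma tls: "distinct tls" "set tls = tiles M"
proof -
  have "\<exists>ts. distinct ts \<and> set ts = tiles M" using finite_distinct_list[OF finite_tiles] by blast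
  from someI_ex[OF this] show "distinct tls" "set tls = tiles M" by (simp_all add: tls_def)
qed

lemma tls_pos: "0 < length tls"
proof -
  let ?k = "ntapes M"
  have "\<lparr>tflag = False, tst = 0, trd = replicate ?k 0, tsy = replicate ?k 0, thd = replicate ?k False\<rparr> \<in> tiles M"
    using wf by (auto simp: tiles_def wf_tm_def)
  then show ?thesis using tls(2) by (metis length_pos_if_in_set)
qed

text \<open>The second disjunct makes different indices conflict at a single cell even outside the
  range of \<open>tls\<close>, as \<open>conf_same\<close> has no bounds.\<close>

definition conf :: "pair_class \<Rightarrow> nat \<Rightarrow> nat \<Rightarrow> bool" where
  "conf z a b \<longleftrightarrow> conflict M z (tls ! a) (tls ! b) \<or> same_cell z \<and> a \<noteq> b"

sublocale conflicts "length tls" conf same_cell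
  by unfold_locales (rule tls_pos)

text \<open>The maximum exists because \<open>pair_class\<close> is a finite type; the successor
  makes it positive, so that the bits of the budget are those of \<open>R\<close> after
  zeros.\<close>

definition R :: nat where "R = Suc (Max (range body_price))"

sublocale reduction "length tls" conf same_cell pair_class R
proof unfold_locales
  show "same_cell (pair_class ds) = (cell False ds = cell True ds)" if "ds \<in> words 16 L" for L ds
    using that by (rule same_cell_iff)
  show "conf z s s'" if "same_cell z" "s \<noteq> s'" for z s s' using that by (simp add: conf_def)
  show "body_price z \<le> R" for z by (simp add: R_def le_SucI)
  show "0 < R" by (simp add: R_def)
qed

text \<open>The lower bound on the side that \<open>tableau\<close> asks for.\<close>

definition Q :: "nat poly" where
  "Q = smult 2 (p + r + [:2, 1:])"

lemma poly_Q: "poly Q n = 2 * (poly p n + poly r n + n + 2)"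
  by (simp add: Q_def)

definition width :: "nat \<Rightarrow> nat" where
  "width n = length (bits (poly Q n))"

lemma width: "poly Q n < 2 ^ width n" "2 ^ width n \<le> 2 * poly Q n + 1"
  using length_bits[of "poly Q n"] by (simp_all add: width_def)

definition forbidden :: "bool list \<Rightarrow> (nat list \<times> nat) list" where
  "forbidden x = forbs M tls x (poly r (length x)) (width (length x))"

definition reduce :: "bool list \<Rightarrow> mcpi" where
  "reduce x = instance_of (width (length x)) (forbidden x)"

lemma forbidden_ok: "(ds, s) \<in> set (forbidden x) \<Longrightarrow> ds \<in> words 4 (width (length x)) \<and> s < length tls"
  by (auto simp: forbidden_def set_forbs digits2_word)

lemma reduce_yes:
  "mcpi_yes (reduce x) \<longleftrightarrow>
    (\<exists>u. length u \<le> poly r (length x) \<and> accepting M (run M [x, u] (poly p (length x))))"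
proof -
  let ?L = "width (length x)"
  interpret T: tiling M x "poly p (length x)" "poly r (length x)" "2 ^ ?L" tls ?L
  proof unfold_locales
    show "2 * (poly p (length x) + poly r (length x) + length x + 2) \<le> 2 ^ ?L"
      using width(1)[of "length x"] by (simp add: poly_Q)
  qed (use wf halts tls in auto)
  have "csp ?L (forbidden x) F \<longleftrightarrow> T.consistent F" for F
  proof -
    \<comment> \<open>For a cell paired with itself both indices are the same value of
      \<open>F\<close>, so the additional disjunct of \<open>conf\<close> is false.\<close>
    have "conf (pair_class ds) (F (cell False ds)) (F (cell True ds)) \<longleftrightarrow>
        conflict M (pair_class ds) (tls ! F (cell False ds)) (tls ! F (cell True ds))" if "ds \<in> words 16 ?L" for ds
      using same_cell_iff[OF that] by (auto simp: conf_def)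
    then show ?thesis unfolding csp_def T.consistent_def forbidden_def by auto
  qed
  then show ?thesis
    using instance_yes_iff[where forbs = "forbidden x" and L = "width (length x)", OF forbidden_ok] T.consistent_iff by (simp add: reduce_def)
qed

lemma reduce_ok:
  "reduce x \<in> mcpi_instances" "lists_at_most 2 (reduce x)" "from_master_list (reduce x)"
  using instance_ok[where forbs = "forbidden x" and L = "width (length x)", OF forbidden_ok] by (simp_all add: reduce_def)

text \<open>Classes become tape symbols, since the automaton keeps its state in one cell.\<close>

definition code :: "pair_class \<Rightarrow> nat" where
  "code = (SOME e. inj e)"

lemma inj_code: "inj code"
proof -
  have "\<exists>e :: pair_class \<Rightarrow> nat. inj e"
    using finite_imp_inj_to_nat_seg[of "UNIV :: pair_class set"] by auto
  then show ?thesis unfolding code_def by (rule someI_ex)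
qed

definition classes :: nat where "classes = Suc (Max (range code))"

lemma code_less: "code z < classes"
  by (simp add: classes_def less_Suc_eq_le)

definition forbid_com :: "(tile \<Rightarrow> bool) \<Rightarrow> com" where
  "forbid_com F = block_com (concat (map forbid (bads tls F)))"

definition forbid_bits :: "(tile \<Rightarrow> bool) \<Rightarrow> nat list \<Rightarrow> bool list" where
  "forbid_bits F = block_bits (concat (map forbid (bads tls F)))"

definition row_bits :: "nat \<Rightarrow> (nat \<Rightarrow> tile \<Rightarrow> bool) \<Rightarrow> bool list" where
  "row_bits L F = concat (map (\<lambda>j. forbid_bits (F j) (digits 2 L j)) [0..<2 ^ L])"

text \<open>The factor \<open>16 ^ L\<close> contributes four zero bits for each digit of the
  counter, written before the bits of \<open>R\<close>.\<close>

definition budget_com :: com where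
  "budget_com = digits_emit (concat (replicate 4 [\<lambda>_. True, \<lambda>_. False])) ;;
     emit (concat (map (\<lambda>b. [True, b]) (bits R)) @ [False] @ enc_nat 1)"

definition class_com :: com where
  "class_com = classify classes (\<lambda>z d. code (class_step (inv code z) d)) (code class_start)
     (\<lambda>z. block_com (block (inv code z)))"

definition price_bits :: "nat \<Rightarrow> bool list" where
  "price_bits c = True # enc_rat (of_nat (price c))"

text \<open>A common bound on the nesting depth of the three polynomial loops.\<close>

definition loops :: nat where
  "loops = length (coeffs r) + length (coeffs Q) + 1"

definition main :: com where
  "main = prepare loops (coeffs Q) ;;
     input_pass (\<lambda>v. forbid_com (bad_input (min v 2))) ;;
     count_pass (coeffs r) (forbid_com (bad_cert True)) (forbid_com (bad_cert False)) ;;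
     count_pass [1] (forbid_com (bad_start (ntapes M) True)) (forbid_com (bad_start (ntapes M) False)) ;;
     odo 16 class_com ;;
     emit [False] ;;
     seqs (map (\<lambda>c. odo 4 (emit (price_bits c))) [0..<NC]) ;;
     emit [False] ;; budget_com"

lemma emits_forbid: "\<exists>b. emits I (forbid_com F) (forbid_bits F) b"
  unfolding forbid_com_def forbid_bits_def by (rule emits_block)

text \<open>The alphabet contains the codes of the classes and the stored digits of a base 16
  counter, which reach the symbol 16.\<close>

lemma wf_main: "wf_com (4 + loops) (classes + 18) main"
proof -
  have b: "wf_com (4 + loops) (classes + 18) (block_com tm)" for tm by (rule wf_block_com) auto
  have e: "wf_com (4 + loops) (classes + 18) (emit bs)" for bs by (rule wf_emit) (auto simp: One_nat_def)
  have P1: "wf_com (4 + loops) (classes + 18) (prepare loops (coeffs Q))"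
    unfolding prepare_def wf_com.simps
    by (intro conjI wf_copy_input wf_poly_loop wf_grow wf_clear) (auto simp: loops_def)
  have P2: "wf_com (4 + loops) (classes + 18) (input_pass (\<lambda>v. forbid_com (bad_input (min v 2))))"
    unfolding input_pass_def wf_com.simps forbid_com_def
    by (intro conjI wf_for_tape wf_next_col wf_odo b) (auto intro!: b local_read[where f = "\<lambda>v. v = Suc 0"] simp: One_nat_def)
  have P3: "wf_com (4 + loops) (classes + 18) (count_pass cs (forbid_com F) (forbid_com F'))"
    if "length cs \<le> loops" for cs F F'
    using that unfolding count_pass_def wf_com.simps forbid_com_def
    by (intro conjI wf_poly_loop wf_next_col wf_odo b) (auto simp: One_nat_def)
  have P4: "wf_com (4 + loops) (classes + 18) (odo 16 class_com)"
    unfolding class_com_def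
    using code_less by (intro wf_odo wf_classify b) (auto simp: One_nat_def trans_less_add1)
  have P5: "wf_com (4 + loops) (classes + 18) (seqs (map (\<lambda>c. odo 4 (emit (price_bits c))) [0..<NC]))"
    by (rule wf_seqs) (auto intro!: wf_odo e simp: One_nat_def)
  have P6: "wf_com (4 + loops) (classes + 18) budget_com"
    unfolding budget_com_def wf_com.simps by (intro conjI wf_digits_emit e) auto
  have l: "length (coeffs r) \<le> loops" "length [1 :: nat] \<le> loops" by (simp_all add: loops_def One_nat_def)
  show ?thesis
    unfolding main_def wf_com.simps by (intro conjI P1 P2 P3[OF l(1)] P3[OF l(2)] P4 e P5 P6)
qed

lemma concat_person_enc:
  assumes "ds \<in> words 16 L" "\<And>us. us \<in> set tm \<Longrightarrow> person_ok us"
  shows "block_bits tm ds = concat (map person_enc (inst ds tm))"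
proof -
  have "\<forall>us \<in> set tm. \<forall>q \<in> set us. 0 < snd q" using assms(2) unfolding person_ok_def by fastforce
  from block_bits_eq[OF assms(1) this] show ?thesis unfolding person_enc_def .
qed

lemma inst_concat: "inst ds (concat (map g as)) = concat (map (\<lambda>a. inst ds (g a)) as)"
  by (induction as) (simp_all add: inst_def)

lemma row_enc:
  "concat (map person_enc (concat (map (\<lambda>(ds, s). inst ds (forbid s)) (row_forbs tls L F)))) =
   row_bits L F"
proof -
  have "concat (map person_enc (concat (map (\<lambda>(ds, s). inst ds (forbid s)) (map (Pair (digits 2 L j)) (bads tls (F j)))))) =
      forbid_bits (F j) (digits 2 L j)" if "j < 2 ^ L" for j
  proof -
    have "forbid_bits (F j) (digits 2 L j) = concat (map person_enc (inst (digits 2 L j) (concat (map forbid (bads tls (F j))))))"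
      unfolding forbid_bits_def
      by (rule concat_person_enc[OF words_4_16[OF digits2_word(1)[OF that]]]) (auto simp: bads_def intro: forbid_ok)
    then show ?thesis by (simp add: inst_concat o_def)
  qed
  then have "concat (map person_enc (concat (map (\<lambda>(ds, s). inst ds (forbid s))
      (concat (map (\<lambda>j. map (Pair (digits 2 L j)) (bads tls (F j))) js))))) =
      concat (map (\<lambda>j. forbid_bits (F j) (digits 2 L j)) js)" if "set js \<subseteq> {..<2 ^ L}" for js
    using that by (induction js) simp_all
  from this[of "[0..<2 ^ L]"] show ?thesis unfolding row_forbs_def row_bits_def by (simp add: atLeast0LessThan)
qed

text \<open>Items with the same code have consecutive numbers, so the price list can be written code
  by code without the number of an item.\<close>

lemma concat_blocks:
  "0 < m \<Longrightarrow> concat (map (\<lambda>c. concat (map (\<lambda>j. g c) [0..<m])) [0..<n]) = concat (map (\<lambda>b. g (b div m)) [0..<n * m])"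
proof (induction n)
  case (Suc n)
  have "[0..<Suc n * m] = [0..<n * m] @ map (\<lambda>j. j + n * m) [0..<m]"
    using upt_add_eq_append[of 0 "n * m" m] map_add_upt[of "n * m" m] by (simp add: add.commute)
  moreover have "concat (map (\<lambda>b. g (b div m)) (map (\<lambda>j. j + n * m) [0..<m])) = concat (map (\<lambda>j. g n) [0..<m])"
    using Suc.prems by (auto intro!: arg_cong[of _ _ concat])
  ultimately show ?case using Suc by simp
qed simp

text \<open>Brings the encoding into the order in which \<open>main\<close> writes it.\<close>

lemma enc_reduce:
  fixes x :: "bool list"
  defines "L \<equiv> width (length x)"
  shows "enc_mcpi (reduce x) =
    row_bits L (\<lambda>j. bad_input (contents_of x (int j))) @
    row_bits L (\<lambda>j. bad_cert (j < poly r (length x))) @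
    row_bits L (\<lambda>j. bad_start (ntapes M) (j = 0)) @
    concat (map (\<lambda>j. block_bits (block (pair_class (digits 16 L j))) (digits 16 L j)) [0..<16 ^ L]) @ [False] @
    concat (map (\<lambda>c. concat (map (\<lambda>j. price_bits c) [0..<4 ^ L])) [0..<NC]) @ [False] @
    enc_rat (of_nat (R * 16 ^ L))"
proof -
  have 1: "concat (map person_enc (concat (map (\<lambda>(ds, s). inst ds (forbid s)) (forbidden x)))) =
    row_bits L (\<lambda>j. bad_input (contents_of x (int j))) @
    row_bits L (\<lambda>j. bad_cert (j < poly r (length x))) @
    row_bits L (\<lambda>j. bad_start (ntapes M) (j = 0))"
    unfolding forbidden_def forbs_def L_def[symmetric] map_append concat_append row_enc by (rule refl)
  have 2: "concat (map person_enc (concat (map (\<lambda>j. inst (digits 16 L j) (block (pair_class (digits 16 L j)))) js))) =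
    concat (map (\<lambda>j. block_bits (block (pair_class (digits 16 L j))) (digits 16 L j)) js)" for js
  proof (induction js)
    case (Cons j js)
    have "block_bits (block (pair_class (digits 16 L j))) (digits 16 L j) =
        concat (map person_enc (inst (digits 16 L j) (block (pair_class (digits 16 L j)))))"
      by (rule concat_person_enc[OF digits_words block_ok]) simp
    with Cons show ?case by simp
  qed simp
  have 3: "enc_list (enc_list (enc_list enc_nat)) (map strict_pref as) = concat (map person_enc as) @ [False]" for as
    by (simp add: enc_list_def[of _ "map strict_pref as"] person_enc_def[abs_def] o_def)
  have 4: "enc_list enc_rat (map (\<lambda>b. of_nat (price (b div 4 ^ L))) [0..<NC * 4 ^ L]) =
      concat (map (\<lambda>c. concat (map (\<lambda>j. price_bits c) [0..<4 ^ L])) [0..<NC]) @ [False]"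
    unfolding enc_list_def price_bits_def
    using concat_blocks[of "4 ^ L" "\<lambda>c. True # enc_rat (of_nat (price c))" NC] by (simp add: o_def)
  show ?thesis
    unfolding enc_mcpi_def reduce_def instance_of_def L_def[symmetric] mcpi.simps 3 4
    unfolding persons_def map_append concat_append 1 2 by simp
qed

lemma budget_enc: "\<exists>b. \<forall>I. emits I budget_com (\<lambda>ds. enc_rat (of_nat (R * 16 ^ length ds))) b"
proof -
  have eq: "enc_rat (of_nat (R * 16 ^ length ds)) =
      concat (map (\<lambda>d. map (\<lambda>g. g d) (concat (replicate 4 [\<lambda>_ :: nat. True, \<lambda>_. False]))) ds) @
      (concat (map (\<lambda>b. [True, b]) (bits R)) @ [False] @ enc_nat 1)" for ds :: "nat list"
  proof -
    have "R * 16 ^ length ds = R * 2 ^ (4 * length ds)" by (simp add: power_mult)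
    then have b: "bits (R * 16 ^ length ds) = replicate (4 * length ds) False @ bits R"
      using bits_shift R(2) by simp
    have "concat (map (\<lambda>b. [True, b]) (replicate (4 * n) False)) =
        concat (map (\<lambda>d. map (\<lambda>g. g d) (concat (replicate 4 [\<lambda>_ :: nat. True, \<lambda>_. False]))) ds)" if "length ds = n" for n
      using that by (induction ds arbitrary: n) (auto simp: numeral_eq_Suc)
    then show ?thesis unfolding enc_rat_of_nat enc_nat_bits[of "R * 16 ^ length ds"] b by simp
  qed
  have "\<exists>b. emits (\<lambda>_. True) budget_com (\<lambda>ds. enc_rat (of_nat (R * 16 ^ length ds))) b"
    unfolding budget_com_def eq by (intro emits_Seq_ex emits_emit emits_digits_emit)
  then show ?thesis using emits_weaken by blast
qed

lemma classify_enc: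
  "\<exists>b. emits (\<lambda>t. t = tape_of [] 0) class_com (\<lambda>ds. block_bits (block (pair_class ds)) ds) b"
proof -
  have "\<exists>b. emits (\<lambda>t. t = tape_of [] 0) class_com
       (\<lambda>ds. block_bits (block (inv code (foldl (\<lambda>z d. code (class_step (inv code z) d)) (code class_start) ds))) ds) b"
    unfolding class_com_def by (rule emits_classify[where f = "\<lambda>z. block_bits (block (inv code z))"]) (auto intro: emits_block code_less)
  moreover have "foldl (\<lambda>z d. code (class_step (inv code z) d)) (code z) ds = code (foldl class_step z ds)" for z ds
    by (rule foldl_hom) (simp add: inv_f_f[OF inj_code])
  ultimately show ?thesis by (simp add: inv_f_f[OF inj_code] pair_class_def)
qed

text \<open>\<open>2 ^ width n\<close> is linear in the value of \<open>Q\<close>, so its fixed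
  powers, which count cells and pairs of cells, are polynomial.\<close>

lemma poly_bounded_power: "poly_bounded (\<lambda>n. (2 ^ k) ^ width n)"
proof -
  have 2: "poly_bounded (\<lambda>n. 2 ^ width n)"
    by (rule poly_bounded_mono[where h = "\<lambda>n. 2 * poly Q n + 1"]) (intro poly_bounded_intros, rule width(2))
  have "poly_bounded (\<lambda>n. (2 ^ width n) ^ k)"
    by (induction k) (simp_all add: poly_bounded_const poly_bounded_mult[OF 2])
  then show ?thesis by (simp add: power_commuting_commutes mult.commute flip: power_mult)
qed

lemma poly_bounded_width: "poly_bounded width"
proof (rule poly_bounded_mono[OF poly_bounded_power[of 1]])
  show "width n \<le> (2 ^ 1) ^ width n" for n using less_exp[of "width n"] by simp
qed

lemma main_runs:
  "\<exists>T. poly_bounded T \<and> (\<forall>x. runs main (initial_store x)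
     (base (map bsym x) loops (width (length x)) (enc_mcpi (reduce x))) (T (length x)))"
proof -
  \<comment> \<open>\<open>stage_input_pass\<close> wants one time bound for all symbols
    \<open>v\<close>; \<open>min v 2\<close> leaves only finitely many programs.\<close>
  obtain b1 where b1: "\<forall>v\<in>{..2}. emits (\<lambda>_. True) (forbid_com (bad_input (min v 2))) (forbid_bits (bad_input (min v 2))) b1"
    using emits_uniform[of "{..2}" "\<lambda>_. True" "\<lambda>v. forbid_com (bad_input (min v 2))"
      "\<lambda>v. forbid_bits (bad_input (min v 2))", OF finite_atMost emits_forbid] by blast
  have b1: "emits (\<lambda>_. True) (forbid_com (bad_input (min v 2))) (forbid_bits (bad_input (min v 2))) b1" for v
    using b1[rule_format, of "min v 2"] by simp
  obtain b2 b2' b3 b3' where b23: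
    "emits (\<lambda>_. True) (forbid_com (bad_cert True)) (forbid_bits (bad_cert True)) b2"
    "emits (\<lambda>_. True) (forbid_com (bad_cert False)) (forbid_bits (bad_cert False)) b2'"
    "emits (\<lambda>_. True) (forbid_com (bad_start (ntapes M) True)) (forbid_bits (bad_start (ntapes M) True)) b3"
    "emits (\<lambda>_. True) (forbid_com (bad_start (ntapes M) False)) (forbid_bits (bad_start (ntapes M) False)) b3'"
    using emits_forbid by metis
  obtain b4 where b4: "emits (\<lambda>t. t = tape_of [] 0) class_com (\<lambda>ds. block_bits (block (pair_class ds)) ds) b4"
    using classify_enc by blast
  obtain b5 where b5: "emits (\<lambda>_. True) (emit [False]) (\<lambda>_. [False]) b5" using emits_emit by blast
  obtain b6 where b6: "\<forall>c\<in>{..<NC}. emits (\<lambda>_. True) (emit (price_bits c)) (\<lambda>_. price_bits c) b6"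
    using emits_uniform[of "{..<NC}" "\<lambda>_. True" "\<lambda>c. emit (price_bits c)"
      "\<lambda>c _. price_bits c", OF finite_lessThan emits_emit] by blast
  obtain b7 where b7: "emits (\<lambda>_. True) budget_com (\<lambda>ds. enc_rat (of_nat (R * 16 ^ length ds))) b7"
    using budget_enc by blast
  define w where "w = (\<lambda>b n. (b + 20) * (width n + 1))"
  define t0 where "t0 = (\<lambda>n. n * (2 * loops + 4) + 3 * n + 8 + loops * (3 * n + 6) +
    loop_time (coeffs Q) n (6 * poly Q n + 20) + 6 * width n + 12)"
  define t1 where "t1 = (\<lambda>n. n * ((b1 + 21) * (width n + 1) + 4) + 3 * n + 7 + ((2 ^ 1) ^ width n + 1) * w b1 n + 1)"
  define t2 where "t2 = (\<lambda>n. loop_time (coeffs r) n (w b2 n) + ((2 ^ 1) ^ width n + 1) * w b2' n + 1)"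
  define t3 where "t3 = (\<lambda>n. loop_time [1] n (w b3 n) + ((2 ^ 1) ^ width n + 1) * w b3' n + 1)"
  define t4 where "t4 = (\<lambda>n. ((2 ^ 4) ^ width n + 1) * w b4 n)"
  define t5 where "t5 = w b5"
  define t6 where "t6 = (\<lambda>n. NC * (((2 ^ 2) ^ width n + 1) * w b6 n + 1))"
  define t7 where "t7 = w b7"
  define T where "T = (\<lambda>n. t0 n + (t1 n + (t2 n + (t3 n + (t4 n + (t5 n + (t6 n + (t5 n + t7 n + 1) + 1) + 1) + 1) + 1) + 1) + 1) + 1)"
  have w: "poly_bounded (w b)" for b
    unfolding w_def by (intro poly_bounded_intros poly_bounded_width)
  have "poly_bounded T"
    unfolding T_def t0_def t1_def t2_def t3_def t4_def t5_def t6_def t7_def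
    by (intro poly_bounded_intros poly_bounded_width poly_bounded_power w)
  moreover have "runs main (initial_store x)
     (base (map bsym x) loops (width (length x)) (enc_mcpi (reduce x))) (T (length x))" for x
  proof -
    let ?n = "length x"
    let ?L = "width ?n"
    let ?xs = "map bsym x"
    note st = stage_def[of ?xs loops ?L]
    have xs: "0 \<notin> set ?xs" by auto
    have 0: "runs (prepare loops (coeffs Q)) (initial_store x) (base ?xs loops ?L []) (t0 ?n)"
      using runs_prepare[of "coeffs Q" loops x "t0 ?n"]
      by (simp add: horner_coeffs width_def t0_def loops_def)
    have less: "?n < 2 ^ ?L" "poly r ?n < 2 ^ ?L" "1 < (2 :: nat) ^ ?L" using width(1)[of ?n] by (auto simp: poly_Q)
    have "stage ?xs loops ?L (input_pass (\<lambda>v. forbid_com (bad_input (min v 2))))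
        (concat (map (\<lambda>j. forbid_bits (bad_input (min (contents_of x (int j)) 2)) (digits 2 ?L j)) [0..<2 ^ ?L])) (t1 ?n)"
      by (rule stage_input_pass[where g = "\<lambda>v. forbid_bits (bad_input (min v 2))", OF b1 less(1)]) (simp add: t1_def w_def)
    moreover have "min (contents_of x k) 2 = contents_of x k" for k by (simp add: contents_of_def)
    ultimately have 1: "stage ?xs loops ?L (input_pass (\<lambda>v. forbid_com (bad_input (min v 2))))
        (row_bits ?L (\<lambda>j. bad_input (contents_of x (int j)))) (t1 ?n)" by (simp add: row_bits_def)
    have "stage ?xs loops ?L (count_pass (coeffs r) (forbid_com (bad_cert True)) (forbid_com (bad_cert False)))
        (concat (map (\<lambda>j. (if j < horner (coeffs r) (length ?xs) then forbid_bits (bad_cert True) else forbid_bits (bad_cert False)) (digits 2 ?L j)) [0..<2 ^ ?L])) (t2 ?n)"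
      by (rule stage_count_pass[OF b23(1,2)]) (use less xs in \<open>simp_all add: t2_def w_def horner_coeffs loops_def\<close>)
    moreover have "(if j < horner (coeffs r) (length ?xs) then forbid_bits (bad_cert True) else forbid_bits (bad_cert False)) =
        forbid_bits (bad_cert (j < poly r ?n))" for j by (simp add: horner_coeffs)
    ultimately have 2: "stage ?xs loops ?L (count_pass (coeffs r) (forbid_com (bad_cert True)) (forbid_com (bad_cert False)))
        (row_bits ?L (\<lambda>j. bad_cert (j < poly r ?n))) (t2 ?n)" by (simp add: row_bits_def)
    have "stage ?xs loops ?L (count_pass [1] (forbid_com (bad_start (ntapes M) True)) (forbid_com (bad_start (ntapes M) False)))
        (concat (map (\<lambda>j. (if j < horner [1] (length ?xs) then forbid_bits (bad_start (ntapes M) True) else forbid_bits (bad_start (ntapes M) False)) (digits 2 ?L j)) [0..<2 ^ ?L])) (t3 ?n)"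
      by (rule stage_count_pass[OF b23(3,4)]) (use less xs in \<open>simp_all add: t3_def w_def loops_def\<close>)
    moreover have "(if j < horner [1] (length ?xs) then forbid_bits (bad_start (ntapes M) True) else forbid_bits (bad_start (ntapes M) False)) =
        forbid_bits (bad_start (ntapes M) (j = 0))" for j by (simp add: One_nat_def)
    ultimately have 3: "stage ?xs loops ?L (count_pass [1] (forbid_com (bad_start (ntapes M) True)) (forbid_com (bad_start (ntapes M) False)))
        (row_bits ?L (\<lambda>j. bad_start (ntapes M) (j = 0))) (t3 ?n)" by (simp add: row_bits_def)
    note 4 = stage_odo[OF b4, where B = 16 and L = ?L and t = "t4 ?n" and xs = ?xs and D = loops]
    have 4: "stage ?xs loops ?L (odo 16 class_com)
        (concat (map (\<lambda>j. block_bits (block (pair_class (digits 16 ?L j))) (digits 16 ?L j)) [0..<16 ^ ?L])) (t4 ?n)"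
      by (rule 4) (simp_all add: t4_def w_def)
    have 5: "stage ?xs loops ?L (emit [False]) [False] (t5 ?n)"
      by (rule stage_emits[OF b5]) (simp_all add: t5_def w_def)
    have "stage ?xs loops ?L (seqs (map (\<lambda>c. odo 4 (emit (price_bits c))) [0..<NC]))
        (concat (map (\<lambda>c. concat (map (\<lambda>j. price_bits c) [0..<4 ^ ?L])) [0..<NC]))
        (length [0..<NC] * (((2 ^ 2) ^ width ?n + 1) * w b6 ?n + 1))"
    proof (rule stage_seqs)
      fix c assume "c \<in> set [0..<NC]"
      then have c: "emits (\<lambda>_. True) (emit (price_bits c)) (\<lambda>_. price_bits c) b6"
        using b6 by simp
      show "stage ?xs loops ?L (odo 4 (emit (price_bits c)))
          (concat (map (\<lambda>j. price_bits c) [0..<4 ^ ?L])) (((2 ^ 2) ^ width ?n + 1) * w b6 ?n)"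
        by (rule stage_odo[OF c, where B = 4]) (simp_all add: w_def)
    qed
    then have 6: "stage ?xs loops ?L (seqs (map (\<lambda>c. odo 4 (emit (price_bits c))) [0..<NC]))
        (concat (map (\<lambda>c. concat (map (\<lambda>j. price_bits c) [0..<4 ^ ?L])) [0..<NC])) (t6 ?n)"
      by (simp add: t6_def)
    have "stage ?xs loops ?L budget_com (enc_rat (of_nat (R * 16 ^ length (digits 2 ?L 0)))) (t7 ?n)"
      by (rule stage_emits[OF b7, where L = ?L]) (simp_all add: t7_def w_def)
    then have 7: "stage ?xs loops ?L budget_com (enc_rat (of_nat (R * 16 ^ ?L))) (t7 ?n)" by simp
    note S = stage_Seq[OF 1 stage_Seq[OF 2 stage_Seq[OF 3 stage_Seq[OF 4 stage_Seq[OF 5 stage_Seq[OF 6 stage_Seq[OF 5 7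
      order_refl] order_refl] order_refl] order_refl] order_refl] order_refl] order_refl]
    show ?thesis
      unfolding main_def enc_reduce T_def
      by (rule runs_Seq[OF 0 S[unfolded st, rule_format, of "[]", unfolded append_Nil] order_refl])
  qed
  ultimately show ?thesis by blast
qed

theorem polytime_reduce: "polytime_computable (\<lambda>x. enc_mcpi (reduce x))"
proof -
  from main_runs obtain T where T: "poly_bounded T" "\<And>x. runs main (initial_store x)
     (base (map bsym x) loops (width (length x)) (enc_mcpi (reduce x))) (T (length x))" by blast
  then obtain q where q: "\<And>n. T n \<le> poly q n" unfolding poly_bounded_def by blast
  have "main \<noteq> Skip" by (simp add: main_def)
  from com_tm_correct[OF wf_main _ _ this] obtain N where N: "wf_tm N"
    "\<And>x s b t. runs main (initial_store x) s b \<Longrightarrow> b \<le> t \<Longrightarrow>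
       halted N (run N [x] t) \<and> snd (run N [x] t) = map s [0..<4 + loops]" by auto
  show ?thesis
    unfolding polytime_computable_def Let_def
  proof (intro exI[of _ N] exI[of _ q] conjI N(1) allI)
    fix x
    note * = N(2)[OF T(2) q, of x]
    show "halted N (run N [x] (poly q (length x)))" using * by blast
    have "snd (run N [x] (poly q (length x))) ! 1 = outp (enc_mcpi (reduce x))" using * by simp
    then show "fst (snd (run N [x] (poly q (length x))) ! 1) = contents_of (enc_mcpi (reduce x))"
      by (simp add: outp_def fst_tape_of_bsym)
  qed
qed

end

text \<open>The reduction lands in the smallest of the considered sets of instances, so one map
  serves every \<open>D\<close> above it. Injectivity of the encoding turns membership in the image
  of the yes-instances into being a yes-instance.\<close>

lemma hardness:
  assumes D: "D \<subseteq> mcpi_instances" "{I \<in> mcpi_instances. lists_at_most 2 I \<and> from_master_list I} \<subseteq> D"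
  shows "NP_hard enc_mcpi D mcpi_yes"
  unfolding NP_hard_def
proof
  fix A assume "A \<in> NP"
  then obtain M and p r :: "nat poly" where M: "wf_tm M"
    "\<And>x u. length u \<le> poly r (length x) \<Longrightarrow> halted M (run M [x, u] (poly p (length x)))"
    "\<And>x. x \<in> A \<longleftrightarrow> (\<exists>u. length u \<le> poly r (length x) \<and> accepting M (run M [x, u] (poly p (length x))))"
    unfolding NP_def by blast
  interpret verifier M p r using M(1,2) by unfold_locales
  have inD: "reduce x \<in> D" for x using reduce_ok[of x] D(2) by blast
  have "x \<in> A \<longleftrightarrow> enc_mcpi (reduce x) \<in> enc_mcpi ` {I \<in> D. mcpi_yes I}" for x
  proof -
    have "enc_mcpi (reduce x) \<in> enc_mcpi ` {I \<in> D. mcpi_yes I} \<longleftrightarrow> mcpi_yes (reduce x)"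
    proof
      assume "enc_mcpi (reduce x) \<in> enc_mcpi ` {I \<in> D. mcpi_yes I}"
      then obtain I where I: "enc_mcpi (reduce x) = enc_mcpi I" "I \<in> D" "mcpi_yes I" by blast
      then have "reduce x = I" using inj_onD[OF inj_on_enc_mcpi I(1)] inD D(1) by blast
      with I show "mcpi_yes (reduce x)" by simp
    qed (use inD in blast)
    with reduce_yes M(3) show ?thesis by simp
  qed
  with polytime_reduce inD show "\<exists>f. polytime_computable f \<and>
      (\<forall>x. f x \<in> enc_mcpi ` D \<and> (x \<in> A \<longleftrightarrow> f x \<in> enc_mcpi ` {I \<in> D. mcpi_yes I}))"
    by (intro exI[of _ "\<lambda>x. enc_mcpi (reduce x)"]) blast
qed

theorem theorem2:
  "NP_hard enc_mcpi mcpi_instances mcpi_yes \<and>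
   NP_hard enc_mcpi {I \<in> mcpi_instances. lists_at_most 2 I} mcpi_yes \<and>
   NP_hard enc_mcpi {I \<in> mcpi_instances. lists_at_most 2 I \<and> from_master_list I} mcpi_yes"
  by (intro conjI hardness) auto

end
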